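(* Let $g\ge 2$. The generalized cone complex $T^{\mathrm{trop}}_g=\varinjlim(\sigma_{(G,P)},\iota_\gamma)$ satisfies: (1) its points are in natural bijection with isomorphism classes of pairs $(\Gamma,\theta)$, where $\Gamma$ is a tropical curve of genus $g$ and $\theta\in T^{\mathrm{trop}}_\Gamma$ (two pairs identified when $\Gamma\cong\Gamma'$ via an isomorphism carrying $\theta$ to $\theta'$), and there is a stratification $T^{\mathrm{trop}}_g=\bigsqcup_{[G,P]} T^{\mathrm{trop}}_{(G,P)}$ over isomorphism classes of pairs $(G,P)$ with $G$ a stable weighted graph of genus $g$ and $P\in\mathcal C_G$, modulo $\operatorname{Aut}(G)$; (2) $T^{\mathrm{trop}}_{(G,P)}\cong \sigma^o_{(G,P)}/\operatorname{Aut}(G,P)$; (3) $T^{\mathrm{trop}}_g$ is connected and of pure dimension $3g-3$; (4) $T^{\mathrm{trop}}_{(G',P')}\subseteq\overline{T^{\mathrm{trop}}_{(G,P)}}$ if and only if $(G,P)\ge(G',P')$.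
   Context: A stable weighted graph $(G,w)$, $G=(V,E)$ finite connected (loops and multiple edges allowed), has $w\colon V\to\mathbb Z_{\ge0}$ with $2w(v)-2+\deg(v)>0$; its genus is $\sum w(v)+|E|-|V|+1$. A tropical curve is $\Gamma=(G,w,\ell)$ with $(G,w)$ stable and $\ell\colon E\to\mathbb R_{>0}$; $T^{\mathrm{trop}}_\Gamma$ is its set of theta-characteristics (classes $[D]\in\operatorname{Pic}(\Gamma)$ with $[2D]=[K_\Gamma]$, $K_\Gamma=\sum_v(2w(v)-2+\deg(v))v$). $\mathcal C_G$ is the set of $P\subseteq E$ such that every vertex has even degree in $P$; for $P\in\mathcal C_G$ let $T_P=\sum_{v}(\frac{\deg_P(v)}2-1+w(v))v+\sum_{e\notin P}p_e$ ($p_e$ the mid-point of $e$); $P\mapsto[T_P]$ is a bijection $\mathcal C_G\to T^{\mathrm{trop}}_\Gamma$. For pairs $(G,P),(G',P')$ with $G,G'$ stable of genus $g$, write $(G,P)\ge(G',P')$ if there is a weighted edge contraction $\gamma\colon G\to G'$ (contracting a set of edges, so that $E(G')$ is identified with the non-contracted edges and weights are updated to preserve genus) with $P'=\gamma_*P$, the set of non-contracted edges of $P$. Let $\operatorname{Aut}(G,P)$ be the subgroup of $\operatorname{Aut}(G)$ (weight-preserving) fixing $P$. Consider the category whose objects are isomorphism classes of pairs $(G,P)$ and whose arrows are generated by such contractions and by elements of $\operatorname{Aut}(G,P)$. To $(G,P)$ associate the cone $\sigma_{(G,P)}=\mathbb R_{\ge0}^{E(G)}$ (integral structure $\mathbb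 Z^{E(G)}$), with interior $\sigma^o_{(G,P)}=\mathbb R^{E(G)}_{>0}$; to a contraction $\gamma$ the face inclusion $\iota_\gamma\colon\sigma_{(G',P')}\hookrightarrow\sigma_{(G,P)}$ onto the face where coordinates of contracted edges vanish; to an automorphism the induced coordinate permutation. $T^{\mathrm{trop}}_g$ is the colimit of this diagram; a point $\underline l\in\sigma^o_{(G,P)}$ corresponds to $(\Gamma,[T_P])$ with $\Gamma=(G,w,\ell)$, $\ell(e)=l_e$. $T^{\mathrm{trop}}_{(G,P)}$ denotes the set of isomorphism classes of pairs $(\Gamma,[T_P])$ with $\Gamma$ of combinatorial type $(G,w)$. *)

theory Defs
  imports "HOL-Analysis.Analysis"
begin

section \<open>Weighted graphs (loops and multiple edges allowed)\<close>

text \<open>Vertices and edges are natural numbers. An edge e in E has endpoints ends e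
(an ordered pair used only as an arbitrary orientation); wt is the weight function.\<close>

record sgraph =
  V :: "nat set"
  E :: "nat set"
  ends :: "nat \<Rightarrow> nat \<times> nat"
  wt :: "nat \<Rightarrow> nat"

text \<open>Degree of v in the edge set P (a loop counts twice).\<close>
definition degP :: "sgraph \<Rightarrow> nat set \<Rightarrow> nat \<Rightarrow> nat" where
  "degP G P v = card {e \<in> P. fst (ends G e) = v} + card {e \<in> P. snd (ends G e) = v}"

definition deg :: "sgraph \<Rightarrow> nat \<Rightarrow> nat" where
  "deg G v = degP G (E G) v"

text \<open>Adjacency relation induced by an edge set.\<close>
definition adj :: "sgraph \<Rightarrow> nat set \<Rightarrow> (nat \<times> nat) set" where
  "adj G F = {(fst (ends G e), snd (ends G e)) | e. e \<in> F}
           \<union> {(snd (ends G e), fst (ends G e)) | e. e \<in> F}"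

definition stable_graph :: "sgraph \<Rightarrow> bool" where
  "stable_graph G \<longleftrightarrow> finite (V G) \<and> finite (E G) \<and> V G \<noteq> {} \<and>
     (\<forall>e \<in> E G. fst (ends G e) \<in> V G \<and> snd (ends G e) \<in> V G) \<and>
     (\<forall>u \<in> V G. \<forall>v \<in> V G. (u, v) \<in> (adj G (E G))\<^sup>*) \<and>
     (\<forall>v \<in> V G. 2 * int (wt G v) - 2 + int (deg G v) > 0)"

definition genus :: "sgraph \<Rightarrow> int" where
  "genus G = (\<Sum>v \<in> V G. int (wt G v)) + int (card (E G)) - int (card (V G)) + 1"

text \<open>The set C_G: subsets of edges with every vertex of even degree.\<close>
definition cyc :: "sgraph \<Rightarrow> nat set \<Rightarrow> bool" where
  "cyc G P \<longleftrightarrow> P \<subseteq> E G \<and> (\<forall>v \<in> V G. even (degP G P v))"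

text \<open>Objects: pairs (G,P), G stable of genus g, P in C_G.\<close>
definition Obj :: "nat \<Rightarrow> (sgraph \<times> nat set) set" where
  "Obj g = {(G, P). stable_graph G \<and> genus G = int g \<and> cyc G P}"

section \<open>Weighted edge contractions (up to isomorphism)\<close>

text \<open>contr G P G' P' S phi psi: G' is (isomorphic to) the weighted contraction of G
along the edge set S; phi sends vertices of G to the vertex of G' they are
contracted to, psi identifies the non-contracted edges with E G'.  With S = {}
this is exactly an isomorphism of pairs.\<close>
definition contr :: "sgraph \<Rightarrow> nat set \<Rightarrow> sgraph \<Rightarrow> nat set \<Rightarrow> nat set
                     \<Rightarrow> (nat \<Rightarrow> nat) \<Rightarrow> (nat \<Rightarrow> nat) \<Rightarrow> bool" where
  "contr G P G' P' S \<phi> \<psi> \<longleftrightarrow>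
     S \<subseteq> E G \<and> \<phi> ` V G = V G' \<and> bij_betw \<psi> (E G - S) (E G') \<and>
     (\<forall>e \<in> S. \<phi> (fst (ends G e)) = \<phi> (snd (ends G e))) \<and>
     (\<forall>e \<in> E G - S. ends G' (\<psi> e) = (\<phi> (fst (ends G e)), \<phi> (snd (ends G e)))
                   \<or> ends G' (\<psi> e) = (\<phi> (snd (ends G e)), \<phi> (fst (ends G e)))) \<and>
     (\<forall>v' \<in> V G'.
        (let F = {v \<in> V G. \<phi> v = v'};
             SF = {e \<in> S. \<phi> (fst (ends G e)) = v'}
         in (\<forall>u \<in> F. \<forall>v \<in> F. (u, v) \<in> (adj G SF)\<^sup>*) \<and>
            int (wt G' v') = (\<Sum>v \<in> F. int (wt G v)) + int (card SF) - int (card F) + 1)) \<and>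
     P' = \<psi> ` (P - S)"

definition pair_ge :: "sgraph \<times> nat set \<Rightarrow> sgraph \<times> nat set \<Rightarrow> bool" where
  "pair_ge GP GP' \<longleftrightarrow> (\<exists>S \<phi> \<psi>. contr (fst GP) (snd GP) (fst GP') (snd GP') S \<phi> \<psi>)"

definition pair_iso :: "sgraph \<times> nat set \<Rightarrow> sgraph \<times> nat set \<Rightarrow> bool" where
  "pair_iso GP GP' \<longleftrightarrow> (\<exists>\<phi> \<psi>. contr (fst GP) (snd GP) (fst GP') (snd GP') {} \<phi> \<psi>)"

section \<open>Cones and the generalized cone complex\<close>

definition cone :: "sgraph \<Rightarrow> (nat \<Rightarrow> real) set" where
  "cone G = {x. (\<forall>e. 0 \<le> x e) \<and> (\<forall>e. e \<notin> E G \<longrightarrow> x e = 0)}"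

definition cone_int :: "sgraph \<Rightarrow> (nat \<Rightarrow> real) set" where
  "cone_int G = {x. (\<forall>e \<in> E G. 0 < x e) \<and> (\<forall>e. e \<notin> E G \<longrightarrow> x e = 0)}"

text \<open>The face map iota_gamma : sigma_(G',P') -> sigma_(G,P).\<close>
definition iota :: "sgraph \<Rightarrow> nat set \<Rightarrow> (nat \<Rightarrow> nat) \<Rightarrow> (nat \<Rightarrow> real) \<Rightarrow> (nat \<Rightarrow> real)" where
  "iota G S \<psi> x' = (\<lambda>e. if e \<in> E G - S then x' (\<psi> e) else 0)"

type_synonym cpt = "(sgraph \<times> nat set) \<times> (nat \<Rightarrow> real)"

text \<open>Disjoint union of the cones (each with its Euclidean topology).\<close>
definition sumtop :: "nat \<Rightarrow> cpt topology" where
  "sumtop g = sum_topology (\<lambda>GP. subtopology euclidean (cone (fst GP))) (Obj g)"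

text \<open>Generating relation of the colimit: a point of a face is identified with its
image under the face map (contractions, including isomorphisms/automorphisms).\<close>
definition gen_rel :: "nat \<Rightarrow> (cpt \<times> cpt) set" where
  "gen_rel g = {(((G', P'), x'), ((G, P), iota G S \<psi> x')) | G P G' P' S \<phi> \<psi> x'.
      (G, P) \<in> Obj g \<and> (G', P') \<in> Obj g \<and> contr G P G' P' S \<phi> \<psi> \<and> x' \<in> cone G'}"

definition ceq :: "nat \<Rightarrow> (cpt \<times> cpt) set" where
  "ceq g = (gen_rel g \<union> (gen_rel g)\<inverse>)\<^sup>*"

definition cls :: "nat \<Rightarrow> cpt \<Rightarrow> cpt set" where
  "cls g a = ceq g `` {a}"

text \<open>Points of T_g^trop.\<close>
definition Tg :: "nat \<Rightarrow> cpt set set" where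
  "Tg g = topspace (sumtop g) // ceq g"

text \<open>Colimit (quotient) topology: U open iff its preimage is open.\<close>
definition Ttop :: "nat \<Rightarrow> cpt set topology" where
  "Ttop g = topology_generated_by {U. U \<subseteq> Tg g \<and> openin (sumtop g) (\<Union>U)}"

text \<open>The stratum T_(G,P) (image of the open cone).\<close>
definition strat :: "nat \<Rightarrow> sgraph \<Rightarrow> nat set \<Rightarrow> cpt set set" where
  "strat g G P = {cls g ((G, P), x) | x. x \<in> cone_int G}"

section \<open>Tropical curves, divisors, theta characteristics\<close>

type_synonym tcurve = "sgraph \<times> (nat \<Rightarrow> real)"

definition trop_curve :: "nat \<Rightarrow> tcurve \<Rightarrow> bool" where
  "trop_curve g \<Gamma> \<longleftrightarrow> stable_graph (fst \<Gamma>) \<and> genus (fst \<Gamma>) = int g \<and>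
     (\<forall>e \<in> E (fst \<Gamma>). snd \<Gamma> e > 0)"

text \<open>Points of the metric graph: vertices, and interior points of edges at
distance t from the first endpoint of the edge.\<close>
datatype tpt = Vt nat | Ep nat real

definition pts :: "tcurve \<Rightarrow> tpt set" where
  "pts \<Gamma> = Vt ` V (fst \<Gamma>) \<union> {Ep e t | e t. e \<in> E (fst \<Gamma>) \<and> 0 < t \<and> t < snd \<Gamma> e}"

definition Div :: "tcurve \<Rightarrow> (tpt \<Rightarrow> int) set" where
  "Div \<Gamma> = {D. finite {p. D p \<noteq> 0} \<and> {p. D p \<noteq> 0} \<subseteq> pts \<Gamma>}"

text \<open>Restriction of a function on Gamma to the edge e, parametrised by [0, l e].\<close>
definition fedge :: "tcurve \<Rightarrow> (tpt \<Rightarrow> real) \<Rightarrow> nat \<Rightarrow> real \<Rightarrow> real" where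
  "fedge \<Gamma> f e t = (if t = 0 then f (Vt (fst (ends (fst \<Gamma>) e)))
                    else if t = snd \<Gamma> e then f (Vt (snd (ends (fst \<Gamma>) e)))
                    else f (Ep e t))"

text \<open>Continuous piecewise linear with finitely many pieces and integer slopes on [0,L].\<close>
definition pl_int :: "(real \<Rightarrow> real) \<Rightarrow> real \<Rightarrow> bool" where
  "pl_int h L \<longleftrightarrow> (\<exists>n::nat. \<exists>t::nat \<Rightarrow> real. t 0 = 0 \<and> t n = L \<and>
      (\<forall>i < n. t i < t (Suc i)) \<and>
      (\<forall>i < n. \<exists>m::int. \<exists>c::real. \<forall>s \<in> {t i .. t (Suc i)}. h s = of_int m * s + c))"

definition rational_fun :: "tcurve \<Rightarrow> (tpt \<Rightarrow> real) \<Rightarrow> bool" where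
  "rational_fun \<Gamma> f \<longleftrightarrow> (\<forall>e \<in> E (fst \<Gamma>). pl_int (fedge \<Gamma> f e) (snd \<Gamma> e))"

text \<open>Outgoing slopes in the increasing and decreasing directions.\<close>
definition rslope :: "(real \<Rightarrow> real) \<Rightarrow> real \<Rightarrow> real" where
  "rslope h s = Lim (at_right 0) (\<lambda>u. (h (s + u) - h s) / u)"

definition lslope :: "(real \<Rightarrow> real) \<Rightarrow> real \<Rightarrow> real" where
  "lslope h s = Lim (at_right 0) (\<lambda>u. (h (s - u) - h s) / u)"

text \<open>ord_p(f): sum of the outgoing slopes of f at p.\<close>
definition ordf :: "tcurve \<Rightarrow> (tpt \<Rightarrow> real) \<Rightarrow> tpt \<Rightarrow> real" where
  "ordf \<Gamma> f p = (case p of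
      Vt v \<Rightarrow> (\<Sum>e \<in> {e \<in> E (fst \<Gamma>). fst (ends (fst \<Gamma>) e) = v}. rslope (fedge \<Gamma> f e) 0)
            + (\<Sum>e \<in> {e \<in> E (fst \<Gamma>). snd (ends (fst \<Gamma>) e) = v}. lslope (fedge \<Gamma> f e) (snd \<Gamma> e))
    | Ep e t \<Rightarrow> rslope (fedge \<Gamma> f e) t + lslope (fedge \<Gamma> f e) t)"

definition lin_equiv :: "tcurve \<Rightarrow> (tpt \<Rightarrow> int) \<Rightarrow> (tpt \<Rightarrow> int) \<Rightarrow> bool" where
  "lin_equiv \<Gamma> D D' \<longleftrightarrow> D \<in> Div \<Gamma> \<and> D' \<in> Div \<Gamma> \<and>
     (\<exists>f. rational_fun \<Gamma> f \<and> (\<forall>p \<in> pts \<Gamma>. of_int (D p - D' p) = ordf \<Gamma> f p))"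

text \<open>The class [D] in Pic(Gamma).\<close>
definition pic_cls :: "tcurve \<Rightarrow> (tpt \<Rightarrow> int) \<Rightarrow> (tpt \<Rightarrow> int) set" where
  "pic_cls \<Gamma> D = {D'. lin_equiv \<Gamma> D' D}"

definition canon :: "tcurve \<Rightarrow> tpt \<Rightarrow> int" where
  "canon \<Gamma> p = (case p of
      Vt v \<Rightarrow> if v \<in> V (fst \<Gamma>) then 2 * int (wt (fst \<Gamma>) v) - 2 + int (deg (fst \<Gamma>) v) else 0
    | Ep e t \<Rightarrow> 0)"

definition theta_chars :: "tcurve \<Rightarrow> (tpt \<Rightarrow> int) set set" where
  "theta_chars \<Gamma> = {pic_cls \<Gamma> D | D. D \<in> Div \<Gamma> \<and> lin_equiv \<Gamma> (\<lambda>p. 2 * D p) (canon \<Gamma>)}"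

text \<open>The divisor T_P.\<close>
definition TP :: "tcurve \<Rightarrow> nat set \<Rightarrow> tpt \<Rightarrow> int" where
  "TP \<Gamma> P p = (case p of
      Vt v \<Rightarrow> if v \<in> V (fst \<Gamma>) then int (degP (fst \<Gamma>) P v) div 2 - 1 + int (wt (fst \<Gamma>) v) else 0
    | Ep e t \<Rightarrow> if e \<in> E (fst \<Gamma>) - P \<and> t = snd \<Gamma> e / 2 then 1 else 0)"

text \<open>Isomorphisms of tropical curves: vertex bijection, edge bijection and, for
each edge, whether its orientation is reversed; they preserve weights and lengths.\<close>
definition tc_iso :: "tcurve \<Rightarrow> tcurve \<Rightarrow> (nat \<Rightarrow> nat) \<Rightarrow> (nat \<Rightarrow> nat) \<Rightarrow> (nat \<Rightarrow> bool) \<Rightarrow> bool" where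
  "tc_iso \<Gamma> \<Gamma>' \<phi> \<psi> \<sigma> \<longleftrightarrow>
     bij_betw \<phi> (V (fst \<Gamma>)) (V (fst \<Gamma>')) \<and> bij_betw \<psi> (E (fst \<Gamma>)) (E (fst \<Gamma>')) \<and>
     (\<forall>v \<in> V (fst \<Gamma>). wt (fst \<Gamma>') (\<phi> v) = wt (fst \<Gamma>) v) \<and>
     (\<forall>e \<in> E (fst \<Gamma>). snd \<Gamma>' (\<psi> e) = snd \<Gamma> e \<and>
        ends (fst \<Gamma>') (\<psi> e) = (if \<sigma> e then prod.swap else id)
                                   (map_prod \<phi> \<phi> (ends (fst \<Gamma>) e)))"

definition ptmap :: "tcurve \<Rightarrow> (nat \<Rightarrow> nat) \<Rightarrow> (nat \<Rightarrow> nat) \<Rightarrow> (nat \<Rightarrow> bool) \<Rightarrow> tpt \<Rightarrow> tpt" where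
  "ptmap \<Gamma> \<phi> \<psi> \<sigma> p = (case p of
      Vt v \<Rightarrow> Vt (\<phi> v)
    | Ep e t \<Rightarrow> Ep (\<psi> e) (if \<sigma> e then snd \<Gamma> e - t else t))"

text \<open>(Gamma,theta) and (Gamma',theta') are isomorphic: an isomorphism carrying theta to theta'.\<close>
definition tc_pair_rel :: "((tcurve \<times> (tpt \<Rightarrow> int) set) \<times> (tcurve \<times> (tpt \<Rightarrow> int) set)) set" where
  "tc_pair_rel = {((\<Gamma>, \<theta>), (\<Gamma>', \<theta>')) | \<Gamma> \<theta> \<Gamma>' \<theta>'. \<exists>\<phi> \<psi> \<sigma>. tc_iso \<Gamma> \<Gamma>' \<phi> \<psi> \<sigma> \<and>
      \<theta>' = {D' \<in> Div \<Gamma>'. \<exists>D \<in> \<theta>. \<forall>p \<in> pts \<Gamma>. D' (ptmap \<Gamma> \<phi> \<psi> \<sigma> p) = D p}}"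

text \<open>Isomorphism classes of pairs (Gamma, theta), Gamma of genus g.\<close>
definition TC :: "nat \<Rightarrow> (tcurve \<times> (tpt \<Rightarrow> int) set) set set" where
  "TC g = {(\<Gamma>, \<theta>). trop_curve g \<Gamma> \<and> \<theta> \<in> theta_chars \<Gamma>} // tc_pair_rel"

end

theory Submission
  imports Defs
begin

text \<open>
  Every point of the disjoint union of the cones is the image, under a face map, of a point in the
  interior of some cone (contract the edges of length zero), and two contractions of a graph along
  the same edges differ by an isomorphism. Hence two points become equal in the colimit exactly when
  their interior representatives are isomorphic; this gives the stratification and the description
  of the strata. Contractions compose and factor, so the set of points whose graph contracts to
  \<open>(G, P)\<close> with prescribed remaining lengths in an open set is an open union of classes; such stars
  yield the quotient topology on the strata and the closure relations. All cones share the point of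
  the one-vertex graph of weight \<open>g\<close>, which gives connectedness. A graph with fewer than \<open>3 g - 3\<close>
  edges can be expanded by trading a unit of weight for a loop or by splitting a vertex of valence
  at least four, the parity of \<open>P\<close> at the new vertex deciding whether the new edge belongs to \<open>P\<close>.

  If \<open>div f = 2 D - K\<close>, the slopes of \<open>f\<close> have constant parity on each edge and the edges of even
  slope form the cycle \<open>P\<close> with \<open>D \<sim> T_P\<close>. Conversely \<open>T_P \<sim> T_P'\<close> forces \<open>P = P'\<close>, since a function
  with zero divisor has zero energy, hence zero slopes.
\<close>

section \<open>Contractions\<close>

text \<open>The colimit relation is generated by undirected zigzags of face maps, so it shows no
  invariant directly. Moving every point to an interior representative makes it a confluent
  reduction, in which the contracted set can be read off from a point as its zero coordinates; an
  empty contracted set means an isomorphism. Genus is tracked through \<open>wt v - 1\<close>: the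
  genus is 1 plus the sum of these terms plus the number of edges, and a contraction adds them up
  over fibres, with one unit per contracted edge. A restriction of a quotient map to a subspace need
  not be a quotient map, so relatively open subsets of a stratum have to be extended to open sets of
  the colimit. The pivot on the divisor side is a function \<open>fP\<close> with divisor 2 T_P - K.
  If div f = 2 D - K and the slope parities of f and \<open>fP\<close> agree, then half of f -
  \<open>fP\<close> has integer slopes and divisor D - T_P. The number 3 g - 3 comes from the degree
  of K: the terms 2 w - 2 + deg are at least one and add up to 2 g - 2, which bounds the vertices by
  2 g - 2 and then the edges through the genus formula.\<close>

definition wf_graph :: "sgraph \<Rightarrow> bool" where
  "wf_graph G \<longleftrightarrow> finite (V G) \<and> finite (E G) \<and>
     (\<forall>e \<in> E G. fst (ends G e) \<in> V G \<and> snd (ends G e) \<in> V G)"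

lemma adj_mono: "F \<subseteq> F' \<Longrightarrow> adj G F \<subseteq> adj G F'"
  by (auto simp: adj_def)

lemma adj_sym: "(u, v) \<in> adj G F \<Longrightarrow> (v, u) \<in> adj G F"
  unfolding adj_def by blast

lemma adj_edge: "e \<in> F \<Longrightarrow> (fst (ends G e), snd (ends G e)) \<in> adj G F"
  by (auto simp: adj_def)

lemma adjE:
  assumes "(u, v) \<in> adj G F"
  obtains e where "e \<in> F" "ends G e = (u, v) \<or> ends G e = (v, u)"
  using assms by (force simp: adj_def prod_eq_iff)

text \<open>A contracted edge has both ends in one fibre, so a path of such edges never leaves the
  fibre where it starts. Hence fibrewise connectivity in \<open>contr\<close> can be tested with all
  of \<open>S\<close> at once.\<close>

lemma adj_path_in_fibre:
  assumes S: "\<forall>e \<in> S. \<phi> (fst (ends G e)) = \<phi> (snd (ends G e))"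
    and p: "(u, v) \<in> (adj G S)\<^sup>*"
  shows "\<phi> v = \<phi> u \<and> (u, v) \<in> (adj G {e \<in> S. \<phi> (fst (ends G e)) = \<phi> u})\<^sup>*"
  using p
proof (induction rule: rtrancl_induct)
  case (step y z)
  obtain e where e: "e \<in> S" "ends G e = (y, z) \<or> ends G e = (z, y)"
    using step(2) by (rule adjE)
  then have "\<phi> y = \<phi> z" "e \<in> {e \<in> S. \<phi> (fst (ends G e)) = \<phi> u}"
    using S step.IH by force+
  moreover have "(y, z) \<in> adj G {e \<in> S. \<phi> (fst (ends G e)) = \<phi> u}"
    using adj_edge[OF calculation(2), of G] adj_sym e(2) by auto
  ultimately show ?case using step.IH by (auto intro: rtrancl_into_rtrancl)
qed simp

text \<open>In terms of \<open>wt - 1\<close> the weight condition becomes additive along the fibres.\<close>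

lemma contr_iff:
  "contr G P G' P' S \<phi> \<psi> \<longleftrightarrow>
     S \<subseteq> E G \<and> \<phi> ` V G = V G' \<and> bij_betw \<psi> (E G - S) (E G') \<and>
     (\<forall>e \<in> S. \<phi> (fst (ends G e)) = \<phi> (snd (ends G e))) \<and>
     (\<forall>e \<in> E G - S. ends G' (\<psi> e) = (\<phi> (fst (ends G e)), \<phi> (snd (ends G e)))
                   \<or> ends G' (\<psi> e) = (\<phi> (snd (ends G e)), \<phi> (fst (ends G e)))) \<and>
     (\<forall>u \<in> V G. \<forall>v \<in> V G. \<phi> u = \<phi> v \<longrightarrow> (u, v) \<in> (adj G S)\<^sup>*) \<and>
     (\<forall>v' \<in> V G'. int (wt G' v') - 1 = (\<Sum>v \<in> {v \<in> V G. \<phi> v = v'}. int (wt G v) - 1)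
         + int (card {e \<in> S. \<phi> (fst (ends G e)) = v'})) \<and>
     P' = \<psi> ` (P - S)" (is "?L \<longleftrightarrow> ?R")
proof
  assume L: ?L
  have "(u, v) \<in> (adj G S)\<^sup>*" if "u \<in> V G" "v \<in> V G" "\<phi> u = \<phi> v" for u v
  proof -
    have "\<phi> u \<in> V G'" using that L unfolding contr_def by blast
    then have "(u, v) \<in> (adj G {e \<in> S. \<phi> (fst (ends G e)) = \<phi> u})\<^sup>*"
      using L that unfolding contr_def Let_def by auto
    then show ?thesis
      using rtrancl_mono[OF adj_mono[of "{e \<in> S. \<phi> (fst (ends G e)) = \<phi> u}" S G]] by blast
  qed
  then show ?R using L unfolding contr_def Let_def by (auto simp: sum_subtractf)
next
  assume R: ?R
  have "(u, v) \<in> (adj G {e \<in> S. \<phi> (fst (ends G e)) = v'})\<^sup>*"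
    if "u \<in> V G" "\<phi> u = v'" "v \<in> V G" "\<phi> v = v'" for u v v'
  proof -
    have "\<forall>e \<in> S. \<phi> (fst (ends G e)) = \<phi> (snd (ends G e))"
      and "\<forall>u \<in> V G. \<forall>v \<in> V G. \<phi> u = \<phi> v \<longrightarrow> (u, v) \<in> (adj G S)\<^sup>*" using R by simp_all
    then show ?thesis using adj_path_in_fibre[of S \<phi> G u v] that by simp
  qed
  moreover have "int (wt G' v') = (\<Sum>v \<in> {v \<in> V G. \<phi> v = v'}. int (wt G v))
       + int (card {e \<in> S. \<phi> (fst (ends G e)) = v'}) - int (card {v \<in> V G. \<phi> v = v'}) + 1"
    if "v' \<in> V G'" for v'
  proof -
    have "int (wt G' v') - 1 = (\<Sum>v \<in> {v \<in> V G. \<phi> v = v'}. int (wt G v) - 1)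
         + int (card {e \<in> S. \<phi> (fst (ends G e)) = v'})" using R that by simp
    then show ?thesis by (simp add: sum_subtractf)
  qed
  ultimately show ?L using R unfolding contr_def Let_def by simp
qed

lemma contrD:
  assumes "contr G P G' P' S \<phi> \<psi>"
  shows "S \<subseteq> E G" "\<phi> ` V G = V G'" "bij_betw \<psi> (E G - S) (E G')"
    "\<And>e. e \<in> S \<Longrightarrow> \<phi> (fst (ends G e)) = \<phi> (snd (ends G e))"
    "\<And>e. e \<in> E G - S \<Longrightarrow> ends G' (\<psi> e) = (\<phi> (fst (ends G e)), \<phi> (snd (ends G e)))
                   \<or> ends G' (\<psi> e) = (\<phi> (snd (ends G e)), \<phi> (fst (ends G e)))"
    "\<And>u v. u \<in> V G \<Longrightarrow> v \<in> V G \<Longrightarrow> \<phi> u = \<phi> v \<Longrightarrow> (u, v) \<in> (adj G S)\<^sup>*"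
    "\<And>v'. v' \<in> V G' \<Longrightarrow> int (wt G' v') - 1 = (\<Sum>v \<in> {v \<in> V G. \<phi> v = v'}. int (wt G v) - 1)
         + int (card {e \<in> S. \<phi> (fst (ends G e)) = v'})"
    "P' = \<psi> ` (P - S)"
  using assms unfolding contr_iff by blast+

text \<open>Edges of the path that lie in \<open>Z\<close> become constant steps, the others become
  edges of \<open>G'\<close>.\<close>

lemma contr_path_image:
  assumes c: "contr G P G' P' Z \<phi> \<psi>" and S: "S \<subseteq> E G" and p: "(u, v) \<in> (adj G S)\<^sup>*"
  shows "(\<phi> u, \<phi> v) \<in> (adj G' (\<psi> ` (S - Z)))\<^sup>*"
  using p
proof (induction rule: rtrancl_induct)
  case (step y z)
  obtain e where e: "e \<in> S" "ends G e = (y, z) \<or> ends G e = (z, y)"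
    using step(2) by (rule adjE)
  show ?case
  proof (cases "e \<in> Z")
    case True
    then have "\<phi> y = \<phi> z" using contrD(4)[OF c True] e by auto
    then show ?thesis using step.IH by simp
  next
    case False
    then have "ends G' (\<psi> e) = (\<phi> y, \<phi> z) \<or> ends G' (\<psi> e) = (\<phi> z, \<phi> y)"
      using contrD(5)[OF c, of e] e S by auto
    then have "(\<phi> y, \<phi> z) \<in> adj G' (\<psi> ` (S - Z))"
      using adj_edge[of "\<psi> e" "\<psi> ` (S - Z)" G'] adj_sym e False by fastforce
    then show ?thesis using step.IH by simp
  qed
qed simp

text \<open>Each edge of the path in \<open>G'\<close> lifts to an edge of \<open>G\<close>, but
  consecutive lifts only meet up to a fibre; fibres are connected through \<open>S\<close>, which
  bridges the gaps. The conclusion covers every vertex over \<open>b\<close> because the induction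
  cannot control the end of a lift.\<close>

lemma contr_path_lift:
  assumes c: "contr G P G' P' S \<phi> \<psi>" and wf: "wf_graph G"
    and T: "S \<subseteq> T" "\<And>e. e \<in> E G - S \<Longrightarrow> \<psi> e \<in> S' \<Longrightarrow> e \<in> T" and S': "S' \<subseteq> E G'"
    and p: "(a, b) \<in> (adj G' S')\<^sup>*" and u: "u \<in> V G" "\<phi> u = a"
  shows "\<forall>v \<in> V G. \<phi> v = b \<longrightarrow> (u, v) \<in> (adj G T)\<^sup>*"
  using p
proof (induction rule: rtrancl_induct)
  have mono: "(adj G S)\<^sup>* \<subseteq> (adj G T)\<^sup>*" by (intro rtrancl_mono adj_mono T)
  case base
  then show ?case using contrD(6)[OF c u(1)] u mono by auto
next
  case (step y z)
  have mono: "(adj G S)\<^sup>* \<subseteq> (adj G T)\<^sup>*" by (intro rtrancl_mono adj_mono T)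
  obtain e' where e': "e' \<in> S'" "ends G' e' = (y, z) \<or> ends G' e' = (z, y)"
    using step(2) by (rule adjE)
  then have "e' \<in> \<psi> ` (E G - S)" using bij_betw_imp_surj_on[OF contrD(3)[OF c]] S' by auto
  then obtain e where e: "e \<in> E G - S" "\<psi> e = e'" by auto
  let ?p = "fst (ends G e)" and ?q = "snd (ends G e)"
  have pq: "?p \<in> V G" "?q \<in> V G" using wf e unfolding wf_graph_def by auto
  have eT: "(?p, ?q) \<in> adj G T" "(?q, ?p) \<in> adj G T"
    using adj_edge[of e T G] adj_sym T(2) e e' by auto
  have "(\<phi> ?p = y \<and> \<phi> ?q = z) \<or> (\<phi> ?q = y \<and> \<phi> ?p = z)"
    using contrD(5)[OF c e(1)] e e'(2) by auto
  then obtain r s where rs: "r \<in> V G" "s \<in> V G" "\<phi> r = y" "\<phi> s = z" "(r, s) \<in> adj G T"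
    using pq eT by blast
  show ?case
  proof safe
    fix v assume v: "v \<in> V G" "z = \<phi> v"
    have "(u, r) \<in> (adj G T)\<^sup>*" using step.IH rs by auto
    moreover have "(s, v) \<in> (adj G T)\<^sup>*" using contrD(6)[OF c rs(2) v(1)] rs v mono by auto
    ultimately show "(u, v) \<in> (adj G T)\<^sup>*" using rs(5) by (meson rtrancl_into_rtrancl rtrancl_trans)
  qed
qed

text \<open>The weight condition summed over a set \<open>W\<close> of image vertices. All of
  \<open>V G'\<close> gives preservation of the genus, a fibre of a further contraction gives the
  weight condition for composites and factors.\<close>

lemma contr_weight_sum:
  assumes c: "contr G P G' P' S \<phi> \<psi>" and wf: "wf_graph G" and W: "W \<subseteq> V G'"
  shows "(\<Sum>v' \<in> W. int (wt G' v') - 1) = (\<Sum>v \<in> {v \<in> V G. \<phi> v \<in> W}. int (wt G v) - 1)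
         + int (card {e \<in> S. \<phi> (fst (ends G e)) \<in> W})"
proof -
  have finV: "finite (V G)" and finS: "finite S" using wf contrD(1)[OF c] finite_subset
    unfolding wf_graph_def by blast+
  then have finW: "finite W" using W contrD(2)[OF c] finite_subset by (metis finite_imageI)
  have "(\<Sum>v' \<in> W. int (wt G' v') - 1) = (\<Sum>v' \<in> W. (\<Sum>v \<in> {v \<in> V G. \<phi> v = v'}. int (wt G v) - 1)
         + (\<Sum>e \<in> {e \<in> S. \<phi> (fst (ends G e)) = v'}. 1))"
    using contrD(7)[OF c] W by (intro sum.cong) auto
  also have "\<dots> = (\<Sum>v' \<in> W. \<Sum>v \<in> {v \<in> V G. \<phi> v = v'}. int (wt G v) - 1)
     + (\<Sum>v' \<in> W. \<Sum>e \<in> {e \<in> S. \<phi> (fst (ends G e)) = v'}. 1)"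
    by (rule sum.distrib)
  also have "(\<Sum>v' \<in> W. \<Sum>v \<in> {v \<in> V G. \<phi> v = v'}. int (wt G v) - 1)
     = (\<Sum>v \<in> {v \<in> V G. \<phi> v \<in> W}. int (wt G v) - 1)"
  proof -
    have "{x \<in> {v \<in> V G. \<phi> v \<in> W}. \<phi> x = v'} = {v \<in> V G. \<phi> v = v'}" if "v' \<in> W" for v'
      using that by auto
    then show ?thesis
      using sum.group[of "{v \<in> V G. \<phi> v \<in> W}" W \<phi> "\<lambda>v. int (wt G v) - 1"] finV finW by force
  qed
  also have "(\<Sum>v' \<in> W. \<Sum>e \<in> {e \<in> S. \<phi> (fst (ends G e)) = v'}. 1)
     = (\<Sum>e \<in> {e \<in> S. \<phi> (fst (ends G e)) \<in> W}. (1::int))"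
  proof -
    have "{x \<in> {e \<in> S. \<phi> (fst (ends G e)) \<in> W}. \<phi> (fst (ends G x)) = v'}
       = {e \<in> S. \<phi> (fst (ends G e)) = v'}" if "v' \<in> W" for v'
      using that by auto
    then show ?thesis
      using sum.group[of "{e \<in> S. \<phi> (fst (ends G e)) \<in> W}" W "\<lambda>e. \<phi> (fst (ends G e))" "\<lambda>e. 1::int"]
        finS finW by force
  qed
  finally show ?thesis by simp
qed

text \<open>The composite contracts \<open>S\<close> and those remaining edges whose images are
  contracted in the second stage. Connectivity of its fibres is path lifting, and the weights add up
  because \<open>wt - 1\<close> is additive.\<close>

lemma contr_comp:
  assumes c1: "contr G P G' P' S \<phi> \<psi>" and c2: "contr G' P' G'' P'' S' \<phi>' \<psi>'"
    and wf: "wf_graph G" and P: "P \<subseteq> E G"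
  shows "contr G P G'' P'' (S \<union> {e \<in> E G - S. \<psi> e \<in> S'}) (\<phi>' \<circ> \<phi>) (\<psi>' \<circ> \<psi>)"
    (is "contr _ _ _ _ ?T _ _")
proof -
  note d1 = contrD[OF c1] and d2 = contrD[OF c2]
  have finS: "finite S" "finite (E G)" "finite (V G)" using wf d1(1) finite_subset
    unfolding wf_graph_def by blast+
  have same: "\<phi>' (\<phi> (fst (ends G e))) = \<phi>' (\<phi> (snd (ends G e)))"
    "\<phi>' (fst (ends G' (\<psi> e))) = \<phi>' (\<phi> (fst (ends G e)))" if "e \<in> E G - S" "\<psi> e \<in> S'" for e
    using d1(5)[OF that(1)] d2(4)[OF that(2)] by auto
  have bij: "bij_betw (\<psi>' \<circ> \<psi>) (E G - ?T) (E G'')"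
  proof (rule bij_betw_trans)
    show "bij_betw \<psi> (E G - ?T) (E G' - S')"
    proof (rule bij_betw_subset[OF d1(3)])
      have "\<psi> ` (E G - S) = E G'" using d1(3) by (simp add: bij_betw_def)
      then show "\<psi> ` (E G - ?T) = E G' - S'" by auto
    qed auto
  qed (rule d2(3))
  have "contr G P G'' P'' ?T (\<phi>' \<circ> \<phi>) (\<psi>' \<circ> \<psi>) \<longleftrightarrow> True"
    unfolding contr_iff simp_thms
  proof (intro conjI ballI impI)
    show "?T \<subseteq> E G" using d1 by auto
    show "(\<phi>' \<circ> \<phi>) ` V G = V G''" using d1(2) d2(2) by (metis image_comp)
    show "bij_betw (\<psi>' \<circ> \<psi>) (E G - ?T) (E G'')" by (rule bij)
    show "(\<phi>' \<circ> \<phi>) (fst (ends G e)) = (\<phi>' \<circ> \<phi>) (snd (ends G e))" if "e \<in> ?T" for e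
      using that same d1(4) by auto
    show "ends G'' ((\<psi>' \<circ> \<psi>) e) = ((\<phi>' \<circ> \<phi>) (fst (ends G e)), (\<phi>' \<circ> \<phi>) (snd (ends G e))) \<or>
          ends G'' ((\<psi>' \<circ> \<psi>) e) = ((\<phi>' \<circ> \<phi>) (snd (ends G e)), (\<phi>' \<circ> \<phi>) (fst (ends G e)))"
      if e: "e \<in> E G - ?T" for e
    proof -
      have "e \<in> E G - S" "\<psi> e \<in> E G' - S'"
        using e bij_betw_apply[OF d1(3)] by auto
      then show ?thesis using d1(5)[of e] d2(5)[of "\<psi> e"] by auto
    qed
    show "(u, v) \<in> (adj G ?T)\<^sup>*" if "u \<in> V G" "v \<in> V G" "(\<phi>' \<circ> \<phi>) u = (\<phi>' \<circ> \<phi>) v" for u v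
    proof -
      have "\<phi> u \<in> V G'" "\<phi> v \<in> V G'" using d1(2) that by auto
      then have "(\<phi> u, \<phi> v) \<in> (adj G' S')\<^sup>*" using d2(6) that by auto
      then show ?thesis using contr_path_lift[OF c1 wf, of ?T S' "\<phi> u" "\<phi> v" u] d2(1) that by auto
    qed
    show "int (wt G'' w) - 1 = (\<Sum>v | v \<in> V G \<and> (\<phi>' \<circ> \<phi>) v = w. int (wt G v) - 1) +
         int (card {e \<in> ?T. (\<phi>' \<circ> \<phi>) (fst (ends G e)) = w})" if w: "w \<in> V G''" for w
    proof -
      \<comment> \<open>The fibre of the second map over \<open>w\<close>; the fibre of the
        composite is its preimage under the first map.\<close>
      let ?W = "{v' \<in> V G'. \<phi>' v' = w}"
      have V1: "{v \<in> V G. \<phi> v \<in> ?W} = {v. v \<in> V G \<and> (\<phi>' \<circ> \<phi>) v = w}" using d1(2) by auto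
      have "fst (ends G e) \<in> V G" if "e \<in> S" for e using that wf d1(1) unfolding wf_graph_def by auto
      then have S1: "{e \<in> S. \<phi> (fst (ends G e)) \<in> ?W} = {e \<in> S. \<phi>' (\<phi> (fst (ends G e))) = w}"
        using d1(2) by auto
      let ?B = "{e \<in> E G - S. \<psi> e \<in> S' \<and> \<phi>' (\<phi> (fst (ends G e))) = w}"
      have "\<psi> ` ?B = {e' \<in> S'. \<phi>' (fst (ends G' e')) = w}"
      proof safe
        fix e' assume "e' \<in> S'" "w = \<phi>' (fst (ends G' e'))"
        moreover then obtain e where "e \<in> E G - S" "e' = \<psi> e"
          using bij_betw_imp_surj_on[OF d1(3)] d2(1) by blast
        ultimately show "e' \<in> \<psi> ` {e \<in> E G - S. \<psi> e \<in> S' \<and>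
              \<phi>' (\<phi> (fst (ends G e))) = \<phi>' (fst (ends G' e'))}" using same by auto
      qed (use same in auto)
      moreover have "inj_on \<psi> ?B" using d1(3) by (auto simp: bij_betw_def inj_on_def)
      ultimately have "card {e' \<in> S'. \<phi>' (fst (ends G' e')) = w} = card ?B"
        using card_image[of \<psi> ?B] by simp
      moreover have "card {e \<in> ?T. (\<phi>' \<circ> \<phi>) (fst (ends G e)) = w}
          = card ({e \<in> S. \<phi>' (\<phi> (fst (ends G e))) = w} \<union> ?B)"
        by (rule arg_cong[of _ _ card]) auto
      moreover have "\<dots> = card {e \<in> S. \<phi>' (\<phi> (fst (ends G e))) = w} + card ?B"
        by (rule card_Un_disjoint) (use finS in auto)
      ultimately show ?thesis
        using d2(7)[OF w] contr_weight_sum[OF c1 wf, of ?W] unfolding V1 S1 by auto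
    qed
    show "P'' = (\<psi>' \<circ> \<psi>) ` (P - ?T)" using d1(8) d2(8) P by (auto simp: image_iff)
  qed
  then show ?thesis by simp
qed

text \<open>Since \<open>Z\<close> is contained in \<open>S\<close>, the second map is constant on
  the fibres of the first and descends to \<open>H\<close>. With \<open>Z = S\<close> nothing
  remains to be contracted, and the factor is an isomorphism between two contractions along the same
  edges.\<close>

lemma contr_factor:
  assumes c1: "contr G P H Q Z \<phi>1 \<psi>1" and c2: "contr G P G' P' S \<phi>2 \<psi>2"
    and ZS: "Z \<subseteq> S" and wf: "wf_graph G" and P: "P \<subseteq> E G"
  obtains \<phi>3 \<psi>3 where "contr H Q G' P' (\<psi>1 ` (S - Z)) \<phi>3 \<psi>3"
    "\<And>e. e \<in> E G - Z \<Longrightarrow> \<psi>3 (\<psi>1 e) = \<psi>2 e"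
proof -
  note d1 = contrD[OF c1] and d2 = contrD[OF c2]
  have finS: "finite S" "finite (E G)" "finite (V G)" using wf d2(1) finite_subset
    unfolding wf_graph_def by blast+
  define \<phi>3 where "\<phi>3 = \<phi>2 \<circ> inv_into (V G) \<phi>1"
  define \<psi>3 where "\<psi>3 = \<psi>2 \<circ> inv_into (E G - Z) \<psi>1"
  have \<psi>3: "\<psi>3 (\<psi>1 e) = \<psi>2 e" if "e \<in> E G - Z" for e
    using that d1(3) unfolding \<psi>3_def bij_betw_def by simp
  \<comment> \<open>The preimage chosen by \<open>inv_into\<close> does not matter: it is joined to
    \<open>v\<close> by edges of \<open>Z\<close>, which the second contraction also
    collapses.\<close>
  have \<phi>3: "\<phi>3 (\<phi>1 v) = \<phi>2 v" if v: "v \<in> V G" for v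
  proof -
    let ?u = "inv_into (V G) \<phi>1 (\<phi>1 v)"
    have "?u \<in> V G" "\<phi>1 ?u = \<phi>1 v" using v by (auto intro: inv_into_into f_inv_into_f)
    then have "(?u, v) \<in> (adj G Z)\<^sup>*" using d1(6) v by blast
    then have "\<phi>2 v = \<phi>2 ?u" using adj_path_in_fibre[of Z \<phi>2 G] d2(4) ZS by blast
    then show ?thesis by (simp add: \<phi>3_def)
  qed
  have inj: "inj_on \<psi>1 (E G - Z)" and im: "\<psi>1 ` (E G - Z) = E H" using d1(3) by (auto simp: bij_betw_def)
  have EV: "fst (ends G e) \<in> V G" "snd (ends G e) \<in> V G" if "e \<in> E G" for e
    using that wf unfolding wf_graph_def by auto
  have ESH: "E H - \<psi>1 ` (S - Z) = \<psi>1 ` (E G - S)"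
  proof -
    have "(E G - Z) - (S - Z) = E G - S" using ZS by auto
    then show ?thesis
      using inj_on_image_set_diff[OF inj, of "E G - Z" "S - Z"] d2(1) im by auto
  qed
  have "contr H Q G' P' (\<psi>1 ` (S - Z)) \<phi>3 \<psi>3 \<longleftrightarrow> True"
    unfolding contr_iff simp_thms
  proof (intro conjI ballI impI)
    show "\<psi>1 ` (S - Z) \<subseteq> E H" using im d2(1) by auto
    show "\<phi>3 ` V H = V G'" using d1(2) d2(2) \<phi>3 by (metis (no_types, lifting) image_cong image_image)
    have "bij_betw \<psi>1 (E G - S) (E H - \<psi>1 ` (S - Z))"
      unfolding ESH using inj ZS by (auto simp: bij_betw_def inj_on_def)
    then show "bij_betw \<psi>3 (E H - \<psi>1 ` (S - Z)) (E G')"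
    proof (rule bij_betw_comp_iff[THEN iffD2])
      show "bij_betw (\<psi>3 \<circ> \<psi>1) (E G - S) (E G')"
        using d2(3) \<psi>3 ZS by (subst bij_betw_cong[of _ _ \<psi>2]) auto
    qed
    show "\<phi>3 (fst (ends H e')) = \<phi>3 (snd (ends H e'))" if e': "e' \<in> \<psi>1 ` (S - Z)" for e'
    proof -
      obtain e where e: "e \<in> S" "e \<in> E G - Z" "e' = \<psi>1 e" using e' d2(1) by auto
      then show ?thesis using d1(5)[OF e(2)] EV[of e] \<phi>3 d2(4)[OF e(1)] by auto
    qed
    show "ends G' (\<psi>3 e') = (\<phi>3 (fst (ends H e')), \<phi>3 (snd (ends H e'))) \<or>
          ends G' (\<psi>3 e') = (\<phi>3 (snd (ends H e')), \<phi>3 (fst (ends H e')))"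
      if e': "e' \<in> E H - \<psi>1 ` (S - Z)" for e'
    proof -
      obtain e where e: "e \<in> E G - S" "e \<in> E G - Z" "e' = \<psi>1 e" using e' ZS unfolding ESH by auto
      then show ?thesis using d1(5)[OF e(2)] d2(5)[OF e(1)] EV[of e] \<phi>3 \<psi>3 by auto
    qed
    show "(u', v') \<in> (adj H (\<psi>1 ` (S - Z)))\<^sup>*" if uv: "u' \<in> V H" "v' \<in> V H" "\<phi>3 u' = \<phi>3 v'" for u' v'
    proof -
      obtain u v where "u \<in> V G" "v \<in> V G" "u' = \<phi>1 u" "v' = \<phi>1 v" 
        using uv(1,2) unfolding d1(2)[symmetric] by auto
      then show ?thesis using contr_path_image[OF c1 d2(1), of u v] d2(6)[of u v] uv \<phi>3 by auto
    qed
    show "int (wt G' w) - 1 = (\<Sum>v | v \<in> V H \<and> \<phi>3 v = w. int (wt H v) - 1) +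
         int (card {e \<in> \<psi>1 ` (S - Z). \<phi>3 (fst (ends H e)) = w})" if w: "w \<in> V G'" for w
    proof -
      let ?W = "{v. v \<in> V H \<and> \<phi>3 v = w}"
      have V1: "{v \<in> V G. \<phi>1 v \<in> ?W} = {v \<in> V G. \<phi>2 v = w}" using d1(2) \<phi>3 by auto
      have ZE: "e \<in> E G" if "e \<in> Z" for e using that d1(1) by auto
      have Z1: "{e \<in> Z. \<phi>1 (fst (ends G e)) \<in> ?W} = {e \<in> Z. \<phi>2 (fst (ends G e)) = w}"
        using EV[OF ZE] \<phi>3 d1(2) by auto
      let ?B = "{e \<in> S - Z. \<phi>2 (fst (ends G e)) = w}"
      have fst3: "\<phi>3 (fst (ends H (\<psi>1 e))) = \<phi>2 (fst (ends G e))" if e: "e \<in> S - Z" for e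
      proof -
        have eE: "e \<in> E G" using e d2(1) by auto
        then show ?thesis using d1(5)[of e] e EV[OF eE] \<phi>3 d2(4)[of e] by auto
      qed
      have "{e \<in> \<psi>1 ` (S - Z). \<phi>3 (fst (ends H e)) = w} = \<psi>1 ` ?B"
        using fst3 by auto
      moreover have "inj_on \<psi>1 ?B" using inj d2(1) by (auto simp: inj_on_def)
      ultimately have "card {e \<in> \<psi>1 ` (S - Z). \<phi>3 (fst (ends H e)) = w} = card ?B"
        by (simp add: card_image)
      moreover have "card {e \<in> S. \<phi>2 (fst (ends G e)) = w}
          = card ({e \<in> Z. \<phi>2 (fst (ends G e)) = w} \<union> ?B)"
        using ZS by (intro arg_cong[of _ _ card]) auto
      moreover have "\<dots> = card {e \<in> Z. \<phi>2 (fst (ends G e)) = w} + card ?B"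
        by (rule card_Un_disjoint) (use finS finite_subset[OF ZS] in auto)
      ultimately show ?thesis
        using d2(7)[OF w] contr_weight_sum[OF c1 wf, of ?W] unfolding V1 Z1 by auto
    qed
    have "Q - \<psi>1 ` (S - Z) = \<psi>1 ` ((P - Z) - (S - Z))"
      unfolding d1(8) using inj P d2(1) by (intro inj_on_image_set_diff[symmetric]) auto
    also have "(P - Z) - (S - Z) = P - S" using ZS by auto
    finally show "P' = \<psi>3 ` (Q - \<psi>1 ` (S - Z))"
      unfolding d2(8) using \<psi>3 P ZS by (auto simp: image_image subset_eq intro!: image_cong)
  qed
  then show ?thesis using that \<psi>3 by simp
qed

section \<open>Degrees, genus and stability under contraction\<close>

lemma card_filter_sum: "finite A \<Longrightarrow> card {e \<in> A. Q e} = (\<Sum>e \<in> A. of_bool (Q e))"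
  by (simp add: of_bool_def sum.If_cases Int_def)

lemma degP_sum:
  assumes "finite P"
  shows "degP G P v = (\<Sum>e \<in> P. of_bool (fst (ends G e) = v) + of_bool (snd (ends G e) = v))"
  using assms by (simp add: degP_def card_filter_sum sum.distrib)

text \<open>Double counting of incidences. The full vertex set gives the handshake identity, a fibre
  gives the degree of the contracted vertex.\<close>

lemma degP_sum_vertices:
  assumes wf: "wf_graph G" and P: "P \<subseteq> E G"
  shows "(\<Sum>v \<in> {v \<in> V G. Q v}. degP G P v)
    = (\<Sum>e \<in> P. of_bool (Q (fst (ends G e))) + of_bool (Q (snd (ends G e))))"
proof -
  have fin: "finite P" "finite {v \<in> V G. Q v}"
    using wf P finite_subset unfolding wf_graph_def by auto
  have one: "(\<Sum>v \<in> {v \<in> V G. Q v}. of_bool (a = v)) = (of_bool (Q a) :: nat)" if "a \<in> V G" for a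
    using that fin(2) by (auto simp: of_bool_def sum.delta)
  have "(\<Sum>v \<in> {v \<in> V G. Q v}. degP G P v)
    = (\<Sum>e \<in> P. \<Sum>v \<in> {v \<in> V G. Q v}. of_bool (fst (ends G e) = v) + of_bool (snd (ends G e) = v))"
    by (simp add: degP_sum fin sum.swap[of _ P])
  also have "\<dots> = (\<Sum>e \<in> P. of_bool (Q (fst (ends G e))) + of_bool (Q (snd (ends G e))))"
    by (intro sum.cong) (use wf P one in \<open>auto simp: sum.distrib wf_graph_def\<close>)
  finally show ?thesis .
qed

text \<open>A contracted edge has both ends in the same fibre, so it costs exactly two incidences.
  Hence parity of degrees survives contraction, and with it the condition
  \<open>cyc\<close>.\<close>

lemma contr_degP:
  assumes c: "contr G P G' P' S \<phi> \<psi>" and wf: "wf_graph G" and Q: "Q \<subseteq> E G"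
  shows "degP G' (\<psi> ` (Q - S)) v' + 2 * card {e \<in> Q \<inter> S. \<phi> (fst (ends G e)) = v'}
    = (\<Sum>v \<in> {v \<in> V G. \<phi> v = v'}. degP G Q v)"
proof -
  let ?f = "\<lambda>e. of_bool (\<phi> (fst (ends G e)) = v') + of_bool (\<phi> (snd (ends G e)) = v') :: nat"
  have fin: "finite Q" using wf Q finite_subset unfolding wf_graph_def by auto
  have inj: "inj_on \<psi> (Q - S)" using contrD(3)[OF c] Q by (auto simp: bij_betw_def inj_on_def)
  have "degP G' (\<psi> ` (Q - S)) v' = (\<Sum>e \<in> Q - S. ?f e)"
  proof -
    have "of_bool (fst (ends G' (\<psi> e)) = v') + of_bool (snd (ends G' (\<psi> e)) = v') = ?f e"
      if "e \<in> Q - S" for e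
    proof -
      have "e \<in> E G - S" using that Q by auto
      from contrD(5)[OF c this] show ?thesis by (elim disjE) simp_all
    qed
    then show ?thesis using fin by (simp add: degP_sum sum.reindex[OF inj])
  qed
  moreover have "(\<Sum>e \<in> Q \<inter> S. ?f e) = (\<Sum>e \<in> Q \<inter> S. 2 * of_bool (\<phi> (fst (ends G e)) = v'))"
    using contrD(4)[OF c] by (intro sum.cong) auto
  moreover have "\<dots> = 2 * card {e \<in> Q \<inter> S. \<phi> (fst (ends G e)) = v'}"
    using fin by (subst card_filter_sum) (auto simp: sum_distrib_left)
  moreover have "(\<Sum>e \<in> Q. ?f e) = (\<Sum>e \<in> Q \<inter> S. ?f e) + (\<Sum>e \<in> Q - S. ?f e)"
    by (rule sum.Int_Diff[OF fin])
  ultimately show ?thesis using degP_sum_vertices[OF wf Q, of "\<lambda>v. \<phi> v = v'"] by simp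
qed

lemma ObjD:
  assumes "(G, P) \<in> Obj g"
  shows "wf_graph G" "P \<subseteq> E G" "stable_graph G" "genus G = int g" "cyc G P" "finite (E G)" "finite (V G)"
  using assms unfolding Obj_def wf_graph_def stable_graph_def cyc_def by auto

lemma genus_alt: "genus G = (\<Sum>v \<in> V G. int (wt G v) - 1) + int (card (E G)) + 1"
  by (simp add: genus_def sum_subtractf)

lemma contr_wf_graph:
  assumes c: "contr G P G' P' S \<phi> \<psi>" and wf: "wf_graph G"
  shows "wf_graph G'"
proof -
  note d = contrD[OF c]
  have "fst (ends G' e') \<in> V G' \<and> snd (ends G' e') \<in> V G'" if "e' \<in> E G'" for e'
  proof -
    have "e' \<in> \<psi> ` (E G - S)" using bij_betw_imp_surj_on[OF d(3)] \<open>e' \<in> E G'\<close> by simp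
    then obtain e where e: "e \<in> E G - S" "e' = \<psi> e" by auto
    then show ?thesis using d(5)[OF e(1)] d(2) wf unfolding wf_graph_def by auto
  qed
  moreover have "finite (V G')" "finite (E G')"
    using d(2) bij_betw_finite[OF d(3)] wf unfolding wf_graph_def by (metis finite_imageI, blast)
  ultimately show ?thesis unfolding wf_graph_def by simp
qed

text \<open>Stability is inherited because 2 w - 2 + deg is additive along fibres: each contracted
  edge raises the weight term by two and lowers the degree by two. A nonempty sum of positive terms
  is positive.\<close>

lemma contr_Obj:
  assumes c: "contr G P G' P' S \<phi> \<psi>" and o: "(G, P) \<in> Obj g"
  shows "(G', P') \<in> Obj g"
proof -
  note d = contrD[OF c] and oD = ObjD[OF o]
  have wf': "wf_graph G'" by (rule contr_wf_graph[OF c oD(1)])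
  have finS: "finite S" using d(1) oD(6) finite_subset by auto
  have im: "\<psi> ` (E G - S) = E G'" using bij_betw_imp_surj_on[OF d(3)] .
  have "V G \<noteq> {}" and conn: "\<And>u v. u \<in> V G \<Longrightarrow> v \<in> V G \<Longrightarrow> (u, v) \<in> (adj G (E G))\<^sup>*"
    and pos: "\<And>v. v \<in> V G \<Longrightarrow> 2 * int (wt G v) - 2 + int (deg G v) > 0"
    using oD(3) unfolding stable_graph_def by blast+
  have "V G' \<noteq> {}" using \<open>V G \<noteq> {}\<close> d(2) by auto
  moreover have "(u', v') \<in> (adj G' (E G'))\<^sup>*" if uv: "u' \<in> V G'" "v' \<in> V G'" for u' v'
  proof -
    obtain u v where "u \<in> V G" "v \<in> V G" "u' = \<phi> u" "v' = \<phi> v"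
      using uv unfolding d(2)[symmetric] by auto
    then show ?thesis using contr_path_image[OF c order_refl conn] unfolding im by simp
  qed
  moreover have "2 * int (wt G' v') - 2 + int (deg G' v') > 0" if v': "v' \<in> V G'" for v'
  proof -
    let ?F = "{v \<in> V G. \<phi> v = v'}"
    have "E G \<inter> S = S" using d(1) by auto
    then have "deg G' v' + 2 * card {e \<in> S. \<phi> (fst (ends G e)) = v'} = (\<Sum>v \<in> ?F. deg G v)"
      using contr_degP[OF c oD(1) order_refl, of v'] unfolding im deg_def by simp
    then have "int (deg G' v') + 2 * int (card {e \<in> S. \<phi> (fst (ends G e)) = v'}) = (\<Sum>v \<in> ?F. int (deg G v))"
      unfolding of_nat_sum[symmetric] by linarith
    moreover have "(\<Sum>v \<in> ?F. 2 * int (wt G v) - 2 + int (deg G v))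
       = 2 * (\<Sum>v \<in> ?F. int (wt G v) - 1) + (\<Sum>v \<in> ?F. int (deg G v))"
      unfolding sum_distrib_left sum.distrib[symmetric] by (intro sum.cong) auto
    moreover have "(\<Sum>v \<in> ?F. 2 * int (wt G v) - 2 + int (deg G v)) > 0"
    proof (rule sum_pos)
      show "?F \<noteq> {}" using v' unfolding d(2)[symmetric] by auto
    qed (use pos oD(7) in auto)
    ultimately show ?thesis using d(7)[OF v'] by linarith
  qed
  ultimately have "stable_graph G'" using wf' unfolding stable_graph_def wf_graph_def by simp
  moreover have "genus G' = int g"
  proof -
    have "card (E G') = card (E G) - card S" "card S \<le> card (E G)"
      using bij_betw_same_card[OF d(3)] d(1) card_Diff_subset[OF finS d(1)] card_mono[OF oD(6) d(1)] by auto
    moreover have "{v \<in> V G. \<phi> v \<in> V G'} = V G" "{e \<in> S. \<phi> (fst (ends G e)) \<in> V G'} = S"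
      using d(1,2) oD(1) unfolding wf_graph_def by auto
    ultimately show ?thesis
      using contr_weight_sum[OF c oD(1) order_refl] oD(4) unfolding genus_alt by auto
  qed
  moreover have "cyc G' P'"
    unfolding cyc_def
  proof (intro conjI ballI)
    show "P' \<subseteq> E G'" using d(8) im oD(2) by auto
    fix v'
    have "even (\<Sum>v \<in> {v \<in> V G. \<phi> v = v'}. degP G P v)"
      using oD(5) unfolding cyc_def by (intro dvd_sum) auto
    then have "even (degP G' P' v' + 2 * card {e \<in> P \<inter> S. \<phi> (fst (ends G e)) = v'})"
      using contr_degP[OF c oD(1,2), of v'] unfolding d(8) by simp
    then show "even (degP G' P' v')" by simp
  qed
  ultimately show ?thesis unfolding Obj_def by simp
qed

section \<open>Existence of contractions\<close>

lemma contr_refl: "contr G P G P {} id id"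
proof -
  have "{v' \<in> V G. v' = v} = {v}" if "v \<in> V G" for v using that by auto
  then show ?thesis unfolding contr_iff by auto
qed

lemma contr_edge:
  assumes wf: "wf_graph G" and e: "e \<in> E G"
  shows "\<exists>G' \<phi>. contr G P G' (P - {e}) {e} \<phi> id"
proof -
  define a b where "a = fst (ends G e)" and "b = snd (ends G e)"
  define \<phi> where "\<phi> = (\<lambda>v. if v = b then a else v)"
  \<comment> \<open>For a loop \<open>a = b\<close>, the map \<open>\<phi>\<close> is the identity
    and the lost cycle is paid for by one unit of weight; otherwise the two ends merge and their
    weights add.\<close>
  define G' where "G' = \<lparr>V = \<phi> ` V G, E = E G - {e}, ends = \<lambda>e. map_prod \<phi> \<phi> (ends G e),
     wt = \<lambda>v. if v = a then (if a = b then wt G a + 1 else wt G a + wt G b) else wt G v\<rparr>"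
  have ab: "a \<in> V G" "b \<in> V G" using wf e unfolding wf_graph_def a_def b_def by auto
  have "contr G P G' (P - {e}) {e} \<phi> id"
    unfolding contr_iff
  proof (intro conjI ballI impI)
    show "(u, v) \<in> (adj G {e})\<^sup>*" if "u \<in> V G" "v \<in> V G" "\<phi> u = \<phi> v" for u v
    proof -
      have "(a, b) \<in> adj G {e}" "(b, a) \<in> adj G {e}"
        unfolding a_def b_def using adj_edge[of e "{e}" G] adj_sym by auto
      then show ?thesis using that unfolding \<phi>_def by (auto split: if_splits)
    qed
    show "int (wt G' w) - 1 = (\<Sum>v | v \<in> V G \<and> \<phi> v = w. int (wt G v) - 1) +
         int (card {e' \<in> {e}. \<phi> (fst (ends G e')) = w})" if w: "w \<in> V G'" for w
    proof (cases "w = a")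
      case True
      have "\<phi> a = a" by (simp add: \<phi>_def)
      then have "{v. v \<in> V G \<and> \<phi> v = w} = {a, b}" "{e' \<in> {e}. \<phi> (fst (ends G e')) = w} = {e}"
        using True ab unfolding \<phi>_def a_def by auto
      then show ?thesis using True by (auto simp: G'_def)
    next
      case False
      have "\<phi> a = a" by (simp add: \<phi>_def)
      moreover have "w \<in> V G" "w \<noteq> b \<or> a = b" using w False unfolding G'_def \<phi>_def by (auto split: if_splits)
      ultimately have "{v. v \<in> V G \<and> \<phi> v = w} = {w}" "{e' \<in> {e}. \<phi> (fst (ends G e')) = w} = {}"
        using False ab unfolding \<phi>_def a_def by auto
      then show ?thesis using False by (auto simp: G'_def)
    qed
    show "bij_betw id (E G - {e}) (E G')" by (simp add: G'_def bij_betw_def)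
    show "\<phi> (fst (ends G e')) = \<phi> (snd (ends G e'))" if "e' \<in> {e}" for e'
      using that by (simp add: \<phi>_def a_def b_def)
    show "ends G' (id e') = (\<phi> (fst (ends G e')), \<phi> (snd (ends G e'))) \<or>
      ends G' (id e') = (\<phi> (snd (ends G e')), \<phi> (fst (ends G e')))" for e'
      by (simp add: G'_def map_prod_def split_beta)
  qed (use e in \<open>simp_all add: G'_def\<close>)
  then show ?thesis by blast
qed

text \<open>Contracting edge by edge keeps the surviving edge names, so \<open>\<psi>\<close> is the
  identity and a length function can be reused unchanged on the contracted graph.\<close>

lemma contr_exists:
  assumes wf: "wf_graph G" and P: "P \<subseteq> E G" and S: "S \<subseteq> E G"
  shows "\<exists>G' \<phi>. contr G P G' (P - S) S \<phi> id"
proof -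
  have "finite S" using S wf finite_subset unfolding wf_graph_def by auto
  then show ?thesis using S
  proof (induction S rule: finite_induct)
    case empty
    show ?case by (metis Diff_empty contr_refl)
  next
    case (insert e S)
    then obtain G0 \<phi>0 where c0: "contr G P G0 (P - S) S \<phi>0 id"
      by (meson insert_subset)
    have "e \<in> E G0" using contrD(3)[OF c0] insert by (auto simp: bij_betw_def)
    then obtain G' \<phi> where "contr G0 (P - S) G' (P - S - {e}) {e} \<phi> id"
      using contr_edge[OF contr_wf_graph[OF c0 wf]] by blast
    then have "contr G P G' (P - S - {e}) (S \<union> {e' \<in> E G - S. id e' \<in> {e}}) (\<phi> \<circ> \<phi>0) (id \<circ> id)"
      by (rule contr_comp[OF c0 _ wf P])
    moreover have "S \<union> {e' \<in> E G - S. id e' \<in> {e}} = insert e S" "P - S - {e} = P - insert e S"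
      using insert by auto
    ultimately show ?case by (metis comp_id)
  qed
qed

section \<open>The colimit relation\<close>

lemma cone_int_subset: "cone_int G \<subseteq> cone G"
proof
  fix x assume x: "x \<in> cone_int G"
  have "0 \<le> x e" for e using x by (cases "e \<in> E G") (auto simp: cone_int_def less_imp_le)
  then show "x \<in> cone G" using x by (auto simp: cone_int_def cone_def)
qed

lemma iota_id: "x \<in> cone G \<Longrightarrow> iota G {} id x = x"
  unfolding iota_def cone_def by auto

lemma iota_in_cone:
  assumes "x \<in> cone G'" shows "iota G S \<psi> x \<in> cone G"
  using assms unfolding iota_def cone_def by auto

lemma iota_in_cone_int:
  assumes "bij_betw \<psi> (E G) (E G')" "x \<in> cone_int G'" shows "iota G {} \<psi> x \<in> cone_int G"
  using bij_betw_apply[OF assms(1)] assms(2) unfolding iota_def cone_int_def by simp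

lemma iota_comp:
  assumes "bij_betw \<psi> (E G - S) (E G')"
  shows "iota G S \<psi> (iota G' S' \<psi>' x) = iota G (S \<union> {e \<in> E G - S. \<psi> e \<in> S'}) (\<psi>' \<circ> \<psi>) x"
  using bij_betw_apply[OF assms] unfolding iota_def by auto

text \<open>Interior points serve as normal forms: every point reduces to one, uniquely up to
  isomorphism.\<close>

definition reduces :: "nat \<Rightarrow> cpt \<Rightarrow> cpt \<Rightarrow> bool" where
  "reduces g a n \<longleftrightarrow> fst a \<in> Obj g \<and> fst n \<in> Obj g \<and> snd n \<in> cone_int (fst (fst n)) \<and>
     (\<exists>S \<phi> \<psi>. contr (fst (fst a)) (snd (fst a)) (fst (fst n)) (snd (fst n)) S \<phi> \<psi> \<and>
        snd a = iota (fst (fst a)) S \<psi> (snd n))"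

lemma reduces_iff:
  "reduces g ((G, P), x) ((H, Q), z) \<longleftrightarrow> (G, P) \<in> Obj g \<and> (H, Q) \<in> Obj g \<and> z \<in> cone_int H \<and>
     (\<exists>S \<phi> \<psi>. contr G P H Q S \<phi> \<psi> \<and> x = iota G S \<psi> z)"
  by (simp add: reduces_def)

lemma gen_rel_iff:
  "(((G', P'), x'), ((G, P), x)) \<in> gen_rel g \<longleftrightarrow> (G, P) \<in> Obj g \<and> (G', P') \<in> Obj g \<and> x' \<in> cone G' \<and>
     (\<exists>S \<phi> \<psi>. contr G P G' P' S \<phi> \<psi> \<and> x = iota G S \<psi> x')"
  unfolding gen_rel_def by auto

lemma reduces_imp_gen_rel: "reduces g a n \<Longrightarrow> (n, a) \<in> gen_rel g"
proof -
  assume r: "reduces g a n"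
  obtain G P x H Q z where eq: "a = ((G, P), x)" "n = ((H, Q), z)" by (metis surj_pair)
  show ?thesis using r cone_int_subset[of H] unfolding eq reduces_iff gen_rel_iff by blast
qed

lemma reduces_self:
  assumes "(G, P) \<in> Obj g" "x \<in> cone_int G" shows "reduces g ((G, P), x) ((G, P), x)"
proof -
  have "x = iota G {} id x" using iota_id[of x G] assms cone_int_subset[of G] by auto
  then show ?thesis using assms contr_refl[of G P] unfolding reduces_iff by blast
qed

lemma reduces_exists:
  assumes o: "(G, P) \<in> Obj g" and x: "x \<in> cone G"
  shows "\<exists>n. reduces g ((G, P), x) n"
proof -
  let ?S = "{e \<in> E G. x e = 0}"
  obtain G' \<phi> where c: "contr G P G' (P - ?S) ?S \<phi> id"
    using contr_exists[OF ObjD(1,2)[OF o], of ?S] by blast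
  have "E G' = E G - ?S" using contrD(3)[OF c] by (auto simp: bij_betw_def)
  then have "x \<in> cone_int G'" "x = iota G ?S id x"
    using x unfolding cone_int_def cone_def iota_def by (auto simp: less_le fun_eq_iff)
  then show ?thesis using c o contr_Obj[OF c o] reduces_iff by blast
qed

text \<open>Composition of contractions carries a normal form from a face to the larger cone. The
  opposite direction needs confluence.\<close>

lemma gen_rel_reduces:
  assumes g: "(a, b) \<in> gen_rel g" and r: "reduces g a n"
  shows "reduces g b n"
proof -
  obtain G P x G' P' x' H Q z where eq: "a = ((G', P'), x')" "b = ((G, P), x)" "n = ((H, Q), z)"
    by (metis surj_pair)
  obtain S \<phi> \<psi> where 1: "contr G P G' P' S \<phi> \<psi>" "x = iota G S \<psi> x'" and o: "(G, P) \<in> Obj g"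
    using g unfolding eq gen_rel_iff by auto
  obtain S' \<phi>' \<psi>' where 2: "contr G' P' H Q S' \<phi>' \<psi>'" "x' = iota G' S' \<psi>' z"
    using r unfolding eq reduces_iff by auto
  show ?thesis
    using r o contr_comp[OF 1(1) 2(1) ObjD(1,2)[OF o]] iota_comp[OF contrD(3)[OF 1(1)]]
    unfolding eq reduces_iff 1 2 by blast
qed

text \<open>The contracted set is determined by the point itself, because an interior point of the
  face has no zero coordinate on an edge. This is the source of uniqueness of normal forms.\<close>

lemma iota_zero_set:
  assumes "bij_betw \<psi> (E G - S) (E H)" "z \<in> cone_int H" "S \<subseteq> E G"
  shows "{e \<in> E G. iota G S \<psi> z e = 0} = S"
proof -
  have "z (\<psi> e) > 0" if "e \<in> E G - S" for e
    using bij_betw_apply[OF assms(1) that] assms(2) by (simp add: cone_int_def)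
  then show ?thesis using assms(3) unfolding iota_def by force
qed

lemma reduces_confluent:
  assumes r: "reduces g a n" and r': "reduces g a n'"
  shows "reduces g n n'"
proof -
  obtain G P x H Q z H' Q' z' where eq: "a = ((G, P), x)" "n = ((H, Q), z)" "n' = ((H', Q'), z')"
    by (metis surj_pair)
  obtain S \<phi> \<psi> where 1: "contr G P H Q S \<phi> \<psi>" "x = iota G S \<psi> z" and o: "(G, P) \<in> Obj g" "z \<in> cone_int H"
    using r unfolding eq reduces_iff by auto
  obtain S' \<phi>' \<psi>' where 2: "contr G P H' Q' S' \<phi>' \<psi>'" "x = iota G S' \<psi>' z'" and o': "z' \<in> cone_int H'"
    using r' unfolding eq reduces_iff by auto
  have S: "S' = S"
    using iota_zero_set[OF contrD(3)[OF 1(1)] o(2) contrD(1)[OF 1(1)]]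
      iota_zero_set[OF contrD(3)[OF 2(1)] o' contrD(1)[OF 2(1)]] 1(2) 2(2) by simp
  \<comment> \<open>Both reductions contract the same set, so the factor contracts the image of the
    empty set.\<close>
  obtain \<phi>3 \<psi>3 where c3: "contr H Q H' Q' (\<psi> ` (S - S)) \<phi>3 \<psi>3"
    and \<psi>3: "\<And>e. e \<in> E G - S \<Longrightarrow> \<psi>3 (\<psi> e) = \<psi>' e"
    using contr_factor[OF 1(1) 2(1)[unfolded S] order_refl ObjD(1,2)[OF o(1)]] by blast
  have "z e' = iota H {} \<psi>3 z' e'" for e'
  proof (cases "e' \<in> E H")
    case True
    then have "e' \<in> \<psi> ` (E G - S)" using bij_betw_imp_surj_on[OF contrD(3)[OF 1(1)]] by simp
    then obtain e where e: "e \<in> E G - S" "e' = \<psi> e" by auto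
    then have "z e' = z' (\<psi>' e)"
      using fun_cong[OF 1(2), of e] fun_cong[OF 2(2), of e] unfolding S iota_def by simp
    then show ?thesis using e True \<psi>3 unfolding iota_def by simp
  qed (use o(2) in \<open>auto simp: cone_int_def iota_def\<close>)
  then have "z = iota H {} \<psi>3 z'" by auto
  then show ?thesis using r r' c3 unfolding eq reduces_iff by (auto simp: reduces_iff)
qed

lemma reduces_trans:
  assumes "reduces g a n" "reduces g n m" shows "reduces g a m"
  using gen_rel_reduces[OF reduces_imp_gen_rel[OF assms(1)] assms(2)] .

lemma ceq_sym: "(a, b) \<in> ceq g \<Longrightarrow> (b, a) \<in> ceq g"
  unfolding ceq_def by (rule symD[OF sym_rtrancl[OF sym_Un_converse]])

lemma ceq_trans: "(a, b) \<in> ceq g \<Longrightarrow> (b, c) \<in> ceq g \<Longrightarrow> (a, c) \<in> ceq g"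
  unfolding ceq_def by (rule rtrancl_trans)

lemma ceq_refl: "(a, a) \<in> ceq g"
  unfolding ceq_def by simp

lemma gen_rel_ceq: "(a, b) \<in> gen_rel g \<Longrightarrow> (a, b) \<in> ceq g"
  unfolding ceq_def by auto

lemma reduces_ceq: "reduces g a n \<Longrightarrow> (a, n) \<in> ceq g"
  by (rule ceq_sym[OF gen_rel_ceq[OF reduces_imp_gen_rel]])

lemma ceq_reduces:
  assumes "(a, b) \<in> ceq g" and "reduces g a n"
  shows "reduces g b n"
  using assms(1) unfolding ceq_def
proof (induction rule: rtrancl_induct)
  case base
  show ?case by (rule assms(2))
next
  case (step b c)
  show ?case
  proof (cases "(b, c) \<in> gen_rel g")
    case False
    \<comment> \<open>A backward step: some normal form \<open>m\<close> of \<open>c\<close> is also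
      one of \<open>b\<close>, hence is linked to \<open>n\<close> by confluence.\<close>
    then have cb: "(c, b) \<in> gen_rel g" using step by auto
    then obtain m where m: "reduces g c m"
      using reduces_exists[of "fst (fst c)" "snd (fst c)" g "snd c"] unfolding gen_rel_def by auto
    show ?thesis
      using reduces_trans[OF m reduces_confluent[OF gen_rel_reduces[OF cb m] step.IH]] .
  qed (use gen_rel_reduces step.IH in blast)
qed

text \<open>An interior point is its own normal form and has no zero coordinate on its edges, so the
  contraction relating two of them contracts nothing.\<close>

lemma ceq_interior_iff:
  assumes o: "(G, P) \<in> Obj g" "(G', P') \<in> Obj g" and x: "x \<in> cone_int G" "y \<in> cone_int G'"
  shows "(((G, P), x), ((G', P'), y)) \<in> ceq g \<longleftrightarrow> (\<exists>\<phi> \<psi>. contr G P G' P' {} \<phi> \<psi> \<and> x = iota G {} \<psi> y)"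
    (is "?L \<longleftrightarrow> ?R")
proof
  assume ?L
  then have "reduces g ((G, P), x) ((G', P'), y)"
    using ceq_reduces[OF ceq_sym] reduces_self[OF o(2) x(2)] by blast
  then obtain S \<phi> \<psi> where c: "contr G P G' P' S \<phi> \<psi>" "x = iota G S \<psi> y"
    unfolding reduces_iff by auto
  have "S = {e \<in> E G. x e = 0}"
    using iota_zero_set[OF contrD(3)[OF c(1)] x(2) contrD(1)[OF c(1)]] c(2) by simp
  then have "S = {}" using x(1) unfolding cone_int_def by auto
  then show ?R using c by auto
next
  assume ?R
  then have "reduces g ((G, P), x) ((G', P'), y)" using o x unfolding reduces_iff by blast
  then show ?L by (rule reduces_ceq)
qed

text \<open>The identity contraction factored through the given isomorphism.\<close>

lemma contr_inverse:
  assumes c: "contr G P G' P' {} \<phi> \<psi>" and o: "(G, P) \<in> Obj g"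
  shows "\<exists>\<phi>' \<psi>'. contr G' P' G P {} \<phi>' \<psi>'"
proof -
  obtain \<phi>' \<psi>' where "contr G' P' G P (\<psi> ` ({} - {})) \<phi>' \<psi>'"
    using contr_factor[OF c contr_refl order_refl ObjD(1,2)[OF o]] by blast
  then show ?thesis by auto
qed

section \<open>Topology of the colimit\<close>

lemma topspace_sumtop: "topspace (sumtop g) = Sigma (Obj g) (\<lambda>GP. cone (fst GP))"
  by (auto simp: sumtop_def)

lemma in_topspace_sumtop_iff: "((G, P), x) \<in> topspace (sumtop g) \<longleftrightarrow> (G, P) \<in> Obj g \<and> x \<in> cone G"
  by (simp add: topspace_sumtop)

lemma reduces_in_topspace: "reduces g a n \<Longrightarrow> a \<in> topspace (sumtop g)"
  using cone_int_subset iota_in_cone unfolding reduces_def topspace_sumtop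
  by (metis (no_types, lifting) SigmaI prod.collapse subsetD)

lemma reduces_exists': "a \<in> topspace (sumtop g) \<Longrightarrow> \<exists>n. reduces g a n"
  using reduces_exists by (metis in_topspace_sumtop_iff surj_pair)

lemma ceq_in_topspace: "(a, b) \<in> ceq g \<Longrightarrow> a \<in> topspace (sumtop g) \<Longrightarrow> b \<in> topspace (sumtop g)"
  using reduces_exists' ceq_reduces reduces_in_topspace by blast

lemma cls_eq_iff: "cls g a = cls g b \<longleftrightarrow> (a, b) \<in> ceq g"
  unfolding cls_def using ceq_refl ceq_sym ceq_trans by blast

lemma Tg_eq_image: "Tg g = cls g ` topspace (sumtop g)"
  unfolding Tg_def quotient_def cls_def by auto

lemma cls_in_Tg_iff: "cls g a \<in> Tg g \<longleftrightarrow> a \<in> topspace (sumtop g)"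
  unfolding Tg_eq_image by (auto simp: image_iff cls_eq_iff intro: ceq_in_topspace ceq_refl dest: ceq_sym)

lemma Union_classes:
  assumes "U \<subseteq> Tg g" shows "\<Union>U = {a. cls g a \<in> U}"
proof (intro equalityI subsetI CollectI)
  fix a assume "a \<in> \<Union>U"
  then obtain b where b: "a \<in> cls g b" "cls g b \<in> U" using assms unfolding Tg_eq_image by blast
  then have "cls g a = cls g b" unfolding cls_eq_iff using ceq_sym by (simp add: cls_def)
  then show "cls g a \<in> U" using b by simp
next
  fix a assume "a \<in> {a. cls g a \<in> U}"
  moreover have "a \<in> cls g a" using ceq_refl by (simp add: cls_def)
  ultimately show "a \<in> \<Union>U" by auto
qed

text \<open>Preimages under \<open>cls g\<close> commute with finite intersections and unions, so
  the generating family is already closed under them and the generated topology is the quotient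
  topology.\<close>

lemma openin_Ttop: "openin (Ttop g) U \<longleftrightarrow> U \<subseteq> Tg g \<and> openin (sumtop g) {a. cls g a \<in> U}"
proof
  let ?S = "{U. U \<subseteq> Tg g \<and> openin (sumtop g) (\<Union>U)}"
  assume "openin (Ttop g) U"
  then have "generate_topology_on ?S U"
    unfolding Ttop_def openin_topology_generated_by_iff .
  then show "U \<subseteq> Tg g \<and> openin (sumtop g) {a. cls g a \<in> U}"
  proof induction
    case (Int A B)
    have "{a. cls g a \<in> A \<inter> B} = {a. cls g a \<in> A} \<inter> {a. cls g a \<in> B}" by auto
    then show ?case using Int.IH by auto
  next
    case (UN K)
    have "{a. cls g a \<in> \<Union>K} = (\<Union>k\<in>K. {a. cls g a \<in> k})" by auto
    moreover have "openin (sumtop g) (\<Union>k\<in>K. {a. cls g a \<in> k})" using UN.IH by (intro openin_Union) auto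
    ultimately show ?case using UN.IH by (metis Union_least)
  next
    case (Basis s)
    then show ?case using Union_classes[of s g] by simp
  qed simp
next
  assume "U \<subseteq> Tg g \<and> openin (sumtop g) {a. cls g a \<in> U}"
  then show "openin (Ttop g) U"
    unfolding Ttop_def using Union_classes[of U g] by (intro topology_generated_by_Basis) simp
qed

lemma openin_Ttop_iff:
  "openin (Ttop g) U \<longleftrightarrow> U \<subseteq> Tg g \<and>
     (\<forall>G P. (G, P) \<in> Obj g \<longrightarrow> openin (top_of_set (cone G)) {x. cls g ((G, P), x) \<in> U})"
proof -
  have "{a. cls g a \<in> U} \<subseteq> Sigma (Obj g) (\<lambda>GP. cone (fst GP))" if "U \<subseteq> Tg g"
    using that cls_in_Tg_iff topspace_sumtop by blast
  then show ?thesis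
    unfolding openin_Ttop unfolding sumtop_def openin_sum_topology by (auto simp: comp_def)
qed

lemma topspace_Ttop: "topspace (Ttop g) = Tg g"
proof -
  have "{x. cls g ((G, P), x) \<in> Tg g} = cone G" if "(G, P) \<in> Obj g" for G P
    using that by (auto simp: cls_in_Tg_iff in_topspace_sumtop_iff)
  then have "openin (Ttop g) (Tg g)" unfolding openin_Ttop_iff by simp
  moreover have "U \<subseteq> Tg g" if "openin (Ttop g) U" for U using that openin_Ttop by blast
  ultimately show ?thesis by (metis openin_subset openin_topspace subset_antisym)
qed

lemma gen_rel_cls: "(a, b) \<in> gen_rel g \<Longrightarrow> cls g a = cls g b"
  by (simp add: cls_eq_iff gen_rel_ceq)

section \<open>Strata and their open neighbourhoods\<close>

lemma strat_subset_Tg: "(G, P) \<in> Obj g \<Longrightarrow> strat g G P \<subseteq> Tg g"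
  using cone_int_subset[of G] unfolding strat_def by (auto simp: cls_in_Tg_iff in_topspace_sumtop_iff)

lemma Tg_eq_strata: "Tg g = (\<Union>GP \<in> Obj g. strat g (fst GP) (snd GP))"
proof
  show "(\<Union>GP \<in> Obj g. strat g (fst GP) (snd GP)) \<subseteq> Tg g"
  proof (rule UN_least)
    show "strat g (fst GP) (snd GP) \<subseteq> Tg g" if "GP \<in> Obj g" for GP
      using strat_subset_Tg[of "fst GP" "snd GP" g] that by simp
  qed
  show "Tg g \<subseteq> (\<Union>GP \<in> Obj g. strat g (fst GP) (snd GP))"
  proof
    fix c assume "c \<in> Tg g"
    then obtain a where a: "c = cls g a" "a \<in> topspace (sumtop g)" unfolding Tg_eq_image by auto
    then obtain n where n: "reduces g a n" using reduces_exists' by blast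
    then have "c = cls g n" using a reduces_ceq cls_eq_iff by metis
    then have "c \<in> strat g (fst (fst n)) (snd (fst n))" "fst n \<in> Obj g"
      using n unfolding reduces_def strat_def by (auto intro!: exI[of _ "snd n"])
    then show "c \<in> (\<Union>GP \<in> Obj g. strat g (fst GP) (snd GP))" by blast
  qed
qed

lemma strat_iso_subset:
  assumes c: "contr G' P' G P {} \<phi> \<psi>" and o: "(G, P) \<in> Obj g" "(G', P') \<in> Obj g"
  shows "strat g G P \<subseteq> strat g G' P'"
proof
  fix c assume "c \<in> strat g G P"
  then obtain x where x: "c = cls g ((G, P), x)" "x \<in> cone_int G" unfolding strat_def by auto
  have "(((G, P), x), ((G', P'), iota G' {} \<psi> x)) \<in> gen_rel g"
    using o c x(2) cone_int_subset[of G] unfolding gen_rel_iff by blast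
  moreover have "iota G' {} \<psi> x \<in> cone_int G'"
    using iota_in_cone_int contrD(3)[OF c] x(2) by simp
  ultimately show "c \<in> strat g G' P'" using gen_rel_cls x(1) unfolding strat_def by blast
qed

lemma strat_iso:
  assumes o: "GP \<in> Obj g" "GP' \<in> Obj g" and i: "pair_iso GP GP'"
  shows "strat g (fst GP) (snd GP) = strat g (fst GP') (snd GP')"
proof -
  obtain \<phi> \<psi> where c: "contr (fst GP) (snd GP) (fst GP') (snd GP') {} \<phi> \<psi>"
    using i unfolding pair_iso_def by auto
  moreover obtain \<phi>' \<psi>' where "contr (fst GP') (snd GP') (fst GP) (snd GP) {} \<phi>' \<psi>'"
    using contr_inverse[OF c, of g] o(1) by auto
  ultimately show ?thesis using strat_iso_subset o by (metis prod.collapse subset_antisym)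
qed

lemma strat_disjoint:
  assumes o: "GP \<in> Obj g" "GP' \<in> Obj g" and i: "\<not> pair_iso GP GP'"
  shows "strat g (fst GP) (snd GP) \<inter> strat g (fst GP') (snd GP') = {}"
proof (rule ccontr)
  assume "\<not> ?thesis"
  then obtain x y where "x \<in> cone_int (fst GP)" "y \<in> cone_int (fst GP')"
    "cls g (GP, x) = cls g (GP', y)" unfolding strat_def by auto
  then show False
    using i o ceq_interior_iff[of "fst GP" "snd GP" g "fst GP'" "snd GP'" x y]
    unfolding pair_iso_def cls_eq_iff by auto
qed

text \<open>For \<open>A\<close> open in the interior of the cone of \<open>(G, P)\<close> this is an open union of classes which
  traces \<open>A\<close> (up to automorphisms) on that stratum.\<close>

definition star :: "nat \<Rightarrow> sgraph \<Rightarrow> nat set \<Rightarrow> (nat \<Rightarrow> real) set \<Rightarrow> cpt set" where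
  "star g G P A = {((G', P'), y) | G' P' y. (G', P') \<in> Obj g \<and> y \<in> cone G' \<and>
     (\<exists>S \<phi> \<psi>. contr G' P' G P S \<phi> \<psi> \<and> (\<exists>a \<in> A. \<forall>e \<in> E G' - S. y e = a (\<psi> e)))}"

lemma in_star_iff:
  "((G', P'), y) \<in> star g G P A \<longleftrightarrow> (G', P') \<in> Obj g \<and> y \<in> cone G' \<and>
     (\<exists>S \<phi> \<psi>. contr G' P' G P S \<phi> \<psi> \<and> (\<exists>a \<in> A. \<forall>e \<in> E G' - S. y e = a (\<psi> e)))"
  unfolding star_def by blast

text \<open>Stars are compatible with reduction, hence saturated. From \<open>b\<close> to
  \<open>n\<close> the contraction factors through the normal form, from \<open>n\<close> to
  \<open>b\<close> it is composed with the reduction.\<close>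

lemma star_reduces:
  assumes r: "reduces g b n" and A: "A \<subseteq> cone_int G"
  shows "b \<in> star g G P A \<longleftrightarrow> n \<in> star g G P A"
proof -
  obtain G' P' y H Q z where eq: "b = ((G', P'), y)" "n = ((H, Q), z)" by (metis surj_pair)
  obtain Z \<phi>1 \<psi>1 where c1: "contr G' P' H Q Z \<phi>1 \<psi>1" "y = iota G' Z \<psi>1 z" and o: "(G', P') \<in> Obj g"
    and oz: "(H, Q) \<in> Obj g" "z \<in> cone_int H"
    using r unfolding eq reduces_iff by auto
  have yz: "y e = z (\<psi>1 e)" if "e \<in> E G' - Z" for e using c1(2) that by (simp add: iota_def)
  have Z: "{e \<in> E G'. y e = 0} = Z"
    unfolding c1(2) by (rule iota_zero_set[OF contrD(3)[OF c1(1)] oz(2) contrD(1)[OF c1(1)]])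
  show ?thesis
  proof
    assume "b \<in> star g G P A"
    then obtain S \<phi> \<psi> a where c: "contr G' P' G P S \<phi> \<psi>" and a: "a \<in> A" "\<forall>e \<in> E G' - S. y e = a (\<psi> e)"
      unfolding eq in_star_iff by blast
    \<comment> \<open>Points of \<open>A\<close> are positive on all edges, so every zero coordinate
      of \<open>y\<close> belongs to a contracted edge; this is the inclusion required for
      factoring.\<close>
    have "y e \<noteq> 0" if "e \<in> E G' - S" for e
      using that a A bij_betw_apply[OF contrD(3)[OF c] that] unfolding cone_int_def by force
    then have ZS: "Z \<subseteq> S" using Z by blast
    obtain \<phi>3 \<psi>3 where c3: "contr H Q G P (\<psi>1 ` (S - Z)) \<phi>3 \<psi>3"
      and \<psi>3: "\<And>e. e \<in> E G' - Z \<Longrightarrow> \<psi>3 (\<psi>1 e) = \<psi> e"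
      using contr_factor[OF c1(1) c ZS ObjD(1,2)[OF o]] by blast
    have "z e' = a (\<psi>3 e')" if e': "e' \<in> E H - \<psi>1 ` (S - Z)" for e'
    proof -
      have "e' \<in> \<psi>1 ` (E G' - Z)" using e' bij_betw_imp_surj_on[OF contrD(3)[OF c1(1)]] by auto
      then obtain e where e: "e \<in> E G' - Z" "e' = \<psi>1 e" by auto
      then have "e \<in> E G' - S" using e' by auto
      then show ?thesis using a(2) yz[OF e(1)] \<psi>3[OF e(1)] e(2) by auto
    qed
    then show "n \<in> star g G P A"
      unfolding eq in_star_iff using oz c3 a(1) cone_int_subset[of H] by blast
  next
    assume "n \<in> star g G P A"
    then obtain S \<phi> \<psi> a where c: "contr H Q G P S \<phi> \<psi>" and a: "a \<in> A" "\<forall>e \<in> E H - S. z e = a (\<psi> e)"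
      unfolding eq in_star_iff by blast
    let ?T = "Z \<union> {e \<in> E G' - Z. \<psi>1 e \<in> S}"
    have "contr G' P' G P ?T (\<phi> \<circ> \<phi>1) (\<psi> \<circ> \<psi>1)"
      by (rule contr_comp[OF c1(1) c ObjD(1,2)[OF o]])
    moreover have "y e = a ((\<psi> \<circ> \<psi>1) e)" if "e \<in> E G' - ?T" for e
      using that yz[of e] a(2) bij_betw_apply[OF contrD(3)[OF c1(1)], of e] by auto
    moreover have "y \<in> cone G'"
      using reduces_in_topspace[OF r] unfolding eq in_topspace_sumtop_iff by simp
    ultimately show "b \<in> star g G P A"
      unfolding eq in_star_iff using o a(1) by blast
  qed
qed

lemma cls_in_star_iff:
  assumes A: "A \<subseteq> cone_int G"
  shows "cls g b \<in> cls g ` star g G P A \<longleftrightarrow> b \<in> star g G P A"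
proof
  assume "cls g b \<in> cls g ` star g G P A"
  then obtain a where a: "a \<in> star g G P A" "(a, b) \<in> ceq g" using cls_eq_iff by (metis imageE ceq_sym)
  then have "a \<in> topspace (sumtop g)" unfolding star_def topspace_sumtop by auto
  then obtain n where "reduces g a n" using reduces_exists' by blast
  then show "b \<in> star g G P A" using ceq_reduces[OF a(2)] star_reduces[OF _ A] a(1) by blast
qed blast

text \<open>A contraction witnessing membership of one point also serves all nearby points of the
  same cone, since only the coordinates outside \<open>S\<close> are constrained, and they are
  constrained by an open condition.\<close>

lemma openin_star:
  assumes "open U" and A: "A = cone_int G \<inter> U" and fin: "finite (E G)"
  shows "openin (Ttop g) (cls g ` star g G P A)"
  unfolding openin_Ttop_iff
proof (intro conjI allI impI)
  show "cls g ` star g G P A \<subseteq> Tg g"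
    unfolding Tg_eq_image topspace_sumtop star_def by (intro image_mono) auto
  fix G' P' assume o: "(G', P') \<in> Obj g"
  have A': "A \<subseteq> cone_int G" using A by simp
  have "\<exists>T. openin (top_of_set (cone G')) T \<and> y0 \<in> T \<and> T \<subseteq> {y. ((G', P'), y) \<in> star g G P A}"
    if y0: "((G', P'), y0) \<in> star g G P A" for y0
  proof -
    obtain S \<phi> \<psi> a where c: "contr G' P' G P S \<phi> \<psi>" and a: "a \<in> A" "\<forall>e \<in> E G' - S. y0 e = a (\<psi> e)"
      and y0c: "y0 \<in> cone G'"
      using y0 unfolding in_star_iff by blast
    have bij: "bij_betw \<psi> (E G' - S) (E G)" by (rule contrD(3)[OF c])
    \<comment> \<open>\<open>r\<close> reads the uncontracted coordinates of \<open>y\<close> as a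
      point over \<open>E G\<close>, with zeros elsewhere as required by
      \<open>cone_int\<close>.\<close>
    define r :: "(nat \<Rightarrow> real) \<Rightarrow> nat \<Rightarrow> real"
      where "r = (\<lambda>y e. if e \<in> E G then y (inv_into (E G' - S) \<psi> e) else 0)"
    have r: "r y (\<psi> e) = y e" if "e \<in> E G' - S" for y e
      using that bij_betw_apply[OF bij that] bij unfolding r_def bij_betw_def by simp
    have cont: "continuous_on UNIV r"
    proof (rule continuous_on_coordinatewise_then_product)
      show "continuous_on UNIV (\<lambda>y. r y i)" for i by (cases "i \<in> E G") (simp_all add: r_def)
    qed
    \<comment> \<open>In the product topology positivity on all edges is open because there are
      finitely many of them.\<close>
    have "open {z :: nat \<Rightarrow> real. \<forall>e \<in> E G. 0 < z e}"
    proof -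
      have "open (\<Inter>e\<in>E G. {z :: nat \<Rightarrow> real. 0 < z e})"
        using fin by (intro open_INT ballI open_Collect_less) auto
      moreover have "(\<Inter>e\<in>E G. {z :: nat \<Rightarrow> real. 0 < z e}) = {z. \<forall>e \<in> E G. 0 < z e}" by auto
      ultimately show ?thesis by simp
    qed
    then have "open (U \<inter> {z. \<forall>e \<in> E G. 0 < z e})" using \<open>open U\<close> by blast
    then have op: "open (r -` (U \<inter> {z. \<forall>e \<in> E G. 0 < z e}))" by (rule open_vimage[OF _ cont])
    let ?T = "cone G' \<inter> r -` (U \<inter> {z. \<forall>e \<in> E G. 0 < z e})"
    have "r y0 = a"
    proof
      fix e' show "r y0 e' = a e'"
      proof (cases "e' \<in> E G")
        case True
        then have "e' \<in> \<psi> ` (E G' - S)" using bij by (simp add: bij_betw_def)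
        then obtain e where "e \<in> E G' - S" "e' = \<psi> e" by auto
        then show ?thesis using r a(2) by simp
      qed (use a(1) A' in \<open>auto simp: r_def cone_int_def\<close>)
    qed
    then have "y0 \<in> ?T" using a(1) A y0c by (auto simp: cone_int_def)
    moreover have "?T \<subseteq> {y. ((G', P'), y) \<in> star g G P A}"
    proof
      fix y assume y: "y \<in> ?T"
      have "r y \<in> A" using y unfolding A cone_int_def by (auto simp: r_def)
      then show "y \<in> {y. ((G', P'), y) \<in> star g G P A}"
        using o c y r unfolding in_star_iff mem_Collect_eq by (metis (no_types, lifting) IntD1)
    qed
    moreover have "openin (top_of_set (cone G')) ?T" using op by (rule openin_open_Int)
    ultimately show ?thesis by blast
  qed
  then have "openin (top_of_set (cone G')) {y. ((G', P'), y) \<in> star g G P A}"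
    by (subst openin_subopen) simp
  then show "openin (top_of_set (cone G')) {x. cls g ((G', P'), x) \<in> cls g ` star g G P A}"
    unfolding cls_in_star_iff[OF A'] .
qed

text \<open>The nontrivial direction extends a set that is open in the stratum to an open set of the
  colimit. The star of its preimage does this, provided that it traces nothing more on the
  stratum.\<close>

lemma quotient_map_strat:
  assumes o: "(G, P) \<in> Obj g"
  shows "quotient_map (top_of_set (cone_int G)) (subtopology (Ttop g) (strat g G P))
           (\<lambda>x. cls g ((G, P), x))"
  unfolding quotient_map_def
proof (intro conjI allI impI)
  have ts: "topspace (subtopology (Ttop g) (strat g G P)) = strat g G P"
    using strat_subset_Tg[OF o] by (auto simp: topspace_Ttop)
  show "(\<lambda>x. cls g ((G, P), x)) ` topspace (top_of_set (cone_int G))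
      = topspace (subtopology (Ttop g) (strat g G P))"
    unfolding ts by (auto simp: strat_def)
  fix U assume "U \<subseteq> topspace (subtopology (Ttop g) (strat g G P))"
  then have U: "U \<subseteq> strat g G P" unfolding ts .
  let ?A = "{x \<in> topspace (top_of_set (cone_int G)). cls g ((G, P), x) \<in> U}"
  show "openin (top_of_set (cone_int G)) ?A \<longleftrightarrow> openin (subtopology (Ttop g) (strat g G P)) U"
  proof
    assume "openin (top_of_set (cone_int G)) ?A"
    then obtain T where T: "open T" "?A = cone_int G \<inter> T" unfolding openin_open by auto
    have A: "?A \<subseteq> cone_int G" by auto
    have op: "openin (Ttop g) (cls g ` star g G P ?A)"
      by (rule openin_star[OF T ObjD(6)[OF o]])
    have "U = cls g ` star g G P ?A \<inter> strat g G P"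
    proof (intro equalityI subsetI IntI)
      fix c assume c: "c \<in> U"
      then obtain x where x: "x \<in> cone_int G" "c = cls g ((G, P), x)" using U unfolding strat_def by auto
      then have "((G, P), x) \<in> star g G P ?A"
        unfolding in_star_iff using o c contr_refl[of G P] cone_int_subset[of G] 
        by (intro conjI exI[of _ "{}"] exI[of _ id] bexI[of _ x]) auto
      then show "c \<in> cls g ` star g G P ?A" using x by blast
      show "c \<in> strat g G P" using c U by auto
    next
      fix c assume c: "c \<in> cls g ` star g G P ?A \<inter> strat g G P"
      then obtain x where x: "x \<in> cone_int G" "c = cls g ((G, P), x)" unfolding strat_def by auto
      then have "((G, P), x) \<in> star g G P ?A" using c cls_in_star_iff[OF A] by auto
      then obtain S \<phi> \<psi> a where cc: "contr G P G P S \<phi> \<psi>" and a: "a \<in> ?A" "\<forall>e \<in> E G - S. x e = a (\<psi> e)"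
        unfolding in_star_iff by blast
      \<comment> \<open>A contraction of \<open>G\<close> onto itself loses no edge by counting, so
        it is an automorphism and the two points have the same class.\<close>
      have "card (E G - S) = card (E G)" using bij_betw_same_card[OF contrD(3)[OF cc]] .
      then have "E G - S = E G" by (intro card_subset_eq ObjD(6)[OF o]) auto
      then have S: "S = {}" using contrD(1)[OF cc] by auto
      have "x = iota G {} \<psi> a" using a(2) x(1) unfolding S iota_def cone_int_def by auto
      then have "(((G, P), a), ((G, P), x)) \<in> gen_rel g"
        unfolding gen_rel_iff using o cc a(1) cone_int_subset[of G] S by auto
      then have "cls g ((G, P), a) = c" using gen_rel_cls x by simp
      then show "c \<in> U" using a(1) by auto
    qed
    then show "openin (subtopology (Ttop g) (strat g G P)) U"
      using op unfolding openin_subtopology by blast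
  next
    assume "openin (subtopology (Ttop g) (strat g G P)) U"
    then obtain W where W: "openin (Ttop g) W" "U = W \<inter> strat g G P" unfolding openin_subtopology by auto
    then have "openin (top_of_set (cone G)) {x. cls g ((G, P), x) \<in> W}" using o openin_Ttop_iff by blast
    then obtain T where T: "open T" "{x. cls g ((G, P), x) \<in> W} = cone G \<inter> T" unfolding openin_open by auto
    have "?A = cone_int G \<inter> {x. cls g ((G, P), x) \<in> W}" unfolding W(2) by (auto simp: strat_def)
    also have "\<dots> = cone_int G \<inter> T" unfolding T(2) using cone_int_subset[of G] by auto
    finally show "openin (top_of_set (cone_int G)) ?A" using T(1) by auto
  qed
qed

lemma cls_strat_interior_iff:
  assumes o: "(G, P) \<in> Obj g" and x: "x \<in> cone_int G" "y \<in> cone_int G"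
  shows "cls g ((G, P), x) = cls g ((G, P), y) \<longleftrightarrow> (\<exists>\<phi> \<psi>. contr G P G P {} \<phi> \<psi> \<and> y = iota G {} \<psi> x)"
  using ceq_interior_iff[OF o o x(2) x(1)] cls_eq_iff by metis

lemma cone_int_nonempty: "(\<lambda>e. if e \<in> E G then 1 else 0) \<in> cone_int G"
  by (auto simp: cone_int_def)

text \<open>One point of the smaller stratum in the closure is enough: its star is an open
  neighbourhood, and any point of the other stratum inside it exhibits a contraction. Conversely a
  face point is a limit of interior points of the larger cone.\<close>

lemma strat_closure_iff:
  assumes o: "(G, P) \<in> Obj g" "(G', P') \<in> Obj g"
  shows "strat g G' P' \<subseteq> Ttop g closure_of strat g G P \<longleftrightarrow> pair_ge (G, P) (G', P')"
proof
  assume L: "strat g G' P' \<subseteq> Ttop g closure_of strat g G P"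
  define x' :: "nat \<Rightarrow> real" where "x' = (\<lambda>e. if e \<in> E G' then 1 else 0)"
  have x': "x' \<in> cone_int G'" unfolding x'_def by (rule cone_int_nonempty)
  let ?W = "cls g ` star g G' P' (cone_int G')"
  have "openin (Ttop g) ?W" by (rule openin_star[OF open_UNIV _ ObjD(6)[OF o(2)]]) simp
  moreover have "cls g ((G', P'), x') \<in> ?W"
  proof -
    have "((G', P'), x') \<in> star g G' P' (cone_int G')"
      unfolding in_star_iff using o x' contr_refl[of G' P'] cone_int_subset[of G']
      by (intro conjI exI[of _ "{}"] exI[of _ id] bexI[of _ x']) auto
    then show ?thesis by blast
  qed
  moreover have "cls g ((G', P'), x') \<in> Ttop g closure_of strat g G P"
    using L x' unfolding strat_def by blast
  ultimately obtain c where "c \<in> strat g G P" "c \<in> ?W" unfolding in_closure_of by blast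
  then obtain x where "cls g ((G, P), x) \<in> ?W" unfolding strat_def by auto
  then have "((G, P), x) \<in> star g G' P' (cone_int G')" using cls_in_star_iff by blast
  then show "pair_ge (G, P) (G', P')" unfolding in_star_iff pair_ge_def by auto
next
  assume "pair_ge (G, P) (G', P')"
  then obtain S \<phi> \<psi> where c: "contr G P G' P' S \<phi> \<psi>" unfolding pair_ge_def by auto
  show "strat g G' P' \<subseteq> Ttop g closure_of strat g G P"
  proof
    fix c assume "c \<in> strat g G' P'"
    then obtain x' where x': "x' \<in> cone_int G'" "c = cls g ((G', P'), x')" unfolding strat_def by auto
    define x where "x = iota G S \<psi> x'"
    have xc: "x \<in> cone G" unfolding x_def using x' cone_int_subset iota_in_cone by blast
    have "(((G', P'), x'), ((G, P), x)) \<in> gen_rel g"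
      unfolding gen_rel_iff x_def using o c x'(1) cone_int_subset[of G'] by blast
    then have cx: "c = cls g ((G, P), x)" using gen_rel_cls x'(2) by simp
    show "c \<in> Ttop g closure_of strat g G P"
      unfolding in_closure_of topspace_Ttop
    proof (intro conjI allI impI)
      show "c \<in> Tg g" unfolding cx cls_in_Tg_iff in_topspace_sumtop_iff using o xc by simp
      fix W assume W: "c \<in> W \<and> openin (Ttop g) W"
      then have "openin (top_of_set (cone G)) {x. cls g ((G, P), x) \<in> W}" using o openin_Ttop_iff by blast
      then obtain T where T: "open T" "{x. cls g ((G, P), x) \<in> W} = cone G \<inter> T" unfolding openin_open by auto
      \<comment> \<open>Adding a small \<open>t\<close> to every edge length moves the face point
        into the open cone.\<close>
      define h :: "real \<Rightarrow> nat \<Rightarrow> real" where "h = (\<lambda>t e. x e + (if e \<in> E G then t else 0))"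
      have "continuous_on UNIV h"
      proof (rule continuous_on_coordinatewise_then_product)
        show "continuous_on UNIV (\<lambda>t. h t i)" for i
          by (cases "i \<in> E G") (auto simp: h_def intro!: continuous_intros)
      qed
      then have "open (h -` T)" by (rule open_vimage[OF T(1)])
      moreover have "h 0 = x" by (auto simp: h_def)
      then have "0 \<in> h -` T" using T(2) W cx by auto
      ultimately obtain d where d: "d > 0" "ball 0 d \<subseteq> h -` T" using open_contains_ball by blast
      then have "h (d / 2) \<in> T" by (auto simp: subset_eq)
      moreover have hi: "h (d / 2) \<in> cone_int G"
        using xc d(1) unfolding h_def cone_int_def cone_def by (auto intro: add_nonneg_pos)
      ultimately have "cls g ((G, P), h (d / 2)) \<in> W" using T(2) cone_int_subset[of G] by blast
      then show "\<exists>y. y \<in> strat g G P \<and> y \<in> W" using hi unfolding strat_def by blast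
    qed
  qed
qed

section \<open>Connectedness\<close>

definition point_graph :: "nat \<Rightarrow> sgraph" where
  "point_graph g = \<lparr>V = {0}, E = {}, ends = \<lambda>_. (0, 0), wt = \<lambda>_. g\<rparr>"

text \<open>Without edges stability reads \<open>2 * g - 2 > 0\<close>; this is where
  \<open>g \<ge> 2\<close> enters.\<close>

lemma point_graph_Obj: "g \<ge> 2 \<Longrightarrow> (point_graph g, {}) \<in> Obj g"
  by (auto simp: Obj_def point_graph_def stable_graph_def genus_def cyc_def deg_def degP_def)

text \<open>With a single fibre the connectivity condition is connectedness of \<open>G\<close> and
  the weight condition is the genus formula.\<close>

lemma contr_point_graph:
  assumes o: "(G, P) \<in> Obj g"
  shows "contr G P (point_graph g) {} (E G) (\<lambda>_. 0) id"
  unfolding contr_iff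
proof (intro conjI ballI impI)
  show "(\<lambda>_. 0) ` V G = V (point_graph g)"
    using ObjD(3)[OF o] by (auto simp: stable_graph_def point_graph_def)
  show "(u, v) \<in> (adj G (E G))\<^sup>*" if "u \<in> V G" "v \<in> V G" for u v
    using ObjD(3)[OF o] that by (auto simp: stable_graph_def)
  show "int (wt (point_graph g) v') - 1 = (\<Sum>v | v \<in> V G \<and> 0 = v'. int (wt G v) - 1) +
       int (card {e \<in> E G. 0 = v'})" if "v' \<in> V (point_graph g)" for v'
    using that ObjD(4)[OF o] unfolding genus_alt by (auto simp: point_graph_def)
  show "{} = id ` (P - E G)" using ObjD(2)[OF o] by auto
qed (auto simp: point_graph_def)

lemma connected_Ttop:
  assumes "g \<ge> 2"
  shows "connected_space (Ttop g)"
proof -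
  define c0 where "c0 = cls g ((point_graph g, {}), \<lambda>_. 0)"
  have seg: "\<exists>C. connectedin (Ttop g) C \<and> c0 \<in> C \<and> c \<in> C" if c: "c \<in> Tg g" for c
  proof -
    obtain a where a: "c = cls g a" "a \<in> topspace (sumtop g)" using c unfolding Tg_eq_image by auto
    obtain G P x where "a = ((G, P), x)" by (metis surj_pair)
    then have o: "(G, P) \<in> Obj g" and x: "x \<in> cone G" "c = cls g ((G, P), x)"
      using a by (auto simp: in_topspace_sumtop_iff)
    \<comment> \<open>The ray from the apex to \<open>x\<close>. At \<open>t = 0\<close> it is the
      image of the only point of the cone of the one-vertex graph, so all such segments share
      \<open>c0\<close>.\<close>
    define h :: "real \<Rightarrow> nat \<Rightarrow> real" where "h = (\<lambda>t e. t * x e)"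
    have hc: "h t \<in> cone G" if "0 \<le> t" for t using that x(1) by (auto simp: h_def cone_def)
    have h: "continuous_on UNIV h"
      by (rule continuous_on_coordinatewise_then_product) (auto simp: h_def intro!: continuous_intros)
    have "continuous_map (top_of_set {0..1}) (Ttop g) (\<lambda>t. cls g ((G, P), h t))"
      unfolding continuous_map_def
    proof (intro conjI allI impI)
      show "(\<lambda>t. cls g ((G, P), h t)) \<in> topspace (top_of_set {0..1}) \<rightarrow> topspace (Ttop g)"
        using hc o by (auto simp: topspace_Ttop cls_in_Tg_iff in_topspace_sumtop_iff)
      fix W assume "openin (Ttop g) W"
      then have "openin (top_of_set (cone G)) {x. cls g ((G, P), x) \<in> W}" using o openin_Ttop_iff by blast
      then obtain T where T: "open T" "{x. cls g ((G, P), x) \<in> W} = cone G \<inter> T" unfolding openin_open by auto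
      have "{t \<in> topspace (top_of_set {0..1}). cls g ((G, P), h t) \<in> W} = {0..1} \<inter> h -` T"
        using hc T(2) by auto
      then show "openin (top_of_set {0..1}) {t \<in> topspace (top_of_set {0..1}). cls g ((G, P), h t) \<in> W}"
        using open_vimage[OF T(1) h] by auto
    qed
    moreover have "connectedin (top_of_set {0..1::real}) {0..1}"
      by (simp add: connectedin_subtopology)
    ultimately have "connectedin (Ttop g) ((\<lambda>t. cls g ((G, P), h t)) ` {0..1})"
      by (rule connectedin_continuous_map_image)
    moreover have "h 1 = x" by (simp add: h_def)
    then have "c \<in> (\<lambda>t. cls g ((G, P), h t)) ` {0..1}" using x(2) by (intro image_eqI[of _ _ 1]) auto
    moreover have "(((point_graph g, {}), \<lambda>_. 0), ((G, P), h 0)) \<in> gen_rel g"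
      unfolding gen_rel_iff using o point_graph_Obj[OF assms] contr_point_graph[OF o]
      by (intro conjI exI[of _ "E G"] exI[of _ "\<lambda>_. 0"] exI[of _ id]) (auto simp: cone_def h_def iota_def)
    then have "c0 = cls g ((G, P), h 0)" unfolding c0_def by (rule gen_rel_cls)
    then have "c0 \<in> (\<lambda>t. cls g ((G, P), h t)) ` {0..1}" by (intro image_eqI[of _ _ 0]) auto
    ultimately show ?thesis by blast
  qed
  let ?K = "{C. connectedin (Ttop g) C \<and> c0 \<in> C}"
  have "connectedin (Ttop g) (\<Union>?K)" by (rule connectedin_Union) auto
  moreover have "\<Union>?K = topspace (Ttop g)"
  proof
    show "\<Union>?K \<subseteq> topspace (Ttop g)" using connectedin_subset_topspace by blast
    show "topspace (Ttop g) \<subseteq> \<Union>?K" unfolding topspace_Ttop using seg by blast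
  qed
  ultimately show ?thesis using connectedin_topspace by metis
qed

section \<open>Dimension\<close>

lemma sum_deg:
  assumes "wf_graph G" shows "(\<Sum>v \<in> V G. deg G v) = 2 * card (E G)"
  using degP_sum_vertices[OF assms order_refl, of "\<lambda>_. True"] by (simp add: deg_def)

text \<open>The degree of the canonical divisor.\<close>

lemma sum_canonical:
  assumes o: "(G, P) \<in> Obj g"
  shows "(\<Sum>v \<in> V G. 2 * int (wt G v) - 2 + int (deg G v)) = 2 * int g - 2"
proof -
  have "(\<Sum>v \<in> V G. 2 * int (wt G v) - 2 + int (deg G v))
    = 2 * (\<Sum>v \<in> V G. int (wt G v) - 1) + (\<Sum>v \<in> V G. int (deg G v))"
    unfolding sum_distrib_left sum.distrib[symmetric] by (intro sum.cong) auto
  also have "(\<Sum>v \<in> V G. int (deg G v)) = 2 * int (card (E G))"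
    using sum_deg[OF ObjD(1)[OF o]] unfolding of_nat_sum[symmetric] by simp
  finally show ?thesis using ObjD(4)[OF o] unfolding genus_alt by simp
qed

text \<open>By stability every summand of the canonical degree is at least one, so there are at most
  2 g - 2 vertices; since weights are nonnegative, the genus formula gives at most g - 1 more edges
  than vertices.\<close>

lemma card_E_le:
  assumes o: "(G, P) \<in> Obj g"
  shows "card (E G) \<le> 3 * g - 3"
proof -
  have "(\<Sum>v \<in> V G. (1::int)) \<le> (\<Sum>v \<in> V G. 2 * int (wt G v) - 2 + int (deg G v))"
    using ObjD(3)[OF o] unfolding stable_graph_def by (intro sum_mono) force
  moreover have "(\<Sum>v \<in> V G. int (wt G v)) \<ge> 0" by (intro sum_nonneg) simp
  ultimately have "int (card (E G)) \<le> 3 * int g - 3"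
    using sum_canonical[OF o] ObjD(4)[OF o] unfolding genus_def by simp
  then show ?thesis by linarith
qed

text \<open>A converse to \<open>contr_Obj\<close>: connectedness lifts along paths and the genus is
  preserved, whereas stability and evenness do not lift in general and have to be supplied.\<close>

lemma Obj_expand:
  assumes c: "contr G1 P1 G P S \<phi> \<psi>" and wf: "wf_graph G1" and o: "(G, P) \<in> Obj g"
    and pos: "\<And>v. v \<in> V G1 \<Longrightarrow> 2 * int (wt G1 v) - 2 + int (deg G1 v) > 0" and cyc: "cyc G1 P1"
  shows "(G1, P1) \<in> Obj g"
proof -
  note d = contrD[OF c]
  have finS: "finite S" "finite (E G1)" using d(1) wf finite_subset unfolding wf_graph_def by auto
  have "V G1 \<noteq> {}" using ObjD(3)[OF o] d(2) unfolding stable_graph_def by auto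
  moreover have "(u, v) \<in> (adj G1 (E G1))\<^sup>*" if uv: "u \<in> V G1" "v \<in> V G1" for u v
  proof -
    have "\<phi> u \<in> V G" "\<phi> v \<in> V G" using d(2) uv by blast+
    then have "(\<phi> u, \<phi> v) \<in> (adj G (E G))\<^sup>*"
      using ObjD(3)[OF o] unfolding stable_graph_def by auto
    from contr_path_lift[OF c wf d(1) _ order_refl this uv(1) refl] uv(2) show ?thesis by auto
  qed
  ultimately have "stable_graph G1" using wf pos unfolding stable_graph_def wf_graph_def by auto
  moreover have "genus G1 = int g"
  proof -
    have "card (E G) = card (E G1) - card S" "card S \<le> card (E G1)"
      using bij_betw_same_card[OF d(3)] card_Diff_subset[OF finS(1) d(1)] card_mono[OF finS(2) d(1)] by auto
    moreover have "{v \<in> V G1. \<phi> v \<in> V G} = V G1" "{e \<in> S. \<phi> (fst (ends G1 e)) \<in> V G} = S"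
      using d(1,2) wf unfolding wf_graph_def by auto
    ultimately show ?thesis
      using contr_weight_sum[OF c wf order_refl] ObjD(4)[OF o] unfolding genus_alt by auto
  qed
  ultimately show ?thesis using cyc unfolding Obj_def by simp
qed

text \<open>The loop raises the degree by two while the lost unit of weight lowers 2 w by two, so
  the stability term is unchanged. Keeping the loop outside \<open>P\<close> leaves all degrees in
  \<open>P\<close> as they were.\<close>

lemma expand_weight:
  assumes o: "(G, P) \<in> Obj g" and v: "v \<in> V G" "wt G v \<ge> 1"
  shows "\<exists>G1 P1 S \<phi> \<psi>. (G1, P1) \<in> Obj g \<and> card (E G1) = Suc (card (E G)) \<and> contr G1 P1 G P S \<phi> \<psi>"
proof -
  note oD = ObjD[OF o]
  obtain n where n: "n \<notin> E G" using ex_new_if_finite[OF infinite_UNIV_nat oD(6)] by auto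
  define G1 where "G1 = \<lparr>V = V G, E = insert n (E G), ends = (ends G)(n := (v, v)),
     wt = (wt G)(v := wt G v - 1)\<rparr>"
  have nP: "n \<notin> P" using n oD(2) by auto
  have wf: "wf_graph G1" using oD(1) v unfolding wf_graph_def G1_def by auto
  have dQ: "degP G1 Q u = degP G Q u" if "Q \<subseteq> E G" for Q u
  proof -
    have "ends G1 e = ends G e" if "e \<in> Q" for e using that \<open>Q \<subseteq> E G\<close> n by (auto simp: G1_def)
    then show ?thesis unfolding degP_def by (simp cong: conj_cong)
  qed
  have dE: "deg G1 u = deg G u + (if u = v then 2 else 0)" for u
  proof -
    have "degP G1 (insert n (E G)) u = (if u = v then 2 else 0) + degP G1 (E G) u"
      using oD(6) n by (simp add: degP_sum) (simp add: G1_def)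
    moreover have "E G1 = insert n (E G)" by (simp add: G1_def)
    ultimately show ?thesis using dQ[OF order_refl, of u] unfolding deg_def by simp
  qed
  have c: "contr G1 P G P {n} id id"
    unfolding contr_iff
  proof (intro conjI ballI impI)
    show "int (wt G w) - 1 = (\<Sum>u | u \<in> V G1 \<and> id u = w. int (wt G1 u) - 1) +
       int (card {e \<in> {n}. id (fst (ends G1 e)) = w})" if "w \<in> V G" for w
    proof -
      have "{u. u \<in> V G1 \<and> id u = w} = {w}" using that by (auto simp: G1_def)
      moreover have "{e \<in> {n}. id (fst (ends G1 e)) = w} = (if w = v then {n} else {})"
        by (auto simp: G1_def)
      ultimately show ?thesis using v(2) by (auto simp: G1_def of_nat_diff)
    qed
    show "P = id ` (P - {n})" using nP by auto
    show "bij_betw id (E G1 - {n}) (E G)" using n by (simp add: G1_def bij_betw_def)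
  qed (auto simp: G1_def)
  have "(G1, P) \<in> Obj g"
  proof (rule Obj_expand[OF c wf o])
    show "2 * int (wt G1 u) - 2 + int (deg G1 u) > 0" if "u \<in> V G1" for u
    proof -
      have "2 * int (wt G u) - 2 + int (deg G u) > 0"
        using that oD(3) unfolding stable_graph_def by (auto simp: G1_def)
      then show ?thesis unfolding dE using v(2) by (auto simp: G1_def of_nat_diff)
    qed
    show "cyc G1 P" using oD(5) dQ[OF oD(2)] unfolding cyc_def by (auto simp: G1_def)
  qed
  moreover have "card (E G1) = Suc (card (E G))" using n oD(6) by (simp add: G1_def)
  ultimately show ?thesis using c by blast
qed

lemma card_split_filter:
  assumes "finite Q" "A \<subseteq> {e. f e = v}"
  shows "card {e \<in> Q. f e = v} = card {e \<in> Q. f e = v \<and> e \<notin> A} + card (A \<inter> Q)"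
proof -
  have "{e \<in> Q. f e = v} = {e \<in> Q. f e = v \<and> e \<notin> A} \<union> (A \<inter> Q)" using assms(2) by auto
  then show ?thesis using assms(1) by (subst card_Un_disjoint[symmetric]) auto
qed

text \<open>Two half-edges at \<open>v\<close> move to a new vertex \<open>m\<close> of weight zero,
  joined to \<open>v\<close> by a new edge \<open>n\<close>. Then \<open>m\<close> has valence three
  and \<open>v\<close> has valence \<open>deg G v - 1\<close>, which is at least three.\<close>

lemma expand_degree:
  assumes o: "(G, P) \<in> Obj g" and v: "v \<in> V G" "wt G v = 0" "deg G v \<ge> 4"
  shows "\<exists>G1 P1 S \<phi> \<psi>. (G1, P1) \<in> Obj g \<and> card (E G1) = Suc (card (E G)) \<and> contr G1 P1 G P S \<phi> \<psi>"
proof -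
  note oD = ObjD[OF o]
  obtain n where n: "n \<notin> E G" using ex_new_if_finite[OF infinite_UNIV_nat oD(6)] by auto
  obtain m where m: "m \<notin> V G" using ex_new_if_finite[OF infinite_UNIV_nat oD(7)] by auto
  have mv: "m \<noteq> v" using m v by auto
  \<comment> \<open>The half-edges to be moved: \<open>A\<close> lists first ends, \<open>B\<close>
    second ends. Valence at least four gives two of one kind, so the other set can be taken
    empty.\<close>
  obtain A B where A: "A \<subseteq> {e \<in> E G. fst (ends G e) = v}" and B: "B \<subseteq> {e \<in> E G. snd (ends G e) = v}"
    and AB: "card A + card B = 2"
  proof (cases "card {e \<in> E G. fst (ends G e) = v} \<ge> 2")
    case True
    obtain A where "A \<subseteq> {e \<in> E G. fst (ends G e) = v}" "card A = 2" "finite A"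
      by (rule obtain_subset_with_card_n[OF True])
    then show ?thesis using that[of A "{}"] by simp
  next
    case False
    then have "card {e \<in> E G. snd (ends G e) = v} \<ge> 2" using v(3) unfolding deg_def degP_def by simp
    then obtain B where "B \<subseteq> {e \<in> E G. snd (ends G e) = v}" "card B = 2" "finite B"
      by (rule obtain_subset_with_card_n)
    then show ?thesis using that[of "{}" B] by simp
  qed
  define G1 where "G1 = \<lparr>V = insert m (V G), E = insert n (E G),
     ends = \<lambda>e. if e = n then (v, m) else
        (if e \<in> A then m else fst (ends G e), if e \<in> B then m else snd (ends G e)),
     wt = (wt G)(m := 0)\<rparr>"
  define \<phi> where "\<phi> = (\<lambda>u. if u = m then v else u)"
  \<comment> \<open>If an odd number of half-edges of \<open>P\<close> moves to \<open>m\<close>,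
    the degrees in \<open>P\<close> of both \<open>v\<close> and \<open>m\<close> become odd, and
    adding \<open>n\<close> corrects both.\<close>
  define P1 where "P1 = (if odd (card (A \<inter> P) + card (B \<inter> P)) then insert n P else P)"
  have nP: "n \<notin> P" using n oD(2) by auto
  have EV: "fst (ends G e) \<in> V G" "snd (ends G e) \<in> V G" if "e \<in> E G" for e
    using that oD(1) unfolding wf_graph_def by auto
  then have Em: "fst (ends G e) \<noteq> m" "snd (ends G e) \<noteq> m" if "e \<in> E G" for e
    using that m by metis+
  have ends1: "ends G1 e = (if e \<in> A then m else fst (ends G e), if e \<in> B then m else snd (ends G e))"
    if "e \<in> E G" for e using that n by (auto simp: G1_def)
  have endsn: "ends G1 n = (v, m)" by (simp add: G1_def)
  have wf: "wf_graph G1"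
    using oD(6,7) EV v(1) unfolding wf_graph_def by (auto simp: G1_def)
  have end_m: "fst (ends G1 e) = m \<longleftrightarrow> e \<in> A" "snd (ends G1 e) = m \<longleftrightarrow> e \<in> B" if "e \<in> E G" for e
    using ends1[OF that] Em[OF that] by simp_all
  have end_v: "fst (ends G1 e) = v \<longleftrightarrow> fst (ends G e) = v \<and> e \<notin> A"
    "snd (ends G1 e) = v \<longleftrightarrow> snd (ends G e) = v \<and> e \<notin> B" if "e \<in> E G" for e
    using ends1[OF that] mv by simp_all
  have end_u: "fst (ends G1 e) = u \<longleftrightarrow> fst (ends G e) = u"
    "snd (ends G1 e) = u \<longleftrightarrow> snd (ends G e) = u" if "e \<in> E G" "u \<noteq> v" "u \<noteq> m" for e u
    using ends1[OF that(1)] that A B by auto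
  have dm: "degP G1 Q m = card (A \<inter> Q) + card (B \<inter> Q)" if Q: "Q \<subseteq> E G" for Q
  proof -
    have "{e \<in> Q. fst (ends G1 e) = m} = A \<inter> Q" "{e \<in> Q. snd (ends G1 e) = m} = B \<inter> Q"
      using end_m Q by blast+
    then show ?thesis by (simp add: degP_def)
  qed
  have dv: "degP G1 Q v + degP G1 Q m = degP G Q v" if Q: "Q \<subseteq> E G" for Q
  proof -
    have fin: "finite Q" using Q oD(6) finite_subset by auto
    have "{e \<in> Q. fst (ends G1 e) = v} = {e \<in> Q. fst (ends G e) = v \<and> e \<notin> A}"
      "{e \<in> Q. snd (ends G1 e) = v} = {e \<in> Q. snd (ends G e) = v \<and> e \<notin> B}"
      using end_v Q by blast+
    moreover have "card {e \<in> Q. fst (ends G e) = v} = card {e \<in> Q. fst (ends G e) = v \<and> e \<notin> A} + card (A \<inter> Q)"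
      "card {e \<in> Q. snd (ends G e) = v} = card {e \<in> Q. snd (ends G e) = v \<and> e \<notin> B} + card (B \<inter> Q)"
      by (rule card_split_filter; use fin A B in auto)+
    ultimately show ?thesis unfolding dm[OF Q] by (simp add: degP_def)
  qed
  have du: "degP G1 Q u = degP G Q u" if Q: "Q \<subseteq> E G" and u: "u \<noteq> v" "u \<noteq> m" for Q u
  proof -
    have "{e \<in> Q. fst (ends G1 e) = u} = {e \<in> Q. fst (ends G e) = u}"
      "{e \<in> Q. snd (ends G1 e) = u} = {e \<in> Q. snd (ends G e) = u}"
      using end_u[OF _ u] Q by blast+
    then show ?thesis by (simp add: degP_def)
  qed
  have dn: "degP G1 (insert n Q) u = degP G1 Q u + of_bool (u = v) + of_bool (u = m)" if Q: "Q \<subseteq> E G" for Q u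
  proof -
    have "finite Q" "n \<notin> Q" using Q oD(6) n finite_subset by auto
    then show ?thesis by (auto simp: degP_sum endsn)
  qed
  have c: "contr G1 P1 G P {n} \<phi> id"
    unfolding contr_iff
  proof (intro conjI ballI impI)
    show "\<phi> ` V G1 = V G" using v(1) m by (auto simp: G1_def \<phi>_def image_iff)
    show "bij_betw id (E G1 - {n}) (E G)" using n by (simp add: G1_def bij_betw_def)
    show "\<phi> (fst (ends G1 e)) = \<phi> (snd (ends G1 e))" if "e \<in> {n}" for e
      using that by (simp add: endsn \<phi>_def)
    show "ends G (id e) = (\<phi> (fst (ends G1 e)), \<phi> (snd (ends G1 e))) \<or>
       ends G (id e) = (\<phi> (snd (ends G1 e)), \<phi> (fst (ends G1 e)))" if e: "e \<in> E G1 - {n}" for e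
    proof -
      have e: "e \<in> E G" using e by (auto simp: G1_def)
      have "\<phi> (fst (ends G1 e)) = fst (ends G e)" "\<phi> (snd (ends G1 e)) = snd (ends G e)"
        using ends1[OF e] Em[OF e] A B by (auto simp: \<phi>_def)
      then show ?thesis by simp
    qed
    show "(a, b) \<in> (adj G1 {n})\<^sup>*" if "a \<in> V G1" "b \<in> V G1" "\<phi> a = \<phi> b" for a b
    proof -
      have "(v, m) \<in> adj G1 {n}" "(m, v) \<in> adj G1 {n}"
        using adj_edge[of n "{n}" G1] adj_sym by (auto simp: endsn)
      then show ?thesis using that by (auto simp: \<phi>_def split: if_splits)
    qed
    show "int (wt G w) - 1 = (\<Sum>u | u \<in> V G1 \<and> \<phi> u = w. int (wt G1 u) - 1) +
       int (card {e \<in> {n}. \<phi> (fst (ends G1 e)) = w})" if w: "w \<in> V G" for w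
    proof (cases "w = v")
      case True
      have "{u. u \<in> V G1 \<and> \<phi> u = w} = {v, m}" "{e \<in> {n}. \<phi> (fst (ends G1 e)) = w} = {n}"
        using True v m by (auto simp: G1_def \<phi>_def)
      then show ?thesis using True v mv by (simp add: G1_def)
    next
      case False
      have "{u. u \<in> V G1 \<and> \<phi> u = w} = {w}" "{e \<in> {n}. \<phi> (fst (ends G1 e)) = w} = {}"
        using False w m mv by (auto simp: G1_def \<phi>_def)
      then show ?thesis using w m by (auto simp: G1_def)
    qed
    show "P = id ` (P1 - {n})" using nP by (auto simp: P1_def)
  qed (simp add: G1_def)
  have E1: "E G1 = insert n (E G)" "V G1 = insert m (V G)" by (simp_all add: G1_def)
  have AE: "A \<inter> E G = A" "B \<inter> E G = B" using A B by auto
  have "(G1, P1) \<in> Obj g"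
  proof (rule Obj_expand[OF c wf o])
    fix u assume u: "u \<in> V G1"
    have d1: "deg G1 u = degP G1 (E G) u + of_bool (u = v) + of_bool (u = m)"
      unfolding deg_def E1 by (rule dn) simp
    consider "u = m" | "u = v" | "u \<in> V G" "u \<noteq> v" "u \<noteq> m" using u E1 m by auto
    then show "2 * int (wt G1 u) - 2 + int (deg G1 u) > 0"
    proof cases
      case 1
      then show ?thesis using d1 dm[OF order_refl] AB mv unfolding AE by simp
    next
      case 2
      have "degP G1 (E G) v + 2 = deg G v" using dv[OF order_refl] dm[OF order_refl] AB
        unfolding AE deg_def by simp
      then show ?thesis using 2 d1 v(3) mv by simp
    next
      case 3
      have "2 * int (wt G u) - 2 + int (deg G u) > 0"
        using 3 oD(3) unfolding stable_graph_def by blast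
      then show ?thesis using 3 d1 du[OF order_refl] by (simp add: G1_def deg_def)
    qed
  next
    show "cyc G1 P1" unfolding cyc_def
    proof (intro conjI ballI)
      show "P1 \<subseteq> E G1" using oD(2) by (auto simp: P1_def E1)
      fix u assume u: "u \<in> V G1"
      have ev: "even (degP G P u)" if "u \<in> V G" using that oD(5) unfolding cyc_def by blast
      have d1: "degP G1 P1 u = degP G1 P u + (if odd (degP G1 P m) then of_bool (u = v) + of_bool (u = m) else 0)"
        using dn[OF oD(2), of u] by (simp add: P1_def dm[OF oD(2)])
      consider "u = m" | "u = v" | "u \<in> V G" "u \<noteq> v" "u \<noteq> m" using u E1 m by auto
      then show "even (degP G1 P1 u)"
      proof cases
        case 1
        then show ?thesis unfolding d1 using mv by auto
      next
        case 2
        then have "even (degP G1 P v + degP G1 P m)" using dv[OF oD(2)] ev v(1) by simp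
        then show ?thesis unfolding d1 using 2 mv by auto
      next
        case 3
        then show ?thesis unfolding d1 using du[OF oD(2)] ev by auto
      qed
    qed
  qed
  moreover have "card (E G1) = Suc (card (E G))" using n oD(6) by (simp add: E1)
  ultimately show ?thesis using c by blast
qed

lemma expand_one:
  assumes o: "(G, P) \<in> Obj g" and l: "card (E G) < 3 * g - 3"
  shows "\<exists>G1 P1 S \<phi> \<psi>. (G1, P1) \<in> Obj g \<and> card (E G1) = Suc (card (E G)) \<and> contr G1 P1 G P S \<phi> \<psi>"
proof (cases "\<exists>v \<in> V G. wt G v \<ge> 1")
  case True
  then show ?thesis using expand_weight[OF o] by blast
next
  case False
  then have w0: "wt G v = 0" if "v \<in> V G" for v using that by force
  \<comment> \<open>With zero weights and valences at most three every stability term is at most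
    one. Then there are at least 2 g - 2 vertices, so at least 3 g - 3 edges, against the
    assumption.\<close>
  have "\<exists>v \<in> V G. deg G v \<ge> 4"
  proof (rule ccontr)
    assume "\<not> ?thesis"
    then have "(\<Sum>v \<in> V G. 2 * int (wt G v) - 2 + int (deg G v)) \<le> (\<Sum>v \<in> V G. 1)"
      using w0 by (intro sum_mono) force
    moreover have "(\<Sum>v \<in> V G. int (wt G v)) = 0" using w0 by simp
    ultimately show False using sum_canonical[OF o] ObjD(4)[OF o] l unfolding genus_def by simp
  qed
  then show ?thesis using expand_degree[OF o] w0 by blast
qed

lemma exists_top_dimensional:
  assumes "(G, P) \<in> Obj g"
  shows "\<exists>(G', P') \<in> Obj g. card (E G') = 3 * g - 3 \<and> pair_ge (G', P') (G, P)"
  using assms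
proof (induction "3 * g - 3 - card (E G)" arbitrary: G P)
  case 0
  then have "card (E G) = 3 * g - 3" using card_E_le[OF 0(2)] by simp
  then show ?case using 0(2) contr_refl[of G P] by (intro bexI[of _ "(G, P)"]) (auto simp: pair_ge_def)
next
  case (Suc k)
  then have "card (E G) < 3 * g - 3" by linarith
  then obtain G1 P1 S \<phi> \<psi> where 1: "(G1, P1) \<in> Obj g" "card (E G1) = Suc (card (E G))" "contr G1 P1 G P S \<phi> \<psi>"
    using expand_one[OF Suc(3)] by blast
  have "k = 3 * g - 3 - card (E G1)" using Suc(2) 1(2) by simp
  from Suc(1)[OF this 1(1)] obtain G' P' where 2: "(G', P') \<in> Obj g" "card (E G') = 3 * g - 3" "pair_ge (G', P') (G1, P1)"
    by auto
  then have "pair_ge (G', P') (G, P)"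
    using contr_comp[OF _ 1(3) ObjD(1,2)[OF 2(1)]] unfolding pair_ge_def by force
  then show ?case using 2 by auto
qed

section \<open>Piecewise linear functions\<close>

text \<open>The slope as a germ condition: equality near \<open>s\<close> instead of a limit of
  difference quotients, so that linear combinations and reflections are immediate. Like
  \<open>lslope\<close>, \<open>lsl\<close> measures the outgoing slope, so an affine piece of slope
  \<open>m\<close> has left slope \<open>- m\<close>.\<close>

definition rsl :: "(real \<Rightarrow> real) \<Rightarrow> real \<Rightarrow> real \<Rightarrow> bool" where
  "rsl h s m \<longleftrightarrow> eventually (\<lambda>u. h (s + u) = h s + m * u) (at_right 0)"

definition lsl :: "(real \<Rightarrow> real) \<Rightarrow> real \<Rightarrow> real \<Rightarrow> bool" where
  "lsl h s m \<longleftrightarrow> eventually (\<lambda>u. h (s - u) = h s + m * u) (at_right 0)"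

lemma rslope_eq:
  assumes "rsl h s m" shows "rslope h s = m"
proof -
  have "eventually (\<lambda>u::real. u > 0) (at_right 0)" by (simp add: eventually_at_right_less)
  with assms have "eventually (\<lambda>u. (h (s + u) - h s) / u = m) (at_right 0)"
    unfolding rsl_def by eventually_elim simp
  then have "((\<lambda>u. (h (s + u) - h s) / u) \<longlongrightarrow> m) (at_right 0)" by (rule tendsto_eventually)
  then show ?thesis unfolding rslope_def by (intro tendsto_Lim) simp_all
qed

text \<open>Reversing the direction of an edge exchanges the two outgoing slopes. Statements about
  left slopes follow from this, as does invariance under isomorphisms that flip edges.\<close>

lemma rsl_reflect: "rsl (\<lambda>t. h (L - t)) s m \<longleftrightarrow> lsl h (L - s) m"
  unfolding rsl_def lsl_def by (simp add: algebra_simps)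

lemma lsl_reflect: "lsl (\<lambda>t. h (L - t)) s m \<longleftrightarrow> rsl h (L - s) m"
  unfolding rsl_def lsl_def by (simp add: algebra_simps)

lemma rslope_reflect: "rslope (\<lambda>t. h (L - t)) s = lslope h (L - s)"
  unfolding rslope_def lslope_def by (simp add: algebra_simps)

lemma lslope_reflect: "lslope (\<lambda>t. h (L - t)) s = rslope h (L - s)"
  unfolding rslope_def lslope_def by (simp add: algebra_simps)

lemma lslope_eq:
  assumes "lsl h s m" shows "lslope h s = m"
  using rslope_eq[of "\<lambda>t. h (- t)" "- s" m] assms rslope_reflect[of h 0 "- s"] rsl_reflect[of h 0 "- s"]
  by simp

lemma rsl_linear:
  assumes "rsl h s m" "rsl h' s m'" shows "rsl (\<lambda>t. a * h t + b * h' t) s (a * m + b * m')"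
  using assms unfolding rsl_def by eventually_elim (simp add: algebra_simps)

lemma lsl_linear:
  assumes "lsl h s m" "lsl h' s m'" shows "lsl (\<lambda>t. a * h t + b * h' t) s (a * m + b * m')"
  using assms unfolding lsl_def by eventually_elim (simp add: algebra_simps)

lemma rsl_affine:
  assumes "a < b" "\<And>s. s \<in> {a..b} \<Longrightarrow> h s = m * s + c" "a \<le> s" "s < b"
  shows "rsl h s m"
proof -
  have "eventually (\<lambda>u. u \<in> {0<..<b - s}) (at_right 0)"
    using assms by (intro eventually_at_right_real) simp
  then show ?thesis unfolding rsl_def
  proof eventually_elim
    case (elim u)
    then show ?case using assms(2)[of "s + u"] assms(2)[of s] assms(3,4) by (simp add: algebra_simps)
  qed
qed

lemma lsl_affine:
  assumes "a < b" "\<And>s. s \<in> {a..b} \<Longrightarrow> h s = m * s + c" "a < s" "s \<le> b"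
  shows "lsl h s (- m)"
proof -
  have "eventually (\<lambda>u. u \<in> {0<..<s - a}) (at_right 0)"
    using assms by (intro eventually_at_right_real) simp
  then show ?thesis unfolding lsl_def
  proof eventually_elim
    case (elim u)
    then show ?case using assms(2)[of "s - u"] assms(2)[of s] assms(3,4) by (simp add: algebra_simps)
  qed
qed

text \<open>A pointwise form of \<open>pl_int\<close>: sums of such functions can be treated without
  choosing a common refinement of two partitions.\<close>

definition loc_pl :: "(real \<Rightarrow> real) \<Rightarrow> real \<Rightarrow> bool" where
  "loc_pl h L \<longleftrightarrow> (\<forall>s. 0 \<le> s \<and> s < L \<longrightarrow> (\<exists>m::int. rsl h s (of_int m))) \<and>
     (\<forall>s. 0 < s \<and> s \<le> L \<longrightarrow> (\<exists>m::int. lsl h s (of_int m)))"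

lemma pl_int_pieces:
  assumes "pl_int h L"
  obtains n t m c where "t 0 = (0::real)" "t n = L" "\<And>i::nat. i < n \<Longrightarrow> t i < t (Suc i)"
    "\<And>i s. i < n \<Longrightarrow> s \<in> {t i..t (Suc i)} \<Longrightarrow> h s = of_int (m i :: int) * s + c i"
proof -
  obtain n t where t: "t 0 = 0" "t n = L" "\<forall>i<n. t i < t (Suc i)"
    and ex: "\<forall>i<n. \<exists>m::int. \<exists>c::real. \<forall>s \<in> {t i .. t (Suc i)}. h s = of_int m * s + c"
    using assms unfolding pl_int_def by auto
  obtain m :: "nat \<Rightarrow> int" where m: "\<forall>i<n. \<exists>c::real. \<forall>s \<in> {t i .. t (Suc i)}. h s = of_int (m i) * s + c"
    using ex by metis
  obtain c :: "nat \<Rightarrow> real" where "\<forall>i<n. \<forall>s \<in> {t i .. t (Suc i)}. h s = of_int (m i) * s + c i"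
    using m by metis
  then show ?thesis using that t by simp
qed

lemma partition_locate_right:
  fixes t :: "nat \<Rightarrow> real"
  assumes "t 0 \<le> s" "s < t n"
  shows "\<exists>i<n. t i \<le> s \<and> s < t (Suc i)"
  using assms
proof (induction n)
  case (Suc n)
  then show ?case by (cases "s < t n") (auto simp: less_Suc_eq not_less)
qed simp

lemma partition_locate_left:
  fixes t :: "nat \<Rightarrow> real"
  assumes "t 0 < s" "s \<le> t n"
  shows "\<exists>i<n. t i < s \<and> s \<le> t (Suc i)"
  using assms
proof (induction n)
  case (Suc n)
  then show ?case by (cases "s \<le> t n") (auto simp: less_Suc_eq not_le)
qed simp

lemma pl_int_imp_loc_pl:
  assumes "pl_int h L" shows "loc_pl h L"
  using assms
proof (rule pl_int_pieces)
  fix n t m c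
  assume t: "t 0 = (0::real)" "t n = L" "\<And>i::nat. i < n \<Longrightarrow> t i < t (Suc i)"
    and h: "\<And>i s. i < n \<Longrightarrow> s \<in> {t i..t (Suc i)} \<Longrightarrow> h s = of_int (m i :: int) * s + c i"
  show ?thesis unfolding loc_pl_def
  proof (intro conjI allI impI)
    fix s assume "0 \<le> s \<and> s < L"
    then obtain i where "i < n" "t i \<le> s" "s < t (Suc i)" using partition_locate_right[of t s n] t by auto
    then show "\<exists>m::int. rsl h s (of_int m)" using rsl_affine[OF t(3) h] by blast
  next
    fix s assume "0 < s \<and> s \<le> L"
    then obtain i where "i < n" "t i < s" "s \<le> t (Suc i)" using partition_locate_left[of t s n] t by auto
    then have "lsl h s (- of_int (m i))" using lsl_affine[OF t(3) h] by blast
    then show "\<exists>m::int. lsl h s (of_int m)" by (metis of_int_minus)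
  qed
qed

text \<open>\<open>pl_int\<close> with an arbitrary left end, so that pieces can be
  concatenated.\<close>

definition pl_on :: "(real \<Rightarrow> real) \<Rightarrow> real \<Rightarrow> real \<Rightarrow> bool" where
  "pl_on h a b \<longleftrightarrow> (\<exists>n::nat. \<exists>t::nat \<Rightarrow> real. t 0 = a \<and> t n = b \<and>
      (\<forall>i < n. t i < t (Suc i)) \<and>
      (\<forall>i < n. \<exists>m::int. \<exists>c::real. \<forall>s \<in> {t i .. t (Suc i)}. h s = of_int m * s + c))"

lemma pl_on_refl: "pl_on h a a"
  unfolding pl_on_def by (intro exI[of _ 0] exI[of _ "\<lambda>_. a"]) simp

lemma pl_on_affine:
  assumes "a \<le> b" "\<And>s. a \<le> s \<Longrightarrow> s \<le> b \<Longrightarrow> h s = of_int m * s + c"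
  shows "pl_on h a b"
proof (cases "a = b")
  case True
  then show ?thesis using pl_on_refl by simp
next
  case False
  have "\<exists>m::int. \<exists>c. \<forall>s \<in> {a..b}. h s = of_int m * s + c" using assms(2) by auto
  then show ?thesis unfolding pl_on_def using False assms(1)
    by (intro exI[of _ 1] exI[of _ "\<lambda>i. if i = 0 then a else b"]) simp
qed

lemma pl_on_trans:
  assumes "pl_on h a b" "pl_on h b c" shows "pl_on h a c"
proof -
  let ?aff = "\<lambda>x y. \<exists>m::int. \<exists>c::real. \<forall>s \<in> {x..y}. h s = of_int m * s + c"
  obtain n t where t: "t 0 = a" "t n = b" "\<forall>i<n. t i < t (Suc i)" "\<forall>i<n. ?aff (t i) (t (Suc i))"
    using assms(1) unfolding pl_on_def by blast
  obtain n' t' where t': "t' 0 = b" "t' n' = c" "\<forall>i<n'. t' i < t' (Suc i)" "\<forall>i<n'. ?aff (t' i) (t' (Suc i))"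
    using assms(2) unfolding pl_on_def by blast
  define r where "r = (\<lambda>i. if i \<le> n then t i else t' (i - n))"
  have *: "r i < r (Suc i) \<and> ?aff (r i) (r (Suc i))" if i: "i < n + n'" for i
  proof (cases "i < n")
    case True
    then have "r i = t i" "r (Suc i) = t (Suc i)" by (auto simp: r_def)
    then show ?thesis using t True by simp
  next
    case False
    then have "r i = t' (i - n)" "r (Suc i) = t' (Suc (i - n))" using t t' by (auto simp: r_def Suc_diff_le)
    moreover have "i - n < n'" using i False by simp
    ultimately show ?thesis using t' by simp
  qed
  have "r 0 = a" "r (n + n') = c" using t t' by (auto simp: r_def)
  then show ?thesis unfolding pl_on_def using *
    by (intro exI[of _ "n + n'"] exI[of _ r]) blast
qed

text \<open>Compactness of the interval, in the form of the bisection principle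
  \<open>Bolzano\<close>: being piecewise linear is transitive over adjacent intervals and holds on
  all short intervals around a point.\<close>

lemma loc_pl_imp_pl_int:
  assumes l: "loc_pl h L" and L: "0 < L"
  shows "pl_int h L"
proof -
  \<comment> \<open>The guards are needed because the short intervals of the bisection principle may
    stick out of \<open>[0, L]\<close>.\<close>
  define Q where "Q = (\<lambda>a b. 0 \<le> a \<longrightarrow> b \<le> L \<longrightarrow> pl_on h a b)"
  have "0 \<le> L" using L by simp
  then have "Q 0 L"
  proof (induction rule: Bolzano)
    case (trans a b c)
    then show ?case using pl_on_trans[of h a b c] unfolding Q_def by auto
  next
    case (local x)
    have "\<exists>d>0. \<forall>b. x \<le> b \<and> b < x + d \<and> b \<le> L \<longrightarrow> pl_on h x b"
    proof (cases "x < L")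
      case True
      then obtain m :: int where "rsl h x (of_int m)" using l local unfolding loc_pl_def by blast
      then obtain d where d: "d > 0" "\<And>u. 0 < u \<Longrightarrow> u < d \<Longrightarrow> h (x + u) = h x + of_int m * u"
        unfolding rsl_def eventually_at_right_field by auto
      have "pl_on h x b" if b: "x \<le> b" "b < x + d" for b
      proof (rule pl_on_affine[OF b(1)])
        fix s assume s: "x \<le> s" "s \<le> b"
        show "h s = of_int m * s + (h x - of_int m * x)"
          using d(2)[of "s - x"] s b by (cases "s = x") (auto simp: algebra_simps)
      qed
      then show ?thesis using d(1) by blast
    next
      case False
      then have "b = x" if "x \<le> b" "b \<le> L" for b using that by simp
      then have "pl_on h x b" if "x \<le> b" "b \<le> L" for b using that pl_on_refl by metis
      then show ?thesis by (intro exI[of _ 1]) auto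
    qed
    then obtain d1 where d1: "d1 > 0" "\<And>b. x \<le> b \<Longrightarrow> b < x + d1 \<Longrightarrow> b \<le> L \<Longrightarrow> pl_on h x b" by blast
    have "\<exists>d>0. \<forall>a. a \<le> x \<and> x - d < a \<and> 0 \<le> a \<longrightarrow> pl_on h a x"
    proof (cases "0 < x")
      case True
      then obtain m :: int where "lsl h x (of_int m)" using l local unfolding loc_pl_def by blast
      then obtain d where d: "d > 0" "\<And>u. 0 < u \<Longrightarrow> u < d \<Longrightarrow> h (x - u) = h x + of_int m * u"
        unfolding lsl_def eventually_at_right_field by auto
      have "pl_on h a x" if a: "a \<le> x" "x - d < a" for a
      proof (rule pl_on_affine[OF a(1)])
        fix s assume s: "a \<le> s" "s \<le> x"
        show "h s = of_int (- m) * s + (h x + of_int m * x)"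
          using d(2)[of "x - s"] s a by (cases "s = x") (auto simp: algebra_simps)
      qed
      then show ?thesis using d(1) by blast
    next
      case False
      then have "a = x" if "a \<le> x" "0 \<le> a" for a using that by simp
      then have "pl_on h a x" if "a \<le> x" "0 \<le> a" for a using that pl_on_refl by metis
      then show ?thesis by (intro exI[of _ 1]) auto
    qed
    then obtain d2 where d2: "d2 > 0" "\<And>a. a \<le> x \<Longrightarrow> x - d2 < a \<Longrightarrow> 0 \<le> a \<Longrightarrow> pl_on h a x" by blast
    show ?case
    proof (intro exI[of _ "min d1 d2"] conjI allI impI)
      show "0 < min d1 d2" using d1 d2 by simp
      fix a b assume ab: "a \<le> x \<and> x \<le> b \<and> b - a < min d1 d2"
      show "Q a b" unfolding Q_def using pl_on_trans[OF d2(2) d1(2), of a b] ab by auto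
    qed
  qed
  then show ?thesis by (simp add: Q_def pl_on_def pl_int_def)
qed

lemma pl_int_iff: "0 < L \<Longrightarrow> pl_int h L \<longleftrightarrow> loc_pl h L"
  using pl_int_imp_loc_pl loc_pl_imp_pl_int by blast

lemma loc_pl_reflect: "loc_pl h L \<Longrightarrow> loc_pl (\<lambda>t. h (L - t)) L"
  unfolding loc_pl_def rsl_reflect lsl_reflect by auto

text \<open>The case \<open>d = 0\<close> says that a function without break points is affine; \<open>d = 2\<close> that the
  parity of the slope is constant when all break points are even.\<close>

lemma slopes_congruent:
  fixes d :: int
  assumes pl: "pl_int h L" and L: "0 < L"
    and brk: "\<And>s. 0 < s \<Longrightarrow> s < L \<Longrightarrow> \<exists>k::int. rslope h s + lslope h s = of_int (d * k)"
  obtains m0 :: int where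
    "\<And>s. 0 \<le> s \<Longrightarrow> s < L \<Longrightarrow> \<exists>m::int. rsl h s (of_int m) \<and> d dvd m - m0"
    "\<And>s. 0 < s \<Longrightarrow> s \<le> L \<Longrightarrow> \<exists>m::int. lsl h s (of_int m) \<and> d dvd m + m0"
    "d = 0 \<Longrightarrow> h L = h 0 + of_int m0 * L"
  using pl
proof (rule pl_int_pieces)
  fix n t m c
  assume t: "t 0 = (0::real)" "t n = L" "\<And>i::nat. i < n \<Longrightarrow> t i < t (Suc i)"
    and h: "\<And>i s. i < n \<Longrightarrow> s \<in> {t i..t (Suc i)} \<Longrightarrow> h s = of_int (m i :: int) * s + c i"
  have ge: "i \<le> j \<Longrightarrow> j \<le> n \<Longrightarrow> t i \<le> t j" for i j
  proof (induction j)
    case (Suc j)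
    then show ?case using t(3)[of j] by (cases "i = Suc j") force+
  qed simp
  \<comment> \<open>At the break point \<open>t (Suc i)\<close> the outgoing slopes are
    \<open>m (Suc i)\<close> and \<open>- m i\<close>; by hypothesis their sum is a multiple of
    \<open>d\<close>.\<close>
  have cong: "i < n \<Longrightarrow> d dvd m i - m 0" for i
  proof (induction i)
    case (Suc i)
    have "t i < t (Suc i)" "t (Suc i) < t (Suc (Suc i))" "0 \<le> t i" "t (Suc (Suc i)) \<le> L"
      using t ge[of 0 i] ge[of "Suc (Suc i)" n] Suc.prems by auto
    moreover have "rsl h (t (Suc i)) (of_int (m (Suc i)))" "lsl h (t (Suc i)) (- of_int (m i))"
      using rsl_affine[OF t(3) h, of "Suc i" "Suc i" "t (Suc i)"] lsl_affine[OF t(3) h, of i i "t (Suc i)"]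
        Suc.prems calculation by simp_all
    ultimately obtain k :: int where "of_int (m (Suc i)) - of_int (m i) = (of_int (d * k) :: real)"
      using brk[of "t (Suc i)"] rslope_eq lslope_eq by force
    then have "m (Suc i) - m i = d * k" unfolding of_int_diff[symmetric] of_int_eq_iff .
    then have "d dvd (m (Suc i) - m i) + (m i - m 0)" using Suc by (intro dvd_add) auto
    then show ?case by simp
  qed simp
  have r: "\<exists>m'::int. rsl h s (of_int m') \<and> d dvd m' - m 0" if s: "0 \<le> s" "s < L" for s
  proof -
    obtain i where i: "i < n" "t i \<le> s" "s < t (Suc i)" using partition_locate_right[of t s n] t s by auto
    then have "rsl h s (of_int (m i))" using rsl_affine[OF t(3) h] by blast
    then show ?thesis using cong i(1) by blast
  qed
  have l: "\<exists>m'::int. lsl h s (of_int m') \<and> d dvd m' + m 0" if s: "0 < s" "s \<le> L" for s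
  proof -
    obtain i where i: "i < n" "t i < s" "s \<le> t (Suc i)" using partition_locate_left[of t s n] t s by auto
    then have "lsl h s (- of_int (m i))" using lsl_affine[OF t(3) h] by blast
    then have "lsl h s (of_int (- m i))" by simp
    moreover have "d dvd - m i + m 0" using cong[OF i(1)] by (metis dvd_minus_iff minus_diff_eq uminus_add_conv_diff)
    ultimately show ?thesis by blast
  qed
  have "h L = h 0 + of_int (m 0) * L" if "d = 0"
  proof -
    have "i \<le> n \<Longrightarrow> h (t i) = h 0 + of_int (m 0) * t i" for i
    proof (induction i)
      case (Suc i)
      then have "m i = m 0" using cong[of i] that by simp
      then show ?case using h[of i "t i"] h[of i "t (Suc i)"] t(3)[of i] Suc by (simp add: algebra_simps)
    qed (simp add: t)
    then show ?thesis using t(2) by auto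
  qed
  then show ?thesis using that r l by blast
qed

section \<open>Theta characteristics\<close>

definition metric_graph :: "tcurve \<Rightarrow> bool" where
  "metric_graph \<Gamma> \<longleftrightarrow> wf_graph (fst \<Gamma>) \<and> (\<forall>e \<in> E (fst \<Gamma>). 0 < snd \<Gamma> e)"

lemma metric_graphD:
  assumes "metric_graph \<Gamma>"
  shows "wf_graph (fst \<Gamma>)" "finite (E (fst \<Gamma>))" "finite (V (fst \<Gamma>))" "\<And>e. e \<in> E (fst \<Gamma>) \<Longrightarrow> 0 < snd \<Gamma> e"
    "\<And>e. e \<in> E (fst \<Gamma>) \<Longrightarrow> fst (ends (fst \<Gamma>) e) \<in> V (fst \<Gamma>)"
    "\<And>e. e \<in> E (fst \<Gamma>) \<Longrightarrow> snd (ends (fst \<Gamma>) e) \<in> V (fst \<Gamma>)"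
  using assms unfolding metric_graph_def wf_graph_def by auto

section \<open>Rational functions and linear equivalence\<close>

lemma rational_fun_iff:
  assumes "metric_graph \<Gamma>"
  shows "rational_fun \<Gamma> f \<longleftrightarrow> (\<forall>e \<in> E (fst \<Gamma>). loc_pl (fedge \<Gamma> f e) (snd \<Gamma> e))"
  unfolding rational_fun_def using pl_int_iff metric_graphD(4)[OF assms] by auto

lemma rational_rsl:
  assumes "metric_graph \<Gamma>" "rational_fun \<Gamma> f" "e \<in> E (fst \<Gamma>)" "0 \<le> s" "s < snd \<Gamma> e"
  obtains m :: int where "rsl (fedge \<Gamma> f e) s (of_int m)"
  using assms unfolding rational_fun_iff[OF assms(1)] loc_pl_def by blast

lemma rational_lsl:
  assumes "metric_graph \<Gamma>" "rational_fun \<Gamma> f" "e \<in> E (fst \<Gamma>)" "0 < s" "s \<le> snd \<Gamma> e"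
  obtains m :: int where "lsl (fedge \<Gamma> f e) s (of_int m)"
  using assms unfolding rational_fun_iff[OF assms(1)] loc_pl_def by blast

lemma fedge_linear:
  "fedge \<Gamma> (\<lambda>p. a * f p + b * f' p) e = (\<lambda>t. a * fedge \<Gamma> f e t + b * fedge \<Gamma> f' e t)"
  by (auto simp: fedge_def)

lemma rslope_linear:
  assumes m: "metric_graph \<Gamma>" and f: "rational_fun \<Gamma> f" "rational_fun \<Gamma> f'"
    and e: "e \<in> E (fst \<Gamma>)" "0 \<le> s" "s < snd \<Gamma> e"
  shows "rslope (fedge \<Gamma> (\<lambda>p. a * f p + b * f' p) e) s = a * rslope (fedge \<Gamma> f e) s + b * rslope (fedge \<Gamma> f' e) s"
proof -
  obtain k k' :: int where k: "rsl (fedge \<Gamma> f e) s (of_int k)" "rsl (fedge \<Gamma> f' e) s (of_int k')"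
    using rational_rsl[OF m f(1) e] rational_rsl[OF m f(2) e] by metis
  show ?thesis using rslope_eq[OF k(1)] rslope_eq[OF k(2)] rslope_eq[OF rsl_linear[OF k, of a b]]
    by (simp add: fedge_linear)
qed

lemma lslope_linear:
  assumes m: "metric_graph \<Gamma>" and f: "rational_fun \<Gamma> f" "rational_fun \<Gamma> f'"
    and e: "e \<in> E (fst \<Gamma>)" "0 < s" "s \<le> snd \<Gamma> e"
  shows "lslope (fedge \<Gamma> (\<lambda>p. a * f p + b * f' p) e) s = a * lslope (fedge \<Gamma> f e) s + b * lslope (fedge \<Gamma> f' e) s"
proof -
  obtain k k' :: int where k: "lsl (fedge \<Gamma> f e) s (of_int k)" "lsl (fedge \<Gamma> f' e) s (of_int k')"
    using rational_lsl[OF m f(1) e] rational_lsl[OF m f(2) e] by metis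
  show ?thesis using lslope_eq[OF k(1)] lslope_eq[OF k(2)] lslope_eq[OF lsl_linear[OF k, of a b]]
    by (simp add: fedge_linear)
qed

text \<open>The coefficients are real, not only integral, because a function is halved
  later.\<close>

lemma ordf_linear:
  assumes m: "metric_graph \<Gamma>" and f: "rational_fun \<Gamma> f" "rational_fun \<Gamma> f'" and p: "p \<in> pts \<Gamma>"
  shows "ordf \<Gamma> (\<lambda>p. a * f p + b * f' p) p = a * ordf \<Gamma> f p + b * ordf \<Gamma> f' p"
proof (cases p)
  case (Vt v)
  have "(\<Sum>e \<in> {e \<in> E (fst \<Gamma>). fst (ends (fst \<Gamma>) e) = v}. rslope (fedge \<Gamma> (\<lambda>p. a * f p + b * f' p) e) 0)
    = (\<Sum>e \<in> {e \<in> E (fst \<Gamma>). fst (ends (fst \<Gamma>) e) = v}.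
        a * rslope (fedge \<Gamma> f e) 0 + b * rslope (fedge \<Gamma> f' e) 0)"
    using metric_graphD(4)[OF m] by (intro sum.cong refl rslope_linear[OF m f]) auto
  moreover have "(\<Sum>e \<in> {e \<in> E (fst \<Gamma>). snd (ends (fst \<Gamma>) e) = v}. lslope (fedge \<Gamma> (\<lambda>p. a * f p + b * f' p) e) (snd \<Gamma> e))
    = (\<Sum>e \<in> {e \<in> E (fst \<Gamma>). snd (ends (fst \<Gamma>) e) = v}.
        a * lslope (fedge \<Gamma> f e) (snd \<Gamma> e) + b * lslope (fedge \<Gamma> f' e) (snd \<Gamma> e))"
    using metric_graphD(4)[OF m] by (intro sum.cong refl lslope_linear[OF m f]) auto
  ultimately show ?thesis
    unfolding ordf_def Vt by (simp add: sum.distrib sum_distrib_left algebra_simps)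
next
  case (Ep e t)
  then have "e \<in> E (fst \<Gamma>)" "0 < t" "t < snd \<Gamma> e" using p unfolding pts_def by auto
  then show ?thesis
    unfolding ordf_def Ep using rslope_linear[OF m f, of e t a b] lslope_linear[OF m f, of e t a b]
    by (simp add: algebra_simps)
qed

lemma rational_linear:
  assumes m: "metric_graph \<Gamma>" and f: "rational_fun \<Gamma> f" "rational_fun \<Gamma> f'"
  shows "rational_fun \<Gamma> (\<lambda>p. of_int a * f p + of_int b * f' p)"
  unfolding rational_fun_iff[OF m] loc_pl_def
proof (intro ballI conjI allI impI)
  fix e s assume e: "e \<in> E (fst \<Gamma>)" and s: "0 \<le> s \<and> s < snd \<Gamma> e"
  obtain k k' :: int where k: "rsl (fedge \<Gamma> f e) s (of_int k)" "rsl (fedge \<Gamma> f' e) s (of_int k')"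
    using rational_rsl[OF m f(1) e] rational_rsl[OF m f(2) e] s by metis
  from rsl_linear[OF k, of "of_int a" "of_int b"]
  have "rsl (fedge \<Gamma> (\<lambda>p. of_int a * f p + of_int b * f' p) e) s (of_int (a * k + b * k'))"
    unfolding fedge_linear by simp
  then show "\<exists>m::int. rsl (fedge \<Gamma> (\<lambda>p. of_int a * f p + of_int b * f' p) e) s (of_int m)" by blast
next
  fix e s assume e: "e \<in> E (fst \<Gamma>)" and s: "0 < s \<and> s \<le> snd \<Gamma> e"
  obtain k k' :: int where k: "lsl (fedge \<Gamma> f e) s (of_int k)" "lsl (fedge \<Gamma> f' e) s (of_int k')"
    using rational_lsl[OF m f(1) e] rational_lsl[OF m f(2) e] s by metis
  from lsl_linear[OF k, of "of_int a" "of_int b"]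
  have "lsl (fedge \<Gamma> (\<lambda>p. of_int a * f p + of_int b * f' p) e) s (of_int (a * k + b * k'))"
    unfolding fedge_linear by simp
  then show "\<exists>m::int. lsl (fedge \<Gamma> (\<lambda>p. of_int a * f p + of_int b * f' p) e) s (of_int m)" by blast
qed

text \<open>Coefficients (-1, 0) give symmetry and (1, 1) transitivity.\<close>

lemma lin_equiv_linear:
  assumes m: "metric_graph \<Gamma>" and l: "lin_equiv \<Gamma> D1 D1'" "lin_equiv \<Gamma> D2 D2'"
    and D: "D \<in> Div \<Gamma>" "D' \<in> Div \<Gamma>" "\<And>p. D p - D' p = a * (D1 p - D1' p) + b * (D2 p - D2' p)"
  shows "lin_equiv \<Gamma> D D'"
proof -
  obtain f1 where f1: "rational_fun \<Gamma> f1" "\<forall>p \<in> pts \<Gamma>. of_int (D1 p - D1' p) = ordf \<Gamma> f1 p"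
    using l(1) unfolding lin_equiv_def by blast
  obtain f2 where f2: "rational_fun \<Gamma> f2" "\<forall>p \<in> pts \<Gamma>. of_int (D2 p - D2' p) = ordf \<Gamma> f2 p"
    using l(2) unfolding lin_equiv_def by blast
  have "of_int (D p - D' p) = ordf \<Gamma> (\<lambda>p. of_int a * f1 p + of_int b * f2 p) p" if p: "p \<in> pts \<Gamma>" for p
  proof -
    have "ordf \<Gamma> f1 p = of_int (D1 p - D1' p)" "ordf \<Gamma> f2 p = of_int (D2 p - D2' p)"
      using f1(2) f2(2) p by simp_all
    then show ?thesis unfolding ordf_linear[OF m f1(1) f2(1) p] D(3) by simp
  qed
  then show ?thesis
    unfolding lin_equiv_def using D rational_linear[OF m f1(1) f2(1)] by blast
qed

lemma rational_const: "metric_graph \<Gamma> \<Longrightarrow> rational_fun \<Gamma> (\<lambda>_. c)"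
  unfolding rational_fun_iff loc_pl_def fedge_def rsl_def lsl_def by (auto intro!: exI[of _ 0])

lemma ordf_const:
  assumes "metric_graph \<Gamma>" shows "ordf \<Gamma> (\<lambda>_. c) p = 0"
proof -
  have "rslope (fedge \<Gamma> (\<lambda>_. c) e) s = 0" "lslope (fedge \<Gamma> (\<lambda>_. c) e) s = 0" for e s
    by (auto intro!: rslope_eq lslope_eq simp: rsl_def lsl_def fedge_def)
  then show ?thesis unfolding ordf_def by (cases p) auto
qed

lemma lin_equiv_refl:
  assumes "metric_graph \<Gamma>" "D \<in> Div \<Gamma>" shows "lin_equiv \<Gamma> D D"
  unfolding lin_equiv_def using assms rational_const[OF assms(1)] ordf_const[OF assms(1)] by auto

lemma lin_equivD: "lin_equiv \<Gamma> D D' \<Longrightarrow> D \<in> Div \<Gamma>" "lin_equiv \<Gamma> D D' \<Longrightarrow> D' \<in> Div \<Gamma>"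
  unfolding lin_equiv_def by auto

lemma lin_equiv_sym:
  assumes "metric_graph \<Gamma>" "lin_equiv \<Gamma> D D'" shows "lin_equiv \<Gamma> D' D"
  by (rule lin_equiv_linear[OF assms(1) assms(2) assms(2), of _ _ "-1" 0]) (use lin_equivD assms(2) in auto)

lemma lin_equiv_trans:
  assumes "metric_graph \<Gamma>" "lin_equiv \<Gamma> D D'" "lin_equiv \<Gamma> D' D''" shows "lin_equiv \<Gamma> D D''"
  by (rule lin_equiv_linear[OF assms, of _ _ 1 1]) (use lin_equivD assms(2,3) in auto)

lemma pic_cls_eq_iff:
  assumes m: "metric_graph \<Gamma>" and D: "D \<in> Div \<Gamma>"
  shows "pic_cls \<Gamma> D = pic_cls \<Gamma> D' \<longleftrightarrow> lin_equiv \<Gamma> D D'"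
proof
  assume "pic_cls \<Gamma> D = pic_cls \<Gamma> D'"
  then show "lin_equiv \<Gamma> D D'" using lin_equiv_refl[OF m D] unfolding pic_cls_def by auto
next
  assume "lin_equiv \<Gamma> D D'"
  then show "pic_cls \<Gamma> D = pic_cls \<Gamma> D'"
    unfolding pic_cls_def using lin_equiv_sym[OF m] lin_equiv_trans[OF m] by blast
qed

text \<open>Minus the distance to the vertices on the edges outside \<open>P\<close>: its divisor is \<open>2 T_P - K\<close>.\<close>

definition fP :: "tcurve \<Rightarrow> nat set \<Rightarrow> tpt \<Rightarrow> real" where
  "fP \<Gamma> P p = (case p of Vt v \<Rightarrow> 0 | Ep e t \<Rightarrow> if e \<in> P then 0 else - min t (snd \<Gamma> e - t))"

lemma fedge_fP:
  assumes "0 < snd \<Gamma> e"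
  shows "fedge \<Gamma> (fP \<Gamma> P) e t = (if e \<in> P then 0 else - min t (snd \<Gamma> e - t))"
  using assms unfolding fedge_def fP_def by auto

text \<open>The strict inequality matters: outside \<open>P\<close>, at the midpoint both outgoing
  slopes are 1, which gives order 2, twice the coefficient of the midpoint in \<open>TP\<close>. At
  all other interior points they cancel.\<close>

lemma rsl_fP:
  assumes L: "0 < snd \<Gamma> e" and s: "0 \<le> s" "s < snd \<Gamma> e"
  shows "rsl (fedge \<Gamma> (fP \<Gamma> P) e) s (if e \<in> P then 0 else if s < snd \<Gamma> e / 2 then -1 else 1)"
proof -
  let ?h = "fedge \<Gamma> (fP \<Gamma> P) e"
  consider "e \<in> P" | "e \<notin> P" "s < snd \<Gamma> e / 2" | "e \<notin> P" "s \<ge> snd \<Gamma> e / 2" by linarith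
  then show ?thesis
  proof cases
    case 1
    have "rsl ?h s 0" by (rule rsl_affine[of 0 "snd \<Gamma> e" _ _ 0]) (use 1 L s in \<open>auto simp: fedge_fP\<close>)
    then show ?thesis using 1 by simp
  next
    case 2
    have "rsl ?h s (-1)" by (rule rsl_affine[of 0 "snd \<Gamma> e / 2" _ _ 0]) (use 2 L s in \<open>auto simp: fedge_fP\<close>)
    then show ?thesis using 2 by simp
  next
    case 3
    have "rsl ?h s 1"
      by (rule rsl_affine[of "snd \<Gamma> e / 2" "snd \<Gamma> e" _ _ "- snd \<Gamma> e"]) (use 3 L s in \<open>auto simp: fedge_fP\<close>)
    then show ?thesis using 3 by simp
  qed
qed

lemma lsl_fP:
  assumes L: "0 < snd \<Gamma> e" and s: "0 < s" "s \<le> snd \<Gamma> e"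
  shows "lsl (fedge \<Gamma> (fP \<Gamma> P) e) s (if e \<in> P then 0 else if s \<le> snd \<Gamma> e / 2 then 1 else -1)"
proof -
  have sym: "fedge \<Gamma> (fP \<Gamma> P) e = (\<lambda>t. fedge \<Gamma> (fP \<Gamma> P) e (snd \<Gamma> e - t))"
    using L by (auto simp: fedge_fP min.commute)
  have "rsl (fedge \<Gamma> (fP \<Gamma> P) e) (snd \<Gamma> e - s)
     (if e \<in> P then 0 else if snd \<Gamma> e - s < snd \<Gamma> e / 2 then -1 else 1)"
    by (rule rsl_fP) (use assms in auto)
  moreover have "(if snd \<Gamma> e - s < snd \<Gamma> e / 2 then -1 else 1) = (if s \<le> snd \<Gamma> e / 2 then 1 else -1 :: real)"
    by (simp add: field_simps)
  ultimately show ?thesis by (subst sym) (simp only: lsl_reflect)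
qed

lemma rational_fP:
  assumes "metric_graph \<Gamma>" shows "rational_fun \<Gamma> (fP \<Gamma> P)"
  unfolding rational_fun_iff[OF assms] loc_pl_def
proof (intro ballI conjI allI impI)
  fix e s assume "e \<in> E (fst \<Gamma>)" "0 \<le> s \<and> s < snd \<Gamma> e"
  then have "rsl (fedge \<Gamma> (fP \<Gamma> P) e) s (of_int (if e \<in> P then 0 else if s < snd \<Gamma> e / 2 then -1 else 1))"
    using rsl_fP[of \<Gamma> e s P] by auto
  then show "\<exists>m::int. rsl (fedge \<Gamma> (fP \<Gamma> P) e) s (of_int m)" by blast
next
  fix e s assume "e \<in> E (fst \<Gamma>)" "0 < s \<and> s \<le> snd \<Gamma> e"
  then have "lsl (fedge \<Gamma> (fP \<Gamma> P) e) s (of_int (if e \<in> P then 0 else if s \<le> snd \<Gamma> e / 2 then 1 else -1))"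
    using lsl_fP[of \<Gamma> e s P] by auto
  then show "\<exists>m::int. lsl (fedge \<Gamma> (fP \<Gamma> P) e) s (of_int m)" by blast
qed

text \<open>At a vertex each end of an edge outside \<open>P\<close> contributes -1, in total
  \<open>degP - deg\<close>. This is 2 T_P - K there once evenness cancels the division by two in
  \<open>TP\<close>.\<close>

lemma ordf_fP:
  assumes m: "metric_graph \<Gamma>" and P: "cyc (fst \<Gamma>) P" and p: "p \<in> pts \<Gamma>"
  shows "ordf \<Gamma> (fP \<Gamma> P) p = of_int (2 * TP \<Gamma> P p - canon \<Gamma> p)"
proof (cases p)
  case (Vt v)
  let ?G = "fst \<Gamma>"
  have v: "v \<in> V ?G" using p Vt unfolding pts_def by auto
  have PE: "P \<subseteq> E ?G" and ev: "even (degP ?G P v)" using P v unfolding cyc_def by auto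
  have cnt: "(\<Sum>e \<in> {e \<in> E ?G. Q e}. if e \<in> P then 0 else - 1 :: real) = real (card {e \<in> P. Q e}) - real (card {e \<in> E ?G. Q e})" for Q
  proof -
    have fin: "finite {e \<in> E ?G. Q e}" using metric_graphD(2)[OF m] by simp
    have "{e \<in> E ?G. Q e} \<inter> {e. e \<in> P} = {e \<in> P. Q e}" using PE by auto
    then have "(\<Sum>e \<in> {e \<in> E ?G. Q e}. of_bool (e \<in> P) :: real) = real (card {e \<in> P. Q e})"
      using fin by (simp add: of_bool_def sum.If_cases)
    moreover have "(\<Sum>e \<in> {e \<in> E ?G. Q e}. if e \<in> P then 0 else - 1 :: real) = (\<Sum>e \<in> {e \<in> E ?G. Q e}. of_bool (e \<in> P) - 1)"
      by (intro sum.cong) auto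
    ultimately show ?thesis by (simp add: sum_subtractf)
  qed
  have "(\<Sum>e \<in> {e \<in> E ?G. fst (ends ?G e) = v}. rslope (fedge \<Gamma> (fP \<Gamma> P) e) 0)
     = (\<Sum>e \<in> {e \<in> E ?G. fst (ends ?G e) = v}. if e \<in> P then 0 else - 1)"
    using metric_graphD(4)[OF m] by (intro sum.cong refl) (auto simp: rslope_eq[OF rsl_fP])
  moreover have "(\<Sum>e \<in> {e \<in> E ?G. snd (ends ?G e) = v}. lslope (fedge \<Gamma> (fP \<Gamma> P) e) (snd \<Gamma> e))
     = (\<Sum>e \<in> {e \<in> E ?G. snd (ends ?G e) = v}. if e \<in> P then 0 else - 1)"
  proof (intro sum.cong refl)
    fix e assume "e \<in> {e \<in> E ?G. snd (ends ?G e) = v}"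
    then have "0 < snd \<Gamma> e" using metric_graphD(4)[OF m] by auto
    then show "lslope (fedge \<Gamma> (fP \<Gamma> P) e) (snd \<Gamma> e) = (if e \<in> P then 0 else - 1)"
      using lslope_eq[OF lsl_fP[of \<Gamma> e "snd \<Gamma> e" P]] by simp
  qed
  ultimately have "ordf \<Gamma> (fP \<Gamma> P) p = real (degP ?G P v) - real (deg ?G v)"
    unfolding ordf_def Vt cnt degP_def deg_def by simp
  moreover have "2 * (int (degP ?G P v) div 2) = int (degP ?G P v)" using ev by simp
  ultimately show ?thesis using v unfolding Vt TP_def canon_def by simp
next
  case (Ep e t)
  then have e: "e \<in> E (fst \<Gamma>)" "0 < t" "t < snd \<Gamma> e" using p unfolding pts_def by auto
  then show ?thesis
    unfolding ordf_def Ep TP_def canon_def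
    using rslope_eq[OF rsl_fP[of \<Gamma> e t P]] lslope_eq[OF lsl_fP[of \<Gamma> e t P]] by auto
qed

lemma canon_TP_in_Div:
  assumes m: "metric_graph \<Gamma>"
  shows "canon \<Gamma> \<in> Div \<Gamma>" "TP \<Gamma> P \<in> Div \<Gamma>"
proof -
  have sub: "{p. canon \<Gamma> p \<noteq> 0} \<subseteq> Vt ` V (fst \<Gamma>)"
  proof
    fix p assume "p \<in> {p. canon \<Gamma> p \<noteq> 0}"
    then show "p \<in> Vt ` V (fst \<Gamma>)" by (cases p) (auto simp: canon_def split: if_splits)
  qed
  then show "canon \<Gamma> \<in> Div \<Gamma>"
    using metric_graphD(3)[OF m] finite_subset[OF sub] unfolding Div_def pts_def by auto
  have sub: "{p. TP \<Gamma> P p \<noteq> 0} \<subseteq> Vt ` V (fst \<Gamma>) \<union> (\<lambda>e. Ep e (snd \<Gamma> e / 2)) ` E (fst \<Gamma>)"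
  proof
    fix p assume "p \<in> {p. TP \<Gamma> P p \<noteq> 0}"
    then show "p \<in> Vt ` V (fst \<Gamma>) \<union> (\<lambda>e. Ep e (snd \<Gamma> e / 2)) ` E (fst \<Gamma>)"
      by (cases p) (auto simp: TP_def split: if_splits)
  qed
  moreover have "Vt ` V (fst \<Gamma>) \<union> (\<lambda>e. Ep e (snd \<Gamma> e / 2)) ` E (fst \<Gamma>) \<subseteq> pts \<Gamma>"
  proof -
    have "Ep e (snd \<Gamma> e / 2) \<in> pts \<Gamma>" if "e \<in> E (fst \<Gamma>)" for e
      unfolding pts_def using that metric_graphD(4)[OF m that]
      by (intro UnI2 CollectI exI[of _ e] exI[of _ "snd \<Gamma> e / 2"]) auto
    moreover have "Vt ` V (fst \<Gamma>) \<subseteq> pts \<Gamma>" unfolding pts_def by auto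
    ultimately show ?thesis by blast
  qed
  ultimately have "{p. TP \<Gamma> P p \<noteq> 0} \<subseteq> pts \<Gamma>" by (rule subset_trans)
  then show "TP \<Gamma> P \<in> Div \<Gamma>"
    using metric_graphD(2,3)[OF m] finite_subset[OF sub] unfolding Div_def by simp
qed

lemma double_Div: "D \<in> Div \<Gamma> \<Longrightarrow> (\<lambda>p. 2 * D p) \<in> Div \<Gamma>"
  unfolding Div_def by simp

lemma TP_theta_char:
  assumes m: "metric_graph \<Gamma>" and P: "cyc (fst \<Gamma>) P"
  shows "pic_cls \<Gamma> (TP \<Gamma> P) \<in> theta_chars \<Gamma>"
proof -
  have "lin_equiv \<Gamma> (\<lambda>p. 2 * TP \<Gamma> P p) (canon \<Gamma>)"
    unfolding lin_equiv_def
    using canon_TP_in_Div[OF m] double_Div rational_fP[OF m, of P] ordf_fP[OF m P] by metis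
  then show ?thesis unfolding theta_chars_def using canon_TP_in_Div[OF m] by blast
qed

text \<open>If \<open>div f = 2 D - K\<close>, the slopes of \<open>f\<close> have constant parity along each edge; the edges of
  even slope form \<open>P\<close>.\<close>

lemma theta_char_TP:
  assumes m: "metric_graph \<Gamma>" and D: "D \<in> Div \<Gamma>" and l: "lin_equiv \<Gamma> (\<lambda>p. 2 * D p) (canon \<Gamma>)"
  shows "\<exists>P. cyc (fst \<Gamma>) P \<and> lin_equiv \<Gamma> D (TP \<Gamma> P)"
proof -
  let ?G = "fst \<Gamma>"
  obtain f where f: "rational_fun \<Gamma> f" and df: "\<And>p. p \<in> pts \<Gamma> \<Longrightarrow> of_int (2 * D p - canon \<Gamma> p) = ordf \<Gamma> f p"
    using l unfolding lin_equiv_def by blast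
  \<comment> \<open>The canonical divisor vanishes inside edges, so interior orders of
    \<open>f\<close> are even and slopes are congruent modulo \<open>d = 2\<close>.\<close>
  have "\<exists>m0::int. (\<forall>s. 0 \<le> s \<longrightarrow> s < snd \<Gamma> e \<longrightarrow> (\<exists>m::int. rsl (fedge \<Gamma> f e) s (of_int m) \<and> 2 dvd m - m0)) \<and>
     (\<forall>s. 0 < s \<longrightarrow> s \<le> snd \<Gamma> e \<longrightarrow> (\<exists>m::int. lsl (fedge \<Gamma> f e) s (of_int m) \<and> 2 dvd m + m0))"
    if e: "e \<in> E ?G" for e
  proof (rule slopes_congruent[of "fedge \<Gamma> f e" "snd \<Gamma> e" 2])
    show "pl_int (fedge \<Gamma> f e) (snd \<Gamma> e)" using f e unfolding rational_fun_def by blast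
    show "0 < snd \<Gamma> e" using metric_graphD(4)[OF m e] .
    fix s assume s: "0 < s" "s < snd \<Gamma> e"
    then have "Ep e s \<in> pts \<Gamma>" using e unfolding pts_def by auto
    from df[OF this] show "\<exists>k::int. rslope (fedge \<Gamma> f e) s + lslope (fedge \<Gamma> f e) s = of_int (2 * k)"
      unfolding ordf_def canon_def by (intro exI[of _ "D (Ep e s)"]) simp
  qed blast
  then obtain m0 :: "nat \<Rightarrow> int" where
    r0: "\<And>e s. e \<in> E ?G \<Longrightarrow> 0 \<le> s \<Longrightarrow> s < snd \<Gamma> e \<Longrightarrow> \<exists>m::int. rsl (fedge \<Gamma> f e) s (of_int m) \<and> 2 dvd m - m0 e"
    and l0: "\<And>e s. e \<in> E ?G \<Longrightarrow> 0 < s \<Longrightarrow> s \<le> snd \<Gamma> e \<Longrightarrow> \<exists>m::int. lsl (fedge \<Gamma> f e) s (of_int m) \<and> 2 dvd m + m0 e"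
    by metis
  define P where "P = {e \<in> E ?G. even (m0 e)}"
  have PE: "P \<subseteq> E ?G" unfolding P_def by auto
  have fin: "finite (E ?G)" using metric_graphD(2)[OF m] .
  have r: "\<exists>m::int. rsl (fedge \<Gamma> f e) s (of_int m) \<and> (even m \<longleftrightarrow> e \<in> P)" if e: "e \<in> E ?G" "0 \<le> s" "s < snd \<Gamma> e" for e s
    using r0[OF e] e(1) unfolding P_def by auto
  have l: "\<exists>m::int. lsl (fedge \<Gamma> f e) s (of_int m) \<and> (even m \<longleftrightarrow> e \<in> P)" if e: "e \<in> E ?G" "0 < s" "s \<le> snd \<Gamma> e" for e s
    using l0[OF e] e(1) unfolding P_def by auto
  have "even (degP ?G P v)" if v: "v \<in> V ?G" for v
  proof -
    have "\<forall>e \<in> E ?G. \<exists>k::int. rslope (fedge \<Gamma> f e) 0 = of_int k \<and> (even k \<longleftrightarrow> e \<in> P)"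
      using r[of _ 0] metric_graphD(4)[OF m] rslope_eq by (metis order_refl)
    then obtain a :: "nat \<Rightarrow> int" where a: "\<And>e. e \<in> E ?G \<Longrightarrow> rslope (fedge \<Gamma> f e) 0 = of_int (a e)"
      "\<And>e. e \<in> E ?G \<Longrightarrow> even (a e) \<longleftrightarrow> e \<in> P" by metis
    have "\<forall>e \<in> E ?G. \<exists>k::int. lslope (fedge \<Gamma> f e) (snd \<Gamma> e) = of_int k \<and> (even k \<longleftrightarrow> e \<in> P)"
      using l metric_graphD(4)[OF m] lslope_eq by (metis order_refl)
    then obtain b :: "nat \<Rightarrow> int" where b: "\<And>e. e \<in> E ?G \<Longrightarrow> lslope (fedge \<Gamma> f e) (snd \<Gamma> e) = of_int (b e)"
      "\<And>e. e \<in> E ?G \<Longrightarrow> even (b e) \<longleftrightarrow> e \<in> P" by metis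
    let ?A = "{e \<in> E ?G. fst (ends ?G e) = v}" and ?B = "{e \<in> E ?G. snd (ends ?G e) = v}"
    \<comment> \<open>For every edge \<open>k e + 1 + of_bool (e \<in> P)\<close> is even; summing
      compares slope sums with valences and degrees in \<open>P\<close>.\<close>
    have par: "even ((\<Sum>e \<in> {e \<in> E ?G. Q e}. k e) + int (card {e \<in> E ?G. Q e}) + int (card {e \<in> P. Q e}))"
      if k: "\<And>e. e \<in> E ?G \<Longrightarrow> even (k e) \<longleftrightarrow> e \<in> P" for k :: "nat \<Rightarrow> int" and Q
    proof -
      have "{e \<in> E ?G. Q e} \<inter> {e. e \<in> P} = {e \<in> P. Q e}" using PE by auto
      then have "(\<Sum>e \<in> {e \<in> E ?G. Q e}. of_bool (e \<in> P)) = int (card {e \<in> P. Q e})"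
        using fin by (simp add: of_bool_def sum.If_cases)
      then have "(\<Sum>e \<in> {e \<in> E ?G. Q e}. k e) + int (card {e \<in> E ?G. Q e}) + int (card {e \<in> P. Q e})
         = (\<Sum>e \<in> {e \<in> E ?G. Q e}. k e + 1 + of_bool (e \<in> P))"
        by (simp add: sum.distrib)
      moreover have "even \<dots>" using k by (intro dvd_sum) auto
      ultimately show ?thesis by simp
    qed
    have "Vt v \<in> pts \<Gamma>" using v unfolding pts_def by auto
    from df[OF this] have "of_int (2 * D (Vt v) - canon \<Gamma> (Vt v)) = ((\<Sum>e \<in> ?A. of_int (a e)) + (\<Sum>e \<in> ?B. of_int (b e)) :: real)"
      unfolding ordf_def using a(1) b(1) by simp
    then have "2 * D (Vt v) - canon \<Gamma> (Vt v) = (\<Sum>e \<in> ?A. a e) + (\<Sum>e \<in> ?B. b e)"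
      unfolding of_int_sum[symmetric] of_int_add[symmetric] of_int_eq_iff .
    then have "(\<Sum>e \<in> ?A. a e) + (\<Sum>e \<in> ?B. b e) = 2 * D (Vt v) - 2 * int (wt ?G v) + 2 - int (deg ?G v)"
      using v unfolding canon_def by simp
    moreover have "even ((\<Sum>e \<in> ?A. a e) + (\<Sum>e \<in> ?B. b e) + int (deg ?G v) + int (degP ?G P v))"
      using dvd_add[OF par[OF a(2), of "\<lambda>e. fst (ends ?G e) = v"] par[OF b(2), of "\<lambda>e. snd (ends ?G e) = v"]]
      unfolding deg_def degP_def by (simp add: algebra_simps)
    ultimately have "even (2 * D (Vt v) - 2 * int (wt ?G v) + 2 + int (degP ?G P v))" by simp
    then show ?thesis by simp
  qed
  then have cyc: "cyc ?G P" using PE unfolding cyc_def by blast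
  \<comment> \<open>Half of \<open>f - fP\<close>: both functions have even slopes exactly on
    \<open>P\<close>, so the slopes are integers, and the divisor is half of (2 D - K) - (2 T_P -
    K).\<close>
  let ?g = "\<lambda>p. (1/2) * f p + (-1/2) * fP \<Gamma> P p"
  have "rational_fun \<Gamma> ?g" unfolding rational_fun_iff[OF m] loc_pl_def
  proof (intro ballI conjI allI impI)
    fix e s assume e: "e \<in> E ?G" and s: "0 \<le> s \<and> s < snd \<Gamma> e"
    obtain k :: int where k: "rsl (fedge \<Gamma> f e) s (of_int k)" "even k \<longleftrightarrow> e \<in> P" using r[OF e] s by blast
    define j :: int where "j = (if e \<in> P then 0 else if s < snd \<Gamma> e / 2 then -1 else 1)"
    have j: "rsl (fedge \<Gamma> (fP \<Gamma> P) e) s (of_int j)"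
      unfolding j_def using rsl_fP[of \<Gamma> e s P] metric_graphD(4)[OF m e] s by auto
    have "even (k - j)" using k(2) by (auto simp: j_def)
    then obtain i where "k - j = 2 * i" by blast
    then have "k = 2 * i + j" by simp
    then have "(1/2) * of_int k + (-1/2) * of_int j = (of_int i :: real)" by (simp add: field_simps)
    then show "\<exists>m::int. rsl (fedge \<Gamma> ?g e) s (of_int m)"
      using rsl_linear[OF k(1) j, of "1/2" "-1/2"] unfolding fedge_linear by auto
  next
    fix e s assume e: "e \<in> E ?G" and s: "0 < s \<and> s \<le> snd \<Gamma> e"
    obtain k :: int where k: "lsl (fedge \<Gamma> f e) s (of_int k)" "even k \<longleftrightarrow> e \<in> P" using l[OF e] s by blast
    define j :: int where "j = (if e \<in> P then 0 else if s \<le> snd \<Gamma> e / 2 then 1 else -1)"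
    have j: "lsl (fedge \<Gamma> (fP \<Gamma> P) e) s (of_int j)"
      unfolding j_def using lsl_fP[of \<Gamma> e s P] metric_graphD(4)[OF m e] s by auto
    have "even (k - j)" using k(2) by (auto simp: j_def)
    then obtain i where "k - j = 2 * i" by blast
    then have "k = 2 * i + j" by simp
    then have "(1/2) * of_int k + (-1/2) * of_int j = (of_int i :: real)" by (simp add: field_simps)
    then show "\<exists>m::int. lsl (fedge \<Gamma> ?g e) s (of_int m)"
      using lsl_linear[OF k(1) j, of "1/2" "-1/2"] unfolding fedge_linear by auto
  qed
  moreover have "of_int (D p - TP \<Gamma> P p) = ordf \<Gamma> ?g p" if p: "p \<in> pts \<Gamma>" for p
    unfolding ordf_linear[OF m f rational_fP[OF m] p] ordf_fP[OF m cyc p] df[OF p, symmetric]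
    by (simp add: field_simps)
  ultimately have "lin_equiv \<Gamma> D (TP \<Gamma> P)"
    unfolding lin_equiv_def using D canon_TP_in_Div[OF m] by blast
  then show ?thesis using cyc by blast
qed

text \<open>A function with zero divisor is affine on edges, and its energy, the sum of slope squared times
  length, vanishes.\<close>

lemma harmonic_slope_zero:
  assumes m: "metric_graph \<Gamma>" and f: "rational_fun \<Gamma> f" and h: "\<And>p. p \<in> pts \<Gamma> \<Longrightarrow> ordf \<Gamma> f p = 0"
    and e0: "e0 \<in> E (fst \<Gamma>)"
  shows "rslope (fedge \<Gamma> f e0) 0 = 0"
proof -
  let ?G = "fst \<Gamma>"
  let ?u = "\<lambda>e. f (Vt (fst (ends ?G e)))" and ?w = "\<lambda>e. f (Vt (snd (ends ?G e)))"
  have "\<exists>k::int. rslope (fedge \<Gamma> f e) 0 = of_int k \<and> lslope (fedge \<Gamma> f e) (snd \<Gamma> e) = - of_int k \<and>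
     ?w e = ?u e + of_int k * snd \<Gamma> e" if e: "e \<in> E ?G" for e
  proof (rule slopes_congruent[of "fedge \<Gamma> f e" "snd \<Gamma> e" 0])
    show "pl_int (fedge \<Gamma> f e) (snd \<Gamma> e)" using f e unfolding rational_fun_def by blast
    show L: "0 < snd \<Gamma> e" using metric_graphD(4)[OF m e] .
    fix s assume s: "0 < s" "s < snd \<Gamma> e"
    then have "Ep e s \<in> pts \<Gamma>" using e unfolding pts_def by auto
    from h[OF this] show "\<exists>k::int. rslope (fedge \<Gamma> f e) s + lslope (fedge \<Gamma> f e) s = of_int (0 * k)"
      unfolding ordf_def by simp
  next
    fix m0 :: int
    assume r: "\<And>s. 0 \<le> s \<Longrightarrow> s < snd \<Gamma> e \<Longrightarrow> \<exists>m::int. rsl (fedge \<Gamma> f e) s (of_int m) \<and> 0 dvd m - m0"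
      and l: "\<And>s. 0 < s \<Longrightarrow> s \<le> snd \<Gamma> e \<Longrightarrow> \<exists>m::int. lsl (fedge \<Gamma> f e) s (of_int m) \<and> 0 dvd m + m0"
      and a: "(0::int) = 0 \<Longrightarrow> fedge \<Gamma> f e (snd \<Gamma> e) = fedge \<Gamma> f e 0 + of_int m0 * snd \<Gamma> e"
    have L: "0 < snd \<Gamma> e" using metric_graphD(4)[OF m e] .
    have "rsl (fedge \<Gamma> f e) 0 (of_int m0)" using r[of 0] L by auto
    moreover obtain k :: int where "lsl (fedge \<Gamma> f e) (snd \<Gamma> e) (of_int k)" "k + m0 = 0" using l[of "snd \<Gamma> e"] L by auto
    then have "lsl (fedge \<Gamma> f e) (snd \<Gamma> e) (- of_int m0)" by (metis add.inverse_unique add.commute of_int_minus)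
    moreover have "?w e = ?u e + of_int m0 * snd \<Gamma> e" using a L by (simp add: fedge_def)
    ultimately show ?thesis using rslope_eq lslope_eq by blast
  qed
  then obtain k :: "nat \<Rightarrow> int" where k: "\<And>e. e \<in> E ?G \<Longrightarrow> rslope (fedge \<Gamma> f e) 0 = of_int (k e)"
    "\<And>e. e \<in> E ?G \<Longrightarrow> lslope (fedge \<Gamma> f e) (snd \<Gamma> e) = - of_int (k e)"
    "\<And>e. e \<in> E ?G \<Longrightarrow> ?w e = ?u e + of_int (k e) * snd \<Gamma> e" by metis
  have fin: "finite (E ?G)" "finite (V ?G)" using metric_graphD(2,3)[OF m] .
  \<comment> \<open>Summation by parts: resorted by edges, the sum of \<open>f\<close> times its
    order becomes the sum of \<open>(?u e - ?w e) * k e\<close>, which is minus the energy.\<close>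
  have "(\<Sum>v \<in> V ?G. f (Vt v) * ordf \<Gamma> f (Vt v)) = 0"
    using h unfolding pts_def by (intro sum.neutral) auto
  moreover have "(\<Sum>v \<in> V ?G. f (Vt v) * ordf \<Gamma> f (Vt v))
     = (\<Sum>v \<in> V ?G. (\<Sum>e \<in> {e \<in> E ?G. fst (ends ?G e) = v}. ?u e * of_int (k e))
         - (\<Sum>e \<in> {e \<in> E ?G. snd (ends ?G e) = v}. ?w e * of_int (k e)))"
  proof (intro sum.cong refl)
    fix v
    have "f (Vt v) * (\<Sum>e \<in> {e \<in> E ?G. fst (ends ?G e) = v}. rslope (fedge \<Gamma> f e) 0)
      = (\<Sum>e \<in> {e \<in> E ?G. fst (ends ?G e) = v}. ?u e * of_int (k e))"
      using k(1) unfolding sum_distrib_left by (intro sum.cong) auto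
    moreover have "f (Vt v) * (\<Sum>e \<in> {e \<in> E ?G. snd (ends ?G e) = v}. lslope (fedge \<Gamma> f e) (snd \<Gamma> e))
      = - (\<Sum>e \<in> {e \<in> E ?G. snd (ends ?G e) = v}. ?w e * of_int (k e))"
      using k(2) unfolding sum_distrib_left sum_negf[symmetric] by (intro sum.cong) auto
    ultimately show "f (Vt v) * ordf \<Gamma> f (Vt v) = (\<Sum>e \<in> {e \<in> E ?G. fst (ends ?G e) = v}. ?u e * of_int (k e))
         - (\<Sum>e \<in> {e \<in> E ?G. snd (ends ?G e) = v}. ?w e * of_int (k e))"
      unfolding ordf_def by (simp add: distrib_left)
  qed
  moreover have "\<dots> = (\<Sum>e \<in> E ?G. ?u e * of_int (k e)) - (\<Sum>e \<in> E ?G. ?w e * of_int (k e))"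
    unfolding sum_subtractf
    using sum.group[OF fin, of "\<lambda>e. fst (ends ?G e)" "\<lambda>e. ?u e * of_int (k e)"]
      sum.group[OF fin, of "\<lambda>e. snd (ends ?G e)" "\<lambda>e. ?w e * of_int (k e)"] metric_graphD(5,6)[OF m]
    by (simp add: image_subset_iff)
  moreover have "\<dots> = - (\<Sum>e \<in> E ?G. (of_int (k e))\<^sup>2 * snd \<Gamma> e)"
    unfolding sum_subtractf[symmetric] sum_negf[symmetric]
    by (intro sum.cong refl) (simp add: k(3) algebra_simps power2_eq_square)
  ultimately have "(\<Sum>e \<in> E ?G. (of_int (k e))\<^sup>2 * snd \<Gamma> e) = 0" by linarith
  moreover have nonneg: "0 \<le> (of_int (k e) :: real)\<^sup>2 * snd \<Gamma> e" if "e \<in> E ?G" for e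
    using metric_graphD(4)[OF m that] by simp
  ultimately have "(of_int (k e0) :: real)\<^sup>2 * snd \<Gamma> e0 = 0"
    using fin(1) e0 nonneg by (subst (asm) sum_nonneg_eq_0_iff) auto
  then show ?thesis using k(1)[OF e0] metric_graphD(4)[OF m e0] by simp
qed

lemma TP_inj:
  assumes m: "metric_graph \<Gamma>" and P: "cyc (fst \<Gamma>) P" "cyc (fst \<Gamma>) P'"
    and l: "lin_equiv \<Gamma> (TP \<Gamma> P) (TP \<Gamma> P')"
  shows "P = P'"
proof -
  obtain f where f: "rational_fun \<Gamma> f" and df: "\<And>p. p \<in> pts \<Gamma> \<Longrightarrow> of_int (TP \<Gamma> P p - TP \<Gamma> P' p) = ordf \<Gamma> f p"
    using l unfolding lin_equiv_def by blast
  let ?d = "\<lambda>p. of_int 1 * fP \<Gamma> P' p + of_int (-1) * fP \<Gamma> P p"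
  \<comment> \<open>Its divisor is 2 (T_P - T_P') + (2 T_P' - K) - (2 T_P - K) = 0. Zero slopes then
    give 2 k plus the difference of two numbers in {0, -1} equal to 0, and parity makes these two
    agree.\<close>
  let ?h = "\<lambda>p. of_int 2 * f p + of_int 1 * ?d p"
  have rd: "rational_fun \<Gamma> ?d" by (rule rational_linear[OF m rational_fP[OF m] rational_fP[OF m]])
  have rh: "rational_fun \<Gamma> ?h" by (rule rational_linear[OF m f rd])
  have "ordf \<Gamma> ?h p = 0" if p: "p \<in> pts \<Gamma>" for p
    unfolding ordf_linear[OF m f rd p] ordf_linear[OF m rational_fP[OF m] rational_fP[OF m] p]
      ordf_fP[OF m P(1) p] ordf_fP[OF m P(2) p] df[OF p, symmetric] by simp
  then have z: "rslope (fedge \<Gamma> ?h e) 0 = 0" if "e \<in> E (fst \<Gamma>)" for e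
    using harmonic_slope_zero[OF m rh _ that] by blast
  have "e \<in> P \<longleftrightarrow> e \<in> P'" if e: "e \<in> E (fst \<Gamma>)" for e
  proof -
    have L: "0 \<le> (0::real)" "0 < snd \<Gamma> e" using metric_graphD(4)[OF m e] by auto
    obtain k :: int where k: "rsl (fedge \<Gamma> f e) 0 (of_int k)" using rational_rsl[OF m f e L] .
    have fp: "rslope (fedge \<Gamma> (fP \<Gamma> Q) e) 0 = of_int (if e \<in> Q then 0 else -1)" for Q
      using rslope_eq[OF rsl_fP[OF L(2) L]] L(2) by simp
    have "0 = of_int 2 * of_int k + of_int 1 * (of_int 1 * of_int (if e \<in> P' then 0 else -1) + of_int (-1) * (of_int (if e \<in> P then 0 else -1) :: real))"
      using z[OF e] unfolding rslope_linear[OF m f rd e L]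
        rslope_linear[OF m rational_fP[OF m] rational_fP[OF m] e L] fp rslope_eq[OF k] by simp
    then have "(of_int (2 * k + (if e \<in> P' then 0 else -1) - (if e \<in> P then 0 else -1)) :: real) = 0" by simp
    then have "2 * k + (if e \<in> P' then 0 else -1) - (if e \<in> P then 0 else -1) = 0"
      unfolding of_int_eq_0_iff .
    then show ?thesis by (auto split: if_splits) presburger+
  qed
  then show ?thesis using P unfolding cyc_def by blast
qed

section \<open>Isomorphisms of tropical curves\<close>

lemma tc_isoD:
  assumes "tc_iso \<Gamma> \<Gamma>' \<phi> \<psi> \<sigma>"
  shows "bij_betw \<phi> (V (fst \<Gamma>)) (V (fst \<Gamma>'))" "bij_betw \<psi> (E (fst \<Gamma>)) (E (fst \<Gamma>'))"
    "\<And>v. v \<in> V (fst \<Gamma>) \<Longrightarrow> wt (fst \<Gamma>') (\<phi> v) = wt (fst \<Gamma>) v"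
    "\<And>e. e \<in> E (fst \<Gamma>) \<Longrightarrow> snd \<Gamma>' (\<psi> e) = snd \<Gamma> e"
    "\<And>e. e \<in> E (fst \<Gamma>) \<Longrightarrow> ends (fst \<Gamma>') (\<psi> e) =
       (if \<sigma> e then (\<phi> (snd (ends (fst \<Gamma>) e)), \<phi> (fst (ends (fst \<Gamma>) e)))
        else (\<phi> (fst (ends (fst \<Gamma>) e)), \<phi> (snd (ends (fst \<Gamma>) e))))"
  using assms unfolding tc_iso_def by (auto simp: map_prod_def split_beta)

lemma tc_isoI:
  assumes "bij_betw \<phi> (V (fst \<Gamma>)) (V (fst \<Gamma>'))" "bij_betw \<psi> (E (fst \<Gamma>)) (E (fst \<Gamma>'))"
    "\<And>v. v \<in> V (fst \<Gamma>) \<Longrightarrow> wt (fst \<Gamma>') (\<phi> v) = wt (fst \<Gamma>) v"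
    "\<And>e. e \<in> E (fst \<Gamma>) \<Longrightarrow> snd \<Gamma>' (\<psi> e) = snd \<Gamma> e"
    "\<And>e. e \<in> E (fst \<Gamma>) \<Longrightarrow> ends (fst \<Gamma>') (\<psi> e) =
       (if \<sigma> e then (\<phi> (snd (ends (fst \<Gamma>) e)), \<phi> (fst (ends (fst \<Gamma>) e)))
        else (\<phi> (fst (ends (fst \<Gamma>) e)), \<phi> (snd (ends (fst \<Gamma>) e))))"
  shows "tc_iso \<Gamma> \<Gamma>' \<phi> \<psi> \<sigma>"
  using assms unfolding tc_iso_def by (auto simp: map_prod_def split_beta)

lemma tc_iso_contr:
  assumes i: "tc_iso \<Gamma> \<Gamma>' \<phi> \<psi> \<sigma>"
  shows "contr (fst \<Gamma>) P (fst \<Gamma>') (\<psi> ` P) {} \<phi> \<psi>"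
  unfolding contr_iff
proof (intro conjI ballI impI)
  note d = tc_isoD[OF i]
  have inj: "inj_on \<phi> (V (fst \<Gamma>))" and im: "\<phi> ` V (fst \<Gamma>) = V (fst \<Gamma>')" using d(1) by (auto simp: bij_betw_def)
  show "\<phi> ` V (fst \<Gamma>) = V (fst \<Gamma>')" by (rule im)
  show "bij_betw \<psi> (E (fst \<Gamma>) - {}) (E (fst \<Gamma>'))" using d(2) by simp
  show "ends (fst \<Gamma>') (\<psi> e) = (\<phi> (fst (ends (fst \<Gamma>) e)), \<phi> (snd (ends (fst \<Gamma>) e))) \<or>
     ends (fst \<Gamma>') (\<psi> e) = (\<phi> (snd (ends (fst \<Gamma>) e)), \<phi> (fst (ends (fst \<Gamma>) e)))"
    if "e \<in> E (fst \<Gamma>) - {}" for e using d(5)[of e] that by auto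
  show "(u, v) \<in> (adj (fst \<Gamma>) {})\<^sup>*" if "u \<in> V (fst \<Gamma>)" "v \<in> V (fst \<Gamma>)" "\<phi> u = \<phi> v" for u v
    using inj_onD[OF inj that(3,1,2)] by simp
  show "int (wt (fst \<Gamma>') v') - 1 = (\<Sum>v | v \<in> V (fst \<Gamma>) \<and> \<phi> v = v'. int (wt (fst \<Gamma>) v) - 1) +
       int (card {e \<in> {}. \<phi> (fst (ends (fst \<Gamma>) e)) = v'})" if v': "v' \<in> V (fst \<Gamma>')" for v'
  proof -
    obtain v where v: "v \<in> V (fst \<Gamma>)" "v' = \<phi> v" using v' im by blast
    then have "{u. u \<in> V (fst \<Gamma>) \<and> \<phi> u = v'} = {v}" using inj_onD[OF inj] by blast
    then show ?thesis using v d(3) by simp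
  qed
qed simp_all

lemma contr_tc_iso:
  assumes c: "contr G P G' P' {} \<phi> \<psi>" and x: "\<And>e. e \<in> E G \<Longrightarrow> x e = x' (\<psi> e)"
  shows "\<exists>\<sigma>. tc_iso (G, x) (G', x') \<phi> \<psi> \<sigma>"
proof -
  note d = contrD[OF c]
  have inj: "inj_on \<phi> (V G)"
  proof (rule inj_onI)
    fix u v assume "u \<in> V G" "v \<in> V G" "\<phi> u = \<phi> v"
    then have "(u, v) \<in> (adj G {})\<^sup>*" by (rule d(6))
    then show "u = v" by (simp add: adj_def)
  qed
  \<comment> \<open>\<open>contr\<close> leaves the orientation open; an edge is flagged as reversed
    when the straight reading fails. For a loop both readings coincide and the flag is
    false.\<close>
  have "tc_iso (G, x) (G', x') \<phi> \<psi> (\<lambda>e. ends G' (\<psi> e) \<noteq> (\<phi> (fst (ends G e)), \<phi> (snd (ends G e))))"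
  proof (rule tc_isoI)
    show "bij_betw \<phi> (V (fst (G, x))) (V (fst (G', x')))" using inj d(2) by (simp add: bij_betw_def)
    show "bij_betw \<psi> (E (fst (G, x))) (E (fst (G', x')))" using d(3) by simp
    show "wt (fst (G', x')) (\<phi> v) = wt (fst (G, x)) v" if "v \<in> V (fst (G, x))" for v
    proof -
      have "{u \<in> V G. \<phi> u = \<phi> v} = {v}" using inj_onD[OF inj] that by auto
      moreover have "\<phi> v \<in> V G'" using that d(2) by auto
      ultimately show ?thesis using d(7)[of "\<phi> v"] by simp
    qed
    show "snd (G', x') (\<psi> e) = snd (G, x) e" if "e \<in> E (fst (G, x))" for e using x that by simp
  qed (use d(5) in auto)
  then show ?thesis by blast
qed

lemma tc_iso_metric_graph:
  assumes i: "tc_iso \<Gamma> \<Gamma>' \<phi> \<psi> \<sigma>" and m: "metric_graph \<Gamma>"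
  shows "metric_graph \<Gamma>'"
proof -
  have "0 < snd \<Gamma>' e'" if e': "e' \<in> E (fst \<Gamma>')" for e'
  proof -
    have "e' \<in> \<psi> ` E (fst \<Gamma>)" using e' tc_isoD(2)[OF i] by (simp add: bij_betw_def)
    then show ?thesis using tc_isoD(4)[OF i] metric_graphD(4)[OF m] by auto
  qed
  then show ?thesis
    using contr_wf_graph[OF tc_iso_contr[OF i] metric_graphD(1)[OF m]] unfolding metric_graph_def by blast
qed

lemma tc_iso_inverse:
  assumes i: "tc_iso \<Gamma> \<Gamma>' \<phi> \<psi> \<sigma>" and m: "metric_graph \<Gamma>"
  obtains \<phi>' \<psi>' \<sigma>' where "tc_iso \<Gamma>' \<Gamma> \<phi>' \<psi>' \<sigma>'"
    "\<And>e. e \<in> E (fst \<Gamma>) \<Longrightarrow> \<psi>' (\<psi> e) = e"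
    "\<And>p. p \<in> pts \<Gamma> \<Longrightarrow> ptmap \<Gamma>' \<phi>' \<psi>' \<sigma>' (ptmap \<Gamma> \<phi> \<psi> \<sigma> p) = p"
    "\<And>q. q \<in> pts \<Gamma>' \<Longrightarrow> ptmap \<Gamma> \<phi> \<psi> \<sigma> (ptmap \<Gamma>' \<phi>' \<psi>' \<sigma>' q) = q"
proof -
  note d = tc_isoD[OF i]
  define \<phi>' where "\<phi>' = inv_into (V (fst \<Gamma>)) \<phi>"
  define \<psi>' where "\<psi>' = inv_into (E (fst \<Gamma>)) \<psi>"
  define \<sigma>' where "\<sigma>' = \<sigma> \<circ> \<psi>'"
  have f1: "\<phi>' (\<phi> v) = v" if "v \<in> V (fst \<Gamma>)" for v
    using that d(1) unfolding \<phi>'_def by (simp add: bij_betw_def)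
  have f2: "\<phi>' v \<in> V (fst \<Gamma>)" "\<phi> (\<phi>' v) = v" if "v \<in> V (fst \<Gamma>')" for v
    using that d(1) unfolding \<phi>'_def by (auto simp: bij_betw_def inv_into_into f_inv_into_f)
  have g1: "\<psi>' (\<psi> e) = e" if "e \<in> E (fst \<Gamma>)" for e
    using that d(2) unfolding \<psi>'_def by (simp add: bij_betw_def)
  have g2: "\<psi>' e \<in> E (fst \<Gamma>)" "\<psi> (\<psi>' e) = e" if "e \<in> E (fst \<Gamma>')" for e
    using that d(2) unfolding \<psi>'_def by (auto simp: bij_betw_def inv_into_into f_inv_into_f)
  have len: "snd \<Gamma> (\<psi>' e) = snd \<Gamma>' e" if "e \<in> E (fst \<Gamma>')" for e
    using d(4)[OF g2(1)[OF that]] g2(2)[OF that] by simp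
  have "tc_iso \<Gamma>' \<Gamma> \<phi>' \<psi>' \<sigma>'"
  proof (rule tc_isoI)
    show "bij_betw \<phi>' (V (fst \<Gamma>')) (V (fst \<Gamma>))" unfolding \<phi>'_def by (rule bij_betw_inv_into[OF d(1)])
    show "bij_betw \<psi>' (E (fst \<Gamma>')) (E (fst \<Gamma>))" unfolding \<psi>'_def by (rule bij_betw_inv_into[OF d(2)])
    show "wt (fst \<Gamma>) (\<phi>' v) = wt (fst \<Gamma>') v" if "v \<in> V (fst \<Gamma>')" for v
      using d(3)[OF f2(1)[OF that]] f2(2)[OF that] by simp
    show "ends (fst \<Gamma>) (\<psi>' e') = (if \<sigma>' e' then (\<phi>' (snd (ends (fst \<Gamma>') e')), \<phi>' (fst (ends (fst \<Gamma>') e')))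
        else (\<phi>' (fst (ends (fst \<Gamma>') e')), \<phi>' (snd (ends (fst \<Gamma>') e'))))" if e': "e' \<in> E (fst \<Gamma>')" for e'
    proof -
      define e where "e = \<psi>' e'"
      have e: "e \<in> E (fst \<Gamma>)" "e' = \<psi> e" using g2[OF e'] by (auto simp: e_def)
      show ?thesis
        unfolding \<sigma>'_def comp_def e_def[symmetric] using d(5)[OF e(1)] e(2) f1 metric_graphD(5,6)[OF m e(1)] by simp
    qed
  qed (rule len)
  moreover have "ptmap \<Gamma>' \<phi>' \<psi>' \<sigma>' (ptmap \<Gamma> \<phi> \<psi> \<sigma> p) = p" if "p \<in> pts \<Gamma>" for p
    using that f1 g1 d(4) unfolding pts_def by (auto simp: ptmap_def \<sigma>'_def)
  moreover have "ptmap \<Gamma> \<phi> \<psi> \<sigma> (ptmap \<Gamma>' \<phi>' \<psi>' \<sigma>' q) = q" if "q \<in> pts \<Gamma>'" for q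
    using that f2 g2 len unfolding pts_def by (auto simp: ptmap_def \<sigma>'_def)
  ultimately show ?thesis using that g1 by blast
qed

lemma tc_iso_comp:
  assumes i: "tc_iso \<Gamma> \<Gamma>' \<phi> \<psi> \<sigma>" and i': "tc_iso \<Gamma>' \<Gamma>'' \<phi>' \<psi>' \<sigma>'"
  shows "tc_iso \<Gamma> \<Gamma>'' (\<phi>' \<circ> \<phi>) (\<psi>' \<circ> \<psi>) (\<lambda>e. \<sigma> e \<noteq> \<sigma>' (\<psi> e))"
proof (rule tc_isoI)
  note d = tc_isoD[OF i] and d' = tc_isoD[OF i']
  show "bij_betw (\<phi>' \<circ> \<phi>) (V (fst \<Gamma>)) (V (fst \<Gamma>''))" by (rule bij_betw_trans[OF d(1) d'(1)])
  show "bij_betw (\<psi>' \<circ> \<psi>) (E (fst \<Gamma>)) (E (fst \<Gamma>''))" by (rule bij_betw_trans[OF d(2) d'(2)])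
  show "wt (fst \<Gamma>'') ((\<phi>' \<circ> \<phi>) v) = wt (fst \<Gamma>) v" if "v \<in> V (fst \<Gamma>)" for v
    using d(3)[OF that] d'(3)[OF bij_betw_apply[OF d(1) that]] by simp
  show "snd \<Gamma>'' ((\<psi>' \<circ> \<psi>) e) = snd \<Gamma> e" if "e \<in> E (fst \<Gamma>)" for e
    using d(4)[OF that] d'(4)[OF bij_betw_apply[OF d(2) that]] by simp
  show "ends (fst \<Gamma>'') ((\<psi>' \<circ> \<psi>) e) = (if \<sigma> e \<noteq> \<sigma>' (\<psi> e)
     then ((\<phi>' \<circ> \<phi>) (snd (ends (fst \<Gamma>) e)), (\<phi>' \<circ> \<phi>) (fst (ends (fst \<Gamma>) e)))
     else ((\<phi>' \<circ> \<phi>) (fst (ends (fst \<Gamma>) e)), (\<phi>' \<circ> \<phi>) (snd (ends (fst \<Gamma>) e))))" if "e \<in> E (fst \<Gamma>)" for e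
    using d(5)[OF that] d'(5)[OF bij_betw_apply[OF d(2) that]] by simp
qed

lemma tc_iso_refl: "(\<And>e. e \<in> E G \<Longrightarrow> l e = l' e) \<Longrightarrow> tc_iso (G, l) (G, l') id id (\<lambda>_. False)"
  by (rule tc_isoI) auto

section \<open>Transport of functions and divisors along isomorphisms\<close>

lemma ptmap_pts:
  assumes i: "tc_iso \<Gamma> \<Gamma>' \<phi> \<psi> \<sigma>" and p: "p \<in> pts \<Gamma>"
  shows "ptmap \<Gamma> \<phi> \<psi> \<sigma> p \<in> pts \<Gamma>'"
  using p tc_isoD(4)[OF i] bij_betw_apply[OF tc_isoD(1)[OF i]] bij_betw_apply[OF tc_isoD(2)[OF i]]
  unfolding pts_def by (auto simp: ptmap_def)

lemma fedge_ptmap: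
  assumes i: "tc_iso \<Gamma> \<Gamma>' \<phi> \<psi> \<sigma>" and m: "metric_graph \<Gamma>" and e: "e \<in> E (fst \<Gamma>)"
  shows "fedge \<Gamma> (f \<circ> ptmap \<Gamma> \<phi> \<psi> \<sigma>) e
     = (\<lambda>t. fedge \<Gamma>' f (\<psi> e) (if \<sigma> e then snd \<Gamma> e - t else t))"
  using tc_isoD(4,5)[OF i e] metric_graphD(4)[OF m e] by (auto simp: fedge_def ptmap_def)

lemma rational_ptmap:
  assumes i: "tc_iso \<Gamma> \<Gamma>' \<phi> \<psi> \<sigma>" and m: "metric_graph \<Gamma>" and f: "rational_fun \<Gamma>' f"
  shows "rational_fun \<Gamma> (f \<circ> ptmap \<Gamma> \<phi> \<psi> \<sigma>)"
  unfolding rational_fun_iff[OF m]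
proof
  fix e assume e: "e \<in> E (fst \<Gamma>)"
  have "loc_pl (fedge \<Gamma>' f (\<psi> e)) (snd \<Gamma> e)"
    using f bij_betw_apply[OF tc_isoD(2)[OF i] e] tc_isoD(4)[OF i e]
    unfolding rational_fun_iff[OF tc_iso_metric_graph[OF i m]] by auto
  then show "loc_pl (fedge \<Gamma> (f \<circ> ptmap \<Gamma> \<phi> \<psi> \<sigma>) e) (snd \<Gamma> e)"
    unfolding fedge_ptmap[OF i m e] using loc_pl_reflect by (cases "\<sigma> e") auto
qed

lemma ordf_Vt:
  assumes "finite (E (fst \<Gamma>))"
  shows "ordf \<Gamma> f (Vt v) = (\<Sum>e \<in> E (fst \<Gamma>). (if fst (ends (fst \<Gamma>) e) = v then rslope (fedge \<Gamma> f e) 0 else 0)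
     + (if snd (ends (fst \<Gamma>) e) = v then lslope (fedge \<Gamma> f e) (snd \<Gamma> e) else 0))"
  using assms unfolding ordf_def by (simp add: sum.distrib sum.inter_filter)

lemma ordf_ptmap:
  assumes i: "tc_iso \<Gamma> \<Gamma>' \<phi> \<psi> \<sigma>" and m: "metric_graph \<Gamma>" and p: "p \<in> pts \<Gamma>"
  shows "ordf \<Gamma> (f \<circ> ptmap \<Gamma> \<phi> \<psi> \<sigma>) p = ordf \<Gamma>' f (ptmap \<Gamma> \<phi> \<psi> \<sigma> p)"
proof (cases p)
  case (Vt v)
  have v: "v \<in> V (fst \<Gamma>)" using p Vt unfolding pts_def by auto
  have inj: "\<phi> a = \<phi> v \<longleftrightarrow> a = v" if "a \<in> V (fst \<Gamma>)" for a
    using that v tc_isoD(1)[OF i] by (auto simp: bij_betw_def inj_on_def)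
  let ?t = "\<lambda>e'. (if fst (ends (fst \<Gamma>') e') = \<phi> v then rslope (fedge \<Gamma>' f e') 0 else 0)
     + (if snd (ends (fst \<Gamma>') e') = \<phi> v then lslope (fedge \<Gamma>' f e') (snd \<Gamma>' e') else 0)"
  have "ordf \<Gamma> (f \<circ> ptmap \<Gamma> \<phi> \<psi> \<sigma>) p = (\<Sum>e \<in> E (fst \<Gamma>). ?t (\<psi> e))"
    unfolding Vt ordf_Vt[OF metric_graphD(2)[OF m]]
  proof (intro sum.cong refl)
    fix e assume e: "e \<in> E (fst \<Gamma>)"
    show "(if fst (ends (fst \<Gamma>) e) = v then rslope (fedge \<Gamma> (f \<circ> ptmap \<Gamma> \<phi> \<psi> \<sigma>) e) 0 else 0)
     + (if snd (ends (fst \<Gamma>) e) = v then lslope (fedge \<Gamma> (f \<circ> ptmap \<Gamma> \<phi> \<psi> \<sigma>) e) (snd \<Gamma> e) else 0) = ?t (\<psi> e)"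
      unfolding fedge_ptmap[OF i m e]
      using tc_isoD(4,5)[OF i e] inj metric_graphD(5,6)[OF m e]
      by (cases "\<sigma> e") (auto simp: rslope_reflect lslope_reflect)
  qed
  also have "\<dots> = (\<Sum>e' \<in> E (fst \<Gamma>'). ?t e')"
    by (rule sum.reindex_bij_betw[OF tc_isoD(2)[OF i]])
  also have "\<dots> = ordf \<Gamma>' f (ptmap \<Gamma> \<phi> \<psi> \<sigma> p)"
    unfolding Vt using ordf_Vt[OF metric_graphD(2)[OF tc_iso_metric_graph[OF i m]]] by (simp add: ptmap_def)
  finally show ?thesis .
next
  case (Ep e t)
  then have e: "e \<in> E (fst \<Gamma>)" using p unfolding pts_def by auto
  then show ?thesis unfolding Ep ordf_def tpt.case fedge_ptmap[OF i m e]
    by (cases "\<sigma> e") (auto simp: rslope_reflect lslope_reflect ptmap_def)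
qed

text \<open>The set on the left is the image of a class as it occurs in \<open>tc_pair_rel\<close>.
  Pulling rational functions back along the isomorphism and along its inverse shows that it is again
  a full linear equivalence class.\<close>

lemma pic_cls_transport:
  assumes i: "tc_iso \<Gamma> \<Gamma>' \<phi> \<psi> \<sigma>" and m: "metric_graph \<Gamma>"
    and D: "D \<in> Div \<Gamma>" "D' \<in> Div \<Gamma>'" "\<And>p. p \<in> pts \<Gamma> \<Longrightarrow> D' (ptmap \<Gamma> \<phi> \<psi> \<sigma> p) = D p"
  shows "{C' \<in> Div \<Gamma>'. \<exists>C \<in> pic_cls \<Gamma> D. \<forall>p \<in> pts \<Gamma>. C' (ptmap \<Gamma> \<phi> \<psi> \<sigma> p) = C p} = pic_cls \<Gamma>' D'"
    (is "?L = _")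
proof -
  have m': "metric_graph \<Gamma>'" by (rule tc_iso_metric_graph[OF i m])
  obtain \<phi>' \<psi>' \<sigma>' where i': "tc_iso \<Gamma>' \<Gamma> \<phi>' \<psi>' \<sigma>'"
    and inv: "\<And>p. p \<in> pts \<Gamma> \<Longrightarrow> ptmap \<Gamma>' \<phi>' \<psi>' \<sigma>' (ptmap \<Gamma> \<phi> \<psi> \<sigma> p) = p"
    "\<And>q. q \<in> pts \<Gamma>' \<Longrightarrow> ptmap \<Gamma> \<phi> \<psi> \<sigma> (ptmap \<Gamma>' \<phi>' \<psi>' \<sigma>' q) = q"
    using tc_iso_inverse[OF i m] by metis
  show ?thesis
  proof (intro equalityI subsetI)
    fix C' assume "C' \<in> ?L"
    then obtain C f where C': "C' \<in> Div \<Gamma>'" and C: "\<forall>p \<in> pts \<Gamma>. C' (ptmap \<Gamma> \<phi> \<psi> \<sigma> p) = C p"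
      and f: "rational_fun \<Gamma> f" "\<forall>p \<in> pts \<Gamma>. of_int (C p - D p) = ordf \<Gamma> f p"
      unfolding pic_cls_def lin_equiv_def by blast
    have "of_int (C' q - D' q) = ordf \<Gamma>' (f \<circ> ptmap \<Gamma>' \<phi>' \<psi>' \<sigma>') q" if q: "q \<in> pts \<Gamma>'" for q
    proof -
      define p where "p = ptmap \<Gamma>' \<phi>' \<psi>' \<sigma>' q"
      have p: "p \<in> pts \<Gamma>" "ptmap \<Gamma> \<phi> \<psi> \<sigma> p = q" using ptmap_pts[OF i' q] inv(2)[OF q] by (simp_all add: p_def)
      have "C' q = C p" "D' q = D p" using C D(3) p by auto
      then show ?thesis unfolding ordf_ptmap[OF i' m' q] p_def[symmetric] using f(2) p(1) by simp
    qed
    then show "C' \<in> pic_cls \<Gamma>' D'"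
      unfolding pic_cls_def lin_equiv_def using C' D(2) rational_ptmap[OF i' m' f(1)] by blast
  next
    fix C' assume "C' \<in> pic_cls \<Gamma>' D'"
    then obtain f where C': "C' \<in> Div \<Gamma>'"
      and f: "rational_fun \<Gamma>' f" "\<forall>p \<in> pts \<Gamma>'. of_int (C' p - D' p) = ordf \<Gamma>' f p"
      unfolding pic_cls_def lin_equiv_def by blast
    \<comment> \<open>Extension by zero off the curve makes the pullback an element of
      \<open>Div\<close>.\<close>
    define C where "C = (\<lambda>p. if p \<in> pts \<Gamma> then C' (ptmap \<Gamma> \<phi> \<psi> \<sigma> p) else 0)"
    have "{p. C p \<noteq> 0} \<subseteq> ptmap \<Gamma>' \<phi>' \<psi>' \<sigma>' ` {q. C' q \<noteq> 0}"
    proof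
      fix p assume "p \<in> {p. C p \<noteq> 0}"
      then have "p \<in> pts \<Gamma>" "C' (ptmap \<Gamma> \<phi> \<psi> \<sigma> p) \<noteq> 0" by (auto simp: C_def split: if_splits)
      then show "p \<in> ptmap \<Gamma>' \<phi>' \<psi>' \<sigma>' ` {q. C' q \<noteq> 0}"
        using inv(1)[of p] by (intro image_eqI[of _ _ "ptmap \<Gamma> \<phi> \<psi> \<sigma> p"]) auto
    qed
    then have "finite {p. C p \<noteq> 0}" using C' finite_subset unfolding Div_def by blast
    moreover have "{p. C p \<noteq> 0} \<subseteq> pts \<Gamma>" by (auto simp: C_def)
    ultimately have CD: "C \<in> Div \<Gamma>" unfolding Div_def by simp
    have "of_int (C p - D p) = ordf \<Gamma> (f \<circ> ptmap \<Gamma> \<phi> \<psi> \<sigma>) p" if p: "p \<in> pts \<Gamma>" for p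
      unfolding ordf_ptmap[OF i m p] using bspec[OF f(2) ptmap_pts[OF i p]] D(3)[OF p] p by (simp add: C_def)
    then have "C \<in> pic_cls \<Gamma> D"
      unfolding pic_cls_def lin_equiv_def using CD D(1) rational_ptmap[OF i m f(1)] by blast
    moreover have "\<forall>p \<in> pts \<Gamma>. C' (ptmap \<Gamma> \<phi> \<psi> \<sigma> p) = C p" by (simp add: C_def)
    ultimately show "C' \<in> ?L" using C' by blast
  qed
qed

text \<open>The divisor is canonical: midpoints are fixed under reversal of an edge, and degrees in
  \<open>P\<close> are preserved since nothing is contracted.\<close>

lemma TP_ptmap:
  assumes i: "tc_iso \<Gamma> \<Gamma>' \<phi> \<psi> \<sigma>" and m: "metric_graph \<Gamma>" and P: "P \<subseteq> E (fst \<Gamma>)" and p: "p \<in> pts \<Gamma>"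
  shows "TP \<Gamma>' (\<psi> ` P) (ptmap \<Gamma> \<phi> \<psi> \<sigma> p) = TP \<Gamma> P p"
proof (cases p)
  case (Vt v)
  have v: "v \<in> V (fst \<Gamma>)" "\<phi> v \<in> V (fst \<Gamma>')"
    using p Vt bij_betw_apply[OF tc_isoD(1)[OF i]] unfolding pts_def by auto
  have "{u \<in> V (fst \<Gamma>). \<phi> u = \<phi> v} = {v}"
    using v tc_isoD(1)[OF i] by (auto simp: bij_betw_def inj_on_def)
  then have "degP (fst \<Gamma>') (\<psi> ` P) (\<phi> v) = degP (fst \<Gamma>) P v"
    using contr_degP[OF tc_iso_contr[OF i, of P] metric_graphD(1)[OF m] P, of "\<phi> v"] by simp
  then show ?thesis using Vt v tc_isoD(3)[OF i] by (simp add: TP_def ptmap_def)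
next
  case (Ep e t)
  then have e: "e \<in> E (fst \<Gamma>)" using p unfolding pts_def by auto
  have "\<psi> e \<in> E (fst \<Gamma>') - \<psi> ` P \<longleftrightarrow> e \<in> E (fst \<Gamma>) - P"
    using e P tc_isoD(2)[OF i] unfolding bij_betw_def inj_on_def by blast
  then show ?thesis using Ep tc_isoD(4)[OF i e] by (auto simp: TP_def ptmap_def)
qed

section \<open>Isomorphism classes of curves with a theta-characteristic\<close>

lemma tc_pair_rel_iff:
  "((\<Gamma>, \<theta>), (\<Gamma>', \<theta>')) \<in> tc_pair_rel \<longleftrightarrow> (\<exists>\<phi> \<psi> \<sigma>. tc_iso \<Gamma> \<Gamma>' \<phi> \<psi> \<sigma> \<and>
      \<theta>' = {D' \<in> Div \<Gamma>'. \<exists>D \<in> \<theta>. \<forall>p \<in> pts \<Gamma>. D' (ptmap \<Gamma> \<phi> \<psi> \<sigma> p) = D p})"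
  unfolding tc_pair_rel_def by blast

lemma tc_pair_rel_TP_iff:
  assumes m: "metric_graph \<Gamma>" and P: "P \<subseteq> E (fst \<Gamma>)"
  shows "((\<Gamma>, pic_cls \<Gamma> (TP \<Gamma> P)), (\<Gamma>', \<theta>')) \<in> tc_pair_rel \<longleftrightarrow>
     (\<exists>\<phi> \<psi> \<sigma>. tc_iso \<Gamma> \<Gamma>' \<phi> \<psi> \<sigma> \<and> \<theta>' = pic_cls \<Gamma>' (TP \<Gamma>' (\<psi> ` P)))"
proof -
  have "{D' \<in> Div \<Gamma>'. \<exists>D \<in> pic_cls \<Gamma> (TP \<Gamma> P). \<forall>p \<in> pts \<Gamma>. D' (ptmap \<Gamma> \<phi> \<psi> \<sigma> p) = D p}
     = pic_cls \<Gamma>' (TP \<Gamma>' (\<psi> ` P))" if i: "tc_iso \<Gamma> \<Gamma>' \<phi> \<psi> \<sigma>" for \<phi> \<psi> \<sigma>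
    by (rule pic_cls_transport[OF i m])
      (use canon_TP_in_Div m tc_iso_metric_graph[OF i m] TP_ptmap[OF i m P] in auto)
  then have "tc_iso \<Gamma> \<Gamma>' \<phi> \<psi> \<sigma> \<and>
      \<theta>' = {D' \<in> Div \<Gamma>'. \<exists>D \<in> pic_cls \<Gamma> (TP \<Gamma> P). \<forall>p \<in> pts \<Gamma>. D' (ptmap \<Gamma> \<phi> \<psi> \<sigma> p) = D p}
    \<longleftrightarrow> tc_iso \<Gamma> \<Gamma>' \<phi> \<psi> \<sigma> \<and> \<theta>' = pic_cls \<Gamma>' (TP \<Gamma>' (\<psi> ` P))" for \<phi> \<psi> \<sigma>
    by (simp cong: conj_cong)
  then show ?thesis unfolding tc_pair_rel_iff by simp
qed

lemma tc_iso_cyc: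
  assumes i: "tc_iso \<Gamma> \<Gamma>' \<phi> \<psi> \<sigma>" and m: "metric_graph \<Gamma>" and P: "cyc (fst \<Gamma>) P"
  shows "cyc (fst \<Gamma>') (\<psi> ` P)"
proof -
  have PE: "P \<subseteq> E (fst \<Gamma>)" using P unfolding cyc_def by simp
  have "even (degP (fst \<Gamma>') (\<psi> ` P) v')" for v'
  proof -
    have "even (\<Sum>v \<in> {v \<in> V (fst \<Gamma>). \<phi> v = v'}. degP (fst \<Gamma>) P v)"
      using P unfolding cyc_def by (intro dvd_sum) auto
    then show ?thesis
      using contr_degP[OF tc_iso_contr[OF i, of P] metric_graphD(1)[OF m] PE, of v'] by simp
  qed
  moreover have "\<psi> ` P \<subseteq> E (fst \<Gamma>')" using PE tc_isoD(2)[OF i] by (auto simp: bij_betw_def)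
  ultimately show ?thesis unfolding cyc_def by simp
qed

lemma tc_pair_class_subset:
  assumes m: "metric_graph \<Gamma>" and P: "P \<subseteq> E (fst \<Gamma>)" and i: "tc_iso \<Gamma> \<Gamma>' \<phi> \<psi> \<sigma>"
  shows "tc_pair_rel `` {(\<Gamma>', pic_cls \<Gamma>' (TP \<Gamma>' (\<psi> ` P)))} \<subseteq> tc_pair_rel `` {(\<Gamma>, pic_cls \<Gamma> (TP \<Gamma> P))}"
proof (rule subsetI)
  fix z assume z: "z \<in> tc_pair_rel `` {(\<Gamma>', pic_cls \<Gamma>' (TP \<Gamma>' (\<psi> ` P)))}"
  obtain \<Gamma>'' \<theta>'' where zeq: "z = (\<Gamma>'', \<theta>'')" by (cases z)
  have P': "\<psi> ` P \<subseteq> E (fst \<Gamma>')" using P tc_isoD(2)[OF i] by (auto simp: bij_betw_def)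
  have "((\<Gamma>', pic_cls \<Gamma>' (TP \<Gamma>' (\<psi> ` P))), (\<Gamma>'', \<theta>'')) \<in> tc_pair_rel"
    using z unfolding zeq by simp
  then obtain \<phi>' \<psi>' \<sigma>' where i': "tc_iso \<Gamma>' \<Gamma>'' \<phi>' \<psi>' \<sigma>'" "\<theta>'' = pic_cls \<Gamma>'' (TP \<Gamma>'' (\<psi>' ` \<psi> ` P))"
    unfolding tc_pair_rel_TP_iff[OF tc_iso_metric_graph[OF i m] P'] by blast
  then have "((\<Gamma>, pic_cls \<Gamma> (TP \<Gamma> P)), (\<Gamma>'', \<theta>'')) \<in> tc_pair_rel"
    unfolding tc_pair_rel_TP_iff[OF m P] using tc_iso_comp[OF i i'(1)] by (metis image_comp)
  then show "z \<in> tc_pair_rel `` {(\<Gamma>, pic_cls \<Gamma> (TP \<Gamma> P))}" unfolding zeq by simp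
qed

text \<open>Two inclusions: one from composing with the isomorphism, the other from its inverse,
  which carries the image of \<open>P\<close> back to \<open>P\<close>.\<close>

lemma tc_pair_class_eq:
  assumes m: "metric_graph \<Gamma>" and P: "P \<subseteq> E (fst \<Gamma>)" and i: "tc_iso \<Gamma> \<Gamma>' \<phi> \<psi> \<sigma>"
  shows "tc_pair_rel `` {(\<Gamma>, pic_cls \<Gamma> (TP \<Gamma> P))} = tc_pair_rel `` {(\<Gamma>', pic_cls \<Gamma>' (TP \<Gamma>' (\<psi> ` P)))}"
proof -
  obtain \<phi>' \<psi>' \<sigma>' where i': "tc_iso \<Gamma>' \<Gamma> \<phi>' \<psi>' \<sigma>'" and inv: "\<And>e. e \<in> E (fst \<Gamma>) \<Longrightarrow> \<psi>' (\<psi> e) = e"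
    using tc_iso_inverse[OF i m] by metis
  have P': "\<psi> ` P \<subseteq> E (fst \<Gamma>')" using P tc_isoD(2)[OF i] by (auto simp: bij_betw_def)
  have "\<psi>' ` \<psi> ` P = P" using inv P by (force simp: image_image)
  then show ?thesis
    using tc_pair_class_subset[OF m P i] tc_pair_class_subset[OF tc_iso_metric_graph[OF i m] P' i'] by simp
qed

lemma tc_pair_class_eq_iff:
  assumes m: "metric_graph \<Gamma>" "metric_graph \<Gamma>'" and P: "cyc (fst \<Gamma>) P" "cyc (fst \<Gamma>') P'"
  shows "tc_pair_rel `` {(\<Gamma>, pic_cls \<Gamma> (TP \<Gamma> P))} = tc_pair_rel `` {(\<Gamma>', pic_cls \<Gamma>' (TP \<Gamma>' P'))} \<longleftrightarrow>
     (\<exists>\<phi> \<psi> \<sigma>. tc_iso \<Gamma> \<Gamma>' \<phi> \<psi> \<sigma> \<and> P' = \<psi> ` P)" (is "?L \<longleftrightarrow> ?R")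
proof
  have PE: "P \<subseteq> E (fst \<Gamma>)" "P' \<subseteq> E (fst \<Gamma>')" using P unfolding cyc_def by auto
  {
    assume ?L
    have "tc_iso \<Gamma>' \<Gamma>' id id (\<lambda>_. False)" using tc_iso_refl[of "fst \<Gamma>'" "snd \<Gamma>'" "snd \<Gamma>'"] by simp
    then have "((\<Gamma>', pic_cls \<Gamma>' (TP \<Gamma>' P')), (\<Gamma>', pic_cls \<Gamma>' (TP \<Gamma>' P'))) \<in> tc_pair_rel"
      unfolding tc_pair_rel_TP_iff[OF m(2) PE(2)] by (metis image_id id_apply)
    then have "((\<Gamma>, pic_cls \<Gamma> (TP \<Gamma> P)), (\<Gamma>', pic_cls \<Gamma>' (TP \<Gamma>' P'))) \<in> tc_pair_rel" using \<open>?L\<close> by blast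
    then obtain \<phi> \<psi> \<sigma> where i: "tc_iso \<Gamma> \<Gamma>' \<phi> \<psi> \<sigma>" "pic_cls \<Gamma>' (TP \<Gamma>' P') = pic_cls \<Gamma>' (TP \<Gamma>' (\<psi> ` P))"
      unfolding tc_pair_rel_TP_iff[OF m(1) PE(1)] by blast
    then have "lin_equiv \<Gamma>' (TP \<Gamma>' P') (TP \<Gamma>' (\<psi> ` P))"
      using pic_cls_eq_iff[OF m(2) canon_TP_in_Div(2)[OF m(2)]] by blast
    then have "P' = \<psi> ` P" by (rule TP_inj[OF m(2) P(2) tc_iso_cyc[OF i(1) m(1) P(1)]])
    then show ?R using i by blast
  }
  assume ?R
  then show ?L using tc_pair_class_eq[OF m(1) PE(1)] by blast
qed

text \<open>Two surjections from \<open>N\<close> with the same fibres. It is applied to interior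
  points, mapped to their colimit class and to the isomorphism class of the curve.\<close>

lemma bij_betw_of_common_cover:
  assumes "a ` N = A" "b ` N = B" "\<And>n n'. n \<in> N \<Longrightarrow> n' \<in> N \<Longrightarrow> a n = a n' \<longleftrightarrow> b n = b n'"
  shows "\<exists>F. bij_betw F A B \<and> (\<forall>n \<in> N. F (a n) = b n)"
proof -
  define F where "F = b \<circ> inv_into N a"
  have F: "F (a n) = b n" if "n \<in> N" for n
  proof -
    have "inv_into N a (a n) \<in> N" "a (inv_into N a (a n)) = a n"
      using that by (auto intro: inv_into_into f_inv_into_f)
    then show ?thesis using assms(3)[of _ n] that by (simp add: F_def)
  qed
  have "inj_on F A" unfolding assms(1)[symmetric] by (rule inj_onI) (use F assms(3) in force)
  moreover have "F ` A = B" unfolding assms(1,2)[symmetric] image_image using F by (intro image_cong) auto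
  ultimately show ?thesis using F unfolding bij_betw_def by blast
qed

section \<open>The generalized cone complex of tropical theta-characteristics\<close>

lemma points_bijection:
  "\<exists>F. bij_betw F (Tg g) (TC g) \<and>
        (\<forall>G P x. (G, P) \<in> Obj g \<longrightarrow> x \<in> cone_int G \<longrightarrow>
           F (cls g ((G, P), x)) = tc_pair_rel `` {((G, x), pic_cls (G, x) (TP (G, x) P))})"
proof -
  define N where "N = {((G, P), x) | G P x. (G, P) \<in> Obj g \<and> x \<in> cone_int G}"
  define b where "b = (\<lambda>((G, P), x). tc_pair_rel `` {((G, x), pic_cls (G, x) (TP (G, x) P))})"
  have metric: "metric_graph (G, x)" if "(G, P) \<in> Obj g" "x \<in> cone_int G" for G P x
    using ObjD(1)[OF that(1)] that(2) by (simp add: metric_graph_def cone_int_def)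
  have a: "cls g ` N = Tg g"
    unfolding Tg_eq_strata strat_def N_def by force
  have b: "b ` N = TC g"
  proof (intro equalityI subsetI)
    fix c assume "c \<in> b ` N"
    then obtain G P x where n: "(G, P) \<in> Obj g" "x \<in> cone_int G"
      and c: "c = tc_pair_rel `` {((G, x), pic_cls (G, x) (TP (G, x) P))}"
      unfolding N_def b_def by auto
    have "trop_curve g (G, x)" using n ObjD(3,4)[OF n(1)] by (simp add: trop_curve_def cone_int_def)
    moreover have "pic_cls (G, x) (TP (G, x) P) \<in> theta_chars (G, x)"
      using TP_theta_char[OF metric[OF n]] ObjD(5)[OF n(1)] by simp
    ultimately show "c \<in> TC g" unfolding TC_def c by (intro quotientI) simp
  next
    fix c assume "c \<in> TC g"
    then obtain G l \<theta> where t: "trop_curve g (G, l)" "\<theta> \<in> theta_chars (G, l)"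
      and c: "c = tc_pair_rel `` {((G, l), \<theta>)}"
      unfolding TC_def by (auto elim!: quotientE)
    have m: "metric_graph (G, l)"
      using t(1) by (simp add: trop_curve_def metric_graph_def stable_graph_def wf_graph_def)
    obtain D where D: "\<theta> = pic_cls (G, l) D" "D \<in> Div (G, l)" "lin_equiv (G, l) (\<lambda>p. 2 * D p) (canon (G, l))"
      using t(2) unfolding theta_chars_def by blast
    obtain P where P: "cyc G P" "lin_equiv (G, l) D (TP (G, l) P)"
      using theta_char_TP[OF m D(2,3)] by auto
    have \<theta>: "\<theta> = pic_cls (G, l) (TP (G, l) P)" using D(1) P(2) pic_cls_eq_iff[OF m D(2)] by simp
    \<comment> \<open>A tropical curve may have arbitrary length values off its edges, whereas
      points of cones vanish there. Truncation changes the curve only by an isomorphism.\<close>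
    define x where "x = (\<lambda>e. if e \<in> E G then l e else 0)"
    have i: "tc_iso (G, l) (G, x) id id (\<lambda>_. False)" by (rule tc_iso_refl) (simp add: x_def)
    have "P \<subseteq> E (fst (G, l))" using P(1) by (simp add: cyc_def)
    from tc_pair_class_eq[OF m this i] have "c = b ((G, P), x)" unfolding c \<theta> b_def by simp
    moreover have "((G, P), x) \<in> N"
      using t(1) P(1) unfolding N_def Obj_def trop_curve_def cone_int_def x_def by simp
    ultimately show "c \<in> b ` N" by blast
  qed
  have "cls g n = cls g n' \<longleftrightarrow> b n = b n'" if nn: "n \<in> N" "n' \<in> N" for n n'
  proof -
    obtain G P x G' P' x' where eq: "n = ((G, P), x)" "n' = ((G', P'), x')"
      and o: "(G, P) \<in> Obj g" "(G', P') \<in> Obj g" and x: "x \<in> cone_int G" "x' \<in> cone_int G'"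
      using nn unfolding N_def by auto
    have "(\<exists>\<phi> \<psi>. contr G P G' P' {} \<phi> \<psi> \<and> x = iota G {} \<psi> x')
       \<longleftrightarrow> (\<exists>\<phi> \<psi> \<sigma>. tc_iso (G, x) (G', x') \<phi> \<psi> \<sigma> \<and> P' = \<psi> ` P)"
    proof
      assume "\<exists>\<phi> \<psi>. contr G P G' P' {} \<phi> \<psi> \<and> x = iota G {} \<psi> x'"
      then obtain \<phi> \<psi> where c: "contr G P G' P' {} \<phi> \<psi>" "x = iota G {} \<psi> x'" by blast
      have "x e = x' (\<psi> e)" if "e \<in> E G" for e using c(2) that by (simp add: iota_def)
      then have "\<exists>\<sigma>. tc_iso (G, x) (G', x') \<phi> \<psi> \<sigma>" by (rule contr_tc_iso[OF c(1)])
      then show "\<exists>\<phi> \<psi> \<sigma>. tc_iso (G, x) (G', x') \<phi> \<psi> \<sigma> \<and> P' = \<psi> ` P"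
        using contrD(8)[OF c(1)] by auto
    next
      assume "\<exists>\<phi> \<psi> \<sigma>. tc_iso (G, x) (G', x') \<phi> \<psi> \<sigma> \<and> P' = \<psi> ` P"
      then obtain \<phi> \<psi> \<sigma> where i: "tc_iso (G, x) (G', x') \<phi> \<psi> \<sigma>" "P' = \<psi> ` P" by blast
      have "x = iota G {} \<psi> x'"
        using tc_isoD(4)[OF i(1)] x(1) by (auto simp: iota_def cone_int_def)
      then show "\<exists>\<phi> \<psi>. contr G P G' P' {} \<phi> \<psi> \<and> x = iota G {} \<psi> x'"
        using tc_iso_contr[OF i(1), of P] i(2) by auto
    qed
    then show ?thesis
      using ceq_interior_iff[OF o x] ObjD(5)[OF o(1)] ObjD(5)[OF o(2)]
        tc_pair_class_eq_iff[OF metric[OF o(1) x(1)] metric[OF o(2) x(2)], of P P']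
      unfolding eq cls_eq_iff b_def by simp
  qed
  from bij_betw_of_common_cover[OF a b this] obtain F
    where "bij_betw F (Tg g) (TC g)" and F: "\<forall>n \<in> N. F (cls g n) = b n" by blast
  moreover have "F (cls g ((G, P), x)) = tc_pair_rel `` {((G, x), pic_cls (G, x) (TP (G, x) P))}"
    if "(G, P) \<in> Obj g" "x \<in> cone_int G" for G P x
    using F that unfolding N_def b_def by fastforce
  ultimately show ?thesis by blast
qed

text \<open>Purity is expressed combinatorially: the dimension of a cone is its number of edges, and
  lying below an object with \<open>3 * g - 3\<close> edges means, by the closure relations, lying
  in the closure of a top-dimensional stratum.\<close>

theorem theorem4p1:
  fixes g :: nat
  assumes "g \<ge> 2"
  shows
    \<comment> \<open>(1) points <-> isomorphism classes of (Gamma, theta), naturally\<close>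
    "(\<exists>F. bij_betw F (Tg g) (TC g) \<and>
        (\<forall>G P x. (G, P) \<in> Obj g \<longrightarrow> x \<in> cone_int G \<longrightarrow>
           F (cls g ((G, P), x)) = tc_pair_rel `` {((G, x), pic_cls (G, x) (TP (G, x) P))}))
   \<and> \<comment> \<open>(1) stratification over isomorphism classes of pairs (G,P)\<close>
     Tg g = (\<Union>GP \<in> Obj g. strat g (fst GP) (snd GP))
   \<and> (\<forall>GP \<in> Obj g. \<forall>GP' \<in> Obj g.
        (pair_iso GP GP' \<longrightarrow> strat g (fst GP) (snd GP) = strat g (fst GP') (snd GP')) \<and>
        (\<not> pair_iso GP GP' \<longrightarrow> strat g (fst GP) (snd GP) \<inter> strat g (fst GP') (snd GP') = {}))
   \<and> \<comment> \<open>(2) T_(G,P) = open cone / Aut(G,P)\<close>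
     (\<forall>(G, P) \<in> Obj g.
        quotient_map (subtopology euclidean (cone_int G)) (subtopology (Ttop g) (strat g G P))
                     (\<lambda>x. cls g ((G, P), x)) \<and>
        (\<forall>x \<in> cone_int G. \<forall>y \<in> cone_int G.
           cls g ((G, P), x) = cls g ((G, P), y) \<longleftrightarrow>
           (\<exists>\<phi> \<psi>. contr G P G P {} \<phi> \<psi> \<and> y = iota G {} \<psi> x)))
   \<and> \<comment> \<open>(3) connected, pure of dimension 3g-3\<close>
     connected_space (Ttop g)
   \<and> (\<forall>(G, P) \<in> Obj g. card (E G) \<le> 3 * g - 3)
   \<and> (\<forall>(G, P) \<in> Obj g. \<exists>(G', P') \<in> Obj g. card (E G') = 3 * g - 3 \<and> pair_ge (G', P') (G, P))
   \<and> \<comment> \<open>(4) closure relations\<close>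
     (\<forall>(G, P) \<in> Obj g. \<forall>(G', P') \<in> Obj g.
        strat g G' P' \<subseteq> Ttop g closure_of (strat g G P) \<longleftrightarrow> pair_ge (G, P) (G', P'))"
proof (intro conjI points_bijection Tg_eq_strata connected_Ttop[OF assms] ballI impI)
  fix GP GP' assume o: "GP \<in> Obj g" "GP' \<in> Obj g"
  show "strat g (fst GP) (snd GP) = strat g (fst GP') (snd GP')" if "pair_iso GP GP'"
    using strat_iso[OF o that] .
  show "strat g (fst GP) (snd GP) \<inter> strat g (fst GP') (snd GP') = {}" if "\<not> pair_iso GP GP'"
    using strat_disjoint[OF o that] .
next
  fix GP assume "GP \<in> Obj g"
  then show "case GP of (G, P) \<Rightarrow>
        quotient_map (subtopology euclidean (cone_int G)) (subtopology (Ttop g) (strat g G P))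
                     (\<lambda>x. cls g ((G, P), x)) \<and>
        (\<forall>x \<in> cone_int G. \<forall>y \<in> cone_int G.
           cls g ((G, P), x) = cls g ((G, P), y) \<longleftrightarrow>
           (\<exists>\<phi> \<psi>. contr G P G P {} \<phi> \<psi> \<and> y = iota G {} \<psi> x))"
    using quotient_map_strat cls_strat_interior_iff by (cases GP) simp
next
  fix GP assume "GP \<in> Obj g"
  then show "case GP of (G, P) \<Rightarrow> card (E G) \<le> 3 * g - 3" using card_E_le by (cases GP) simp
next
  fix GP assume "GP \<in> Obj g"
  then show "case GP of (G, P) \<Rightarrow>
      \<exists>(G', P') \<in> Obj g. card (E G') = 3 * g - 3 \<and> pair_ge (G', P') (G, P)"
    using exists_top_dimensional by (cases GP) simp
next
  fix GP assume "GP \<in> Obj g"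
  then show "case GP of (G, P) \<Rightarrow> \<forall>(G', P') \<in> Obj g.
        strat g G' P' \<subseteq> Ttop g closure_of (strat g G P) \<longleftrightarrow> pair_ge (G, P) (G', P')"
    by (cases GP) (simp add: split_beta strat_closure_iff)
qed

end
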